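(* Let $d\ge1$ and let $c(t)=(c_{ij}(t))$, $t\in\mathbb R$, be a symmetric $d\times d$ matrix with Borel measurable, locally bounded entries, such that $c(t)$ is non-negative definite for all $t$ and, for some integer $1\le p_0\le d$, $$\sum_{i,j=1}^d c_{ij}(t)\xi_i\xi_j\ \ge\ \sum_{j=1}^{p_0}\xi_j^2\qquad\text{for all }t\in\mathbb R,\ \xi\in\mathbb R^d.$$ Then for every $p\in(1,\infty)$ there is a constant $M_0=M_0(d,p,p_0)$ depending only on $d,p,p_0$ such that for all $u\in C_0^\infty(\mathbb R^{d+1})$ and all $i,j\in\{1,\dots,p_0\}$, $$\|u_{x_ix_j}\|_{L^p(\mathbb R^{d+1})}\le M_0\,\|u_t+Lu\|_{L^p(\mathbb R^{d+1})},$$ where $Lu(t,x)=\sum_{i,j=1}^d c_{ij}(t)u_{x_ix_j}(t,x)$.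
   Context: $L^p$ norms are with respect to Lebesgue measure on $\mathbb R^{d+1}$. The constant $M_0$ does not depend on the coefficients $c_{ij}$ (in particular no upper bound on $c$ is assumed). *)

theory Defs
  imports "HOL-Analysis.Analysis"
begin

text \<open>Points of R^(d+1) are pairs (t, x) with t real and x :: real^'n, d = CARD('n).
  The coordinates x_1,...,x_d are the elements of the finite linearly ordered index type 'n,
  enumerated in increasing order.\<close>

definition pderiv :: "('a::real_normed_vector) \<Rightarrow> ('a \<Rightarrow> real) \<Rightarrow> 'a \<Rightarrow> real" where
  "pderiv v f z = deriv (\<lambda>s. f (z + s *\<^sub>R v)) 0"

fun iter_pderiv :: "('a::real_normed_vector) list \<Rightarrow> ('a \<Rightarrow> real) \<Rightarrow> 'a \<Rightarrow> real" where
  "iter_pderiv [] f = f"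
| "iter_pderiv (v # vs) f = pderiv v (iter_pderiv vs f)"

definition smooth :: "('a::real_normed_vector \<Rightarrow> real) \<Rightarrow> bool" where
  "smooth f \<longleftrightarrow> (\<forall>vs z. iter_pderiv vs f differentiable (at z))"

definition C0_infty :: "('a::real_normed_vector \<Rightarrow> real) \<Rightarrow> bool" where
  "C0_infty f \<longleftrightarrow> smooth f \<and> (\<exists>K. compact K \<and> (\<forall>z. z \<notin> K \<longrightarrow> f z = 0))"

definition e_t :: "real \<times> (real^'n)" where "e_t = (1, 0)"
definition e_x :: "'n \<Rightarrow> real \<times> (real^'n)" where "e_x i = (0, axis i 1)"

definition Lp_norm :: "real \<Rightarrow> ('a::euclidean_space \<Rightarrow> real) \<Rightarrow> real" where
  "Lp_norm p f = (\<integral>z. \<bar>f z\<bar> powr p \<partial>lebesgue) powr (1 / p)"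

definition first_coords :: "nat \<Rightarrow> ('n::{finite,linorder}) set" where
  "first_coords p0 = {j. card {k. k < j} < p0}"

definition Lop :: "(real \<Rightarrow> real^'n^'n) \<Rightarrow> (real \<times> (real^'n) \<Rightarrow> real) \<Rightarrow> real \<times> (real^'n) \<Rightarrow> real" where
  "Lop c u z = (\<Sum>i\<in>UNIV. \<Sum>j\<in>UNIV. c (fst z) $ i $ j * pderiv (e_x i) (pderiv (e_x j) u) z)"

end

theory Submission
  imports Defs
begin

text \<open>By polarization it suffices to bound the second derivative of u in one direction xi such
  that c(t) - xi xi^T is non-negative definite. Time is discretized with step h^2/4: the part
  xi xi^T of the operator becomes a lazy random walk along xi with step h, and the remainder
  sum_l sigma_l(t) sigma_l(t)^T becomes a random jump by a multiple of one of the vectors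
  sigma_l(t) or - sigma_l(t).

  The jumps can be conditioned on and removed by translating the data, so by Jensen's inequality
  they do not change the constant. What remains is the lazy walk on the lattice of all times and
  of all positions along xi, where the l^p bound is Calderon-Zygmund theory on a countable set:
  an energy estimate gives l^2, and the kernel satisfies Hormander's condition with respect to
  parabolic boxes. Letting h tend to 0, Fatou's lemma on the left and dominated convergence on
  the right give the estimate; the convergence is pointwise in t, hence mere measurability of c
  suffices.\<close>

subsection \<open>The kernel of the lazy random walk\<close>

text \<open>The coefficients depend on time only, so every step of the scheme commutes with
  translations in x. That is what lets a jump be traded for a translation of the data, and it
  explains why the size of c never enters the constant: the jumps may be as long as they like. The
  walk has to be lazy. Its symbol cos^2(theta/2) is non-negative, whereas the plain walk has symbol
  cos theta, which reaches -1; the alternating mode would then not decay, the energy argument would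
  fail, and the kernel would have no regularity in time. The time step h^2/4 is forced by this
  choice, because one lazy step adds a quarter of a second difference. On the lattice every estimate
  is stated for arbitrary finite sets with a constant independent of the set, so that no infinite
  sum, Fourier transform or principal value appears there. Since the operator is u_t + Lu, the
  scheme marches from late to early times, and the vanishing of u at late times is the zero initial
  value.\<close>

definition lstep :: "(int \<Rightarrow> real) \<Rightarrow> int \<Rightarrow> real" where
  "lstep g k = (g (k - 1) + 2 * g k + g (k + 1)) / 4"

definition fdiff :: "(int \<Rightarrow> real) \<Rightarrow> int \<Rightarrow> real" where
  "fdiff g k = g (k + 1) - g k"

text \<open>Two fair coin steps of length 1/2 make one lazy step, so \<open>lazy_walk m j\<close> is
  the binomial probability (2m choose m + j) / 4^m. The recursion is kept as the definition because
  it is the discrete heat equation on which the later arguments rest.\<close>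

primrec lazy_walk :: "nat \<Rightarrow> int \<Rightarrow> real" where
  "lazy_walk 0 = (\<lambda>j. if j = 0 then 1 else 0)"
| "lazy_walk (Suc m) = lstep (lazy_walk m)"

text \<open>Windows {-L..L} replace sums over all integers. The function must vanish at the two end
  points as well, since a unit shift pushes one point out of the window and brings another
  in.\<close>

lemma sum_shift_int:
  fixes h :: "int \<Rightarrow> real"
  assumes "\<And>j. L \<le> \<bar>j\<bar> \<Longrightarrow> h j = 0"
  shows "(\<Sum>j\<in>{-L..L}. h (j - 1)) = (\<Sum>j\<in>{-L..L}. h j)"
    and "(\<Sum>j\<in>{-L..L}. h (j + 1)) = (\<Sum>j\<in>{-L..L}. h j)"
proof -
  have "(\<Sum>j\<in>{-L..L}. h (j - 1)) = (\<Sum>j\<in>{-L-1..L-1}. h j)"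
    by (rule sum.reindex_bij_witness[of _ "\<lambda>j. j + 1" "\<lambda>j. j - 1"]) auto
  also have "\<dots> = (\<Sum>j\<in>{-L-1..L}. h j)"
    by (rule sum.mono_neutral_left) (auto intro!: assms)
  also have "\<dots> = (\<Sum>j\<in>{-L..L}. h j)"
    by (rule sum.mono_neutral_right) (auto intro!: assms)
  finally show "(\<Sum>j\<in>{-L..L}. h (j - 1)) = (\<Sum>j\<in>{-L..L}. h j)" .
  have "(\<Sum>j\<in>{-L..L}. h (j + 1)) = (\<Sum>j\<in>{-L+1..L+1}. h j)"
    by (rule sum.reindex_bij_witness[of _ "\<lambda>j. j - 1" "\<lambda>j. j + 1"]) auto
  also have "\<dots> = (\<Sum>j\<in>{-L..L+1}. h j)"
    by (rule sum.mono_neutral_left) (auto intro!: assms)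
  also have "\<dots> = (\<Sum>j\<in>{-L..L}. h j)"
    by (rule sum.mono_neutral_right) (auto intro!: assms)
  finally show "(\<Sum>j\<in>{-L..L}. h (j + 1)) = (\<Sum>j\<in>{-L..L}. h j)" .
qed

lemma lstep_self_adjoint:
  assumes "\<And>j. L \<le> \<bar>j\<bar> \<Longrightarrow> g j = 0"
  shows "(\<Sum>j\<in>{-L..L}. lstep g j * h j) = (\<Sum>j\<in>{-L..L}. g j * lstep h j)"
proof -
  have 1: "(\<Sum>j\<in>{-L..L}. g (j - 1) * h j) = (\<Sum>j\<in>{-L..L}. g j * h (j + 1))"
    using sum_shift_int(1)[of L "\<lambda>j. g j * h (j + 1)"] assms by simp
  have 2: "(\<Sum>j\<in>{-L..L}. g (j + 1) * h j) = (\<Sum>j\<in>{-L..L}. g j * h (j - 1))"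
    using sum_shift_int(2)[of L "\<lambda>j. g j * h (j - 1)"] assms by simp
  have "(\<Sum>j\<in>{-L..L}. lstep g j * h j) =
      ((\<Sum>j\<in>{-L..L}. g (j - 1) * h j) + 2 * (\<Sum>j\<in>{-L..L}. g j * h j)
        + (\<Sum>j\<in>{-L..L}. g (j + 1) * h j)) / 4"
    by (simp add: lstep_def sum_distrib_left sum_divide_distrib
        flip: sum.distrib) (simp add: field_simps)
  also have "\<dots> = (\<Sum>j\<in>{-L..L}. g j * lstep h j)"
    unfolding 1 2 by (simp add: lstep_def sum_distrib_left sum_divide_distrib
        flip: sum.distrib) (simp add: field_simps)
  finally show ?thesis .
qed

lemma lazy_walk_nonneg: "0 \<le> lazy_walk m j"
  by (induction m arbitrary: j) (auto simp: lstep_def)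

lemma lazy_walk_outside: "int m < \<bar>j\<bar> \<Longrightarrow> lazy_walk m j = 0"
  by (induction m arbitrary: j) (auto simp: lstep_def)

text \<open>Quotient of neighbouring binomial coefficients, stated without division. It is the
  discrete form of the Gaussian identity w' = -(x / variance) w and will turn a difference of the
  walk into a first moment.\<close>

lemma lazy_walk_ratio:
  "(real m + 1 + real_of_int j) * lazy_walk m (j + 1) = (real m - real_of_int j) * lazy_walk m j"
proof (induction m arbitrary: j)
  case 0
  then show ?case by (auto)
next
  case (Suc m)
  have 1: "(m + real_of_int j) * lazy_walk m j = (m - real_of_int j + 1) * lazy_walk m (j - 1)"
    using Suc.IH[of "j - 1"] by (simp add: algebra_simps)
  have 2: "(m + 1 + real_of_int j) * lazy_walk m (j + 1) = (m - real_of_int j) * lazy_walk m j"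
    using Suc.IH[of j] by (simp add: algebra_simps)
  have 3: "(m + 2 + real_of_int j) * lazy_walk m (j + 2) = (m - real_of_int j - 1) * lazy_walk m (j + 1)"
    using Suc.IH[of "j + 1"] by (simp add: algebra_simps)
  show ?case
    using 1 2 3 by (simp add: lstep_def field_simps)
qed

lemma sum_lazy_walk_Suc:
  assumes "int m < L"
  shows "(\<Sum>j\<in>{-L..L}. lazy_walk (Suc m) j * h j) = (\<Sum>j\<in>{-L..L}. lazy_walk m j * lstep h j)"
  using lstep_self_adjoint[of L "lazy_walk m" h] lazy_walk_outside[of m] assms by simp

text \<open>By self-adjointness a step can be moved from the walk onto the test function, and
  \<open>lstep\<close> maps 1, j^2 and j^4 to themselves plus terms of lower order. This gives
  closed recursions in m; the exact fourth moment is 3/4 m^2 - m/4.\<close>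

lemma lazy_walk_moments:
  assumes "int m < L"
  shows "(\<Sum>j\<in>{-L..L}. lazy_walk m j) = 1"
    and "(\<Sum>j\<in>{-L..L}. lazy_walk m j * real_of_int j ^ 2) = m / 2"
    and "(\<Sum>j\<in>{-L..L}. lazy_walk m j * real_of_int j ^ 4) \<le> m ^ 2"
proof -
  have "(\<Sum>j\<in>{-L..L}. lazy_walk m j * 1) = 1 \<and>
     (\<Sum>j\<in>{-L..L}. lazy_walk m j * real_of_int j ^ 2) = m / 2 \<and>
     (\<Sum>j\<in>{-L..L}. lazy_walk m j * real_of_int j ^ 4) = 3 / 4 * (real m) ^ 2 - m / 4"
    using assms
  proof (induction m)
    case 0
    have "(\<Sum>j\<in>{-L..L}. lazy_walk 0 j * f j) = f 0" for f
      using 0 by (simp add: sum.delta if_distrib[of "\<lambda>x. x * _"] cong: if_cong)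
    then show ?case using 0 by simp
  next
    case (Suc m)
    then have IH: "(\<Sum>j\<in>{-L..L}. lazy_walk m j * 1) = 1"
     "(\<Sum>j\<in>{-L..L}. lazy_walk m j * real_of_int j ^ 2) = m / 2"
     "(\<Sum>j\<in>{-L..L}. lazy_walk m j * real_of_int j ^ 4) = 3 / 4 * (real m) ^ 2 - m / 4"
      by auto
    have s: "lstep (\<lambda>j. 1) = (\<lambda>j. 1)" "lstep (\<lambda>j. real_of_int j ^ 2) = (\<lambda>j. real_of_int j ^ 2 + 1/2)"
      "lstep (\<lambda>j. real_of_int j ^ 4) = (\<lambda>j. real_of_int j ^ 4 + 3 * real_of_int j ^ 2 + 1/2)"
      by (auto simp: lstep_def fun_eq_iff power2_eq_square power4_eq_xxxx algebra_simps)
    have m: "int m < L" using Suc by simp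
    have "(\<Sum>j\<in>{-L..L}. lazy_walk m j * (real_of_int j ^ 2 + 1/2)) = m / 2 + 1 / 2"
      using IH by (simp add: distrib_left sum.distrib flip: sum_divide_distrib)
    moreover have "(\<Sum>j\<in>{-L..L}. lazy_walk m j * (real_of_int j ^ 4 + 3 * real_of_int j ^ 2 + 1/2))
       = (\<Sum>j\<in>{-L..L}. lazy_walk m j * real_of_int j ^ 4)
         + 3 * (\<Sum>j\<in>{-L..L}. lazy_walk m j * real_of_int j ^ 2)
         + (\<Sum>j\<in>{-L..L}. lazy_walk m j * 1) / 2"
      by (simp add: sum_distrib_left sum_divide_distrib flip: sum.distrib) (simp add: algebra_simps)
    ultimately show ?case
      unfolding sum_lazy_walk_Suc[OF m] s using IH by (simp add: field_simps power2_eq_square)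
  qed
  then show "(\<Sum>j\<in>{-L..L}. lazy_walk m j) = 1"
    "(\<Sum>j\<in>{-L..L}. lazy_walk m j * real_of_int j ^ 2) = m / 2"
    "(\<Sum>j\<in>{-L..L}. lazy_walk m j * real_of_int j ^ 4) \<le> (real m) ^ 2"
    using zero_le_power2[of "real m"] of_nat_0_le_iff[of m, where ?'a=real] by (auto simp only: mult_1_right)
qed

lemma lazy_walk_convolution:
  assumes "int m < L"
  shows "lazy_walk (m + n) j = (\<Sum>i\<in>{-L..L}. lazy_walk m i * lazy_walk n (j - i))"
  using assms
proof (induction m arbitrary: j)
  case 0
  then show ?case by (simp add: sum.delta if_distrib[of "\<lambda>x. x * _"] cong: if_cong)
next
  case (Suc m)
  have r: "lstep (\<lambda>i. lazy_walk n (j - i)) = (\<lambda>i. lstep (lazy_walk n) (j - i))"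
    by (auto simp: fun_eq_iff lstep_def algebra_simps)
  have "lazy_walk (Suc m + n) j = lstep (lazy_walk (m + n)) j" by simp
  also have "\<dots> = (\<Sum>i\<in>{-L..L}. lazy_walk m i * lstep (lazy_walk n) (j - i))"
    unfolding lstep_def using Suc
    by (simp add: sum_distrib_left sum_divide_distrib flip: sum.distrib) (simp add: algebra_simps)
  also have "\<dots> = (\<Sum>i\<in>{-L..L}. lazy_walk (Suc m) i * lazy_walk n (j - i))"
    using Suc.prems by (subst sum_lazy_walk_Suc) (auto simp: r)
  finally show ?case .
qed

text \<open>Semigroup property with one of the differences placed on the first block of steps.
  Cutting a walk into blocks and giving each block one difference is what produces a factor of order
  m^(-1/2) per difference.\<close>

lemma fdiff_convolution:
  assumes "int m + 1 < L"
  shows "(fdiff ^^ Suc a) (lazy_walk (m + n)) j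
    = (\<Sum>i\<in>{-L..L}. fdiff (lazy_walk m) i * (fdiff ^^ a) (lazy_walk n) (j - i))"
proof -
  have 1: "(fdiff ^^ a) (lazy_walk (m + n)) = (\<lambda>j. \<Sum>i\<in>{-L..L}. lazy_walk m i * (fdiff ^^ a) (lazy_walk n) (j - i))" for a
  proof (induction a)
    case 0
    show ?case using assms lazy_walk_convolution[of m L n] by auto
  next
    case (Suc a)
    show ?case
      by (simp add: Suc fdiff_def[of "\<lambda>j. \<Sum>i\<in>{-L..L}. lazy_walk m i * (fdiff ^^ a) (lazy_walk n) (j - i)"]
          fdiff_def[of "(fdiff ^^ a) (lazy_walk n)"] fun_eq_iff right_diff_distrib sum_subtractf diff_add_eq)
  qed
  let ?g = "(fdiff ^^ a) (lazy_walk n)"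
  have 2: "(\<Sum>i\<in>{-L..L}. lazy_walk m (i + 1) * ?g (j - i)) = (\<Sum>i\<in>{-L..L}. lazy_walk m i * ?g (j - i + 1))"
    using sum_shift_int(2)[of L "\<lambda>i. lazy_walk m i * ?g (j - i + 1)"] lazy_walk_outside[of m] assms by simp
  have "(fdiff ^^ Suc a) (lazy_walk (m + n)) j = (\<Sum>i\<in>{-L..L}. lazy_walk m i * fdiff ?g (j - i))"
    unfolding 1[of "Suc a"] by simp
  also have "\<dots> = (\<Sum>i\<in>{-L..L}. fdiff (lazy_walk m) i * ?g (j - i))"
    by (simp only: fdiff_def[of ?g] fdiff_def[of "lazy_walk m"] left_diff_distrib right_diff_distrib sum_subtractf 2)
  finally show ?thesis .
qed

section \<open>Decay of the differences of the walk in l^1\<close>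

lemma sum_translate_le:
  fixes g :: "int \<Rightarrow> real"
  assumes g: "\<And>G. finite G \<Longrightarrow> (\<Sum>j\<in>G. g j) \<le> C" and "finite G"
  shows "(\<Sum>j\<in>G. g (j + a)) \<le> C"
proof -
  have "(\<Sum>j\<in>G. g (j + a)) = (\<Sum>j\<in>(\<lambda>j. j + a) ` G. g j)"
    by (subst sum.reindex) (auto simp: inj_on_def)
  then show ?thesis using g[of "(\<lambda>j. j + a) ` G"] assms(2) by simp
qed

text \<open>The ratio identity, rewritten as m (w(j+1) - w(j)) = -(j+1) w(j+1) - j w(j), trades a
  difference for first moments, which have size sqrt m, divided by m.\<close>

lemma fdiff_lazy_walk_abs_le:
  "real m * \<bar>fdiff (lazy_walk m) j\<bar> \<le> \<bar>real_of_int (j + 1)\<bar> * lazy_walk m (j + 1) + \<bar>real_of_int j\<bar> * lazy_walk m j"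
proof -
  have "m * fdiff (lazy_walk m) j = - (real_of_int (j + 1) * lazy_walk m (j + 1)) - real_of_int j * lazy_walk m j"
    using lazy_walk_ratio[of m j] by (simp add: fdiff_def algebra_simps)
  then have "m * \<bar>fdiff (lazy_walk m) j\<bar> = \<bar>real_of_int (j + 1) * lazy_walk m (j + 1) + real_of_int j * lazy_walk m j\<bar>"
    by (simp add: abs_mult[of "real m", simplified, symmetric] abs_minus_commute)
  also have "\<dots> \<le> \<bar>real_of_int (j + 1)\<bar> * lazy_walk m (j + 1) + \<bar>real_of_int j\<bar> * lazy_walk m j"
    by (rule order_trans[OF abs_triangle_ineq]) (simp add: abs_mult lazy_walk_nonneg)
  finally show ?thesis .
qed

lemma sum_le_interval:
  fixes h :: "int \<Rightarrow> real"
  assumes "finite G" "\<And>j. 0 \<le> h j" "\<And>j. L < \<bar>j\<bar> \<Longrightarrow> h j = 0"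
  shows "(\<Sum>j\<in>G. h j) \<le> (\<Sum>j\<in>{-L..L}. h j)"
proof -
  have "(\<Sum>j\<in>G. h j) = (\<Sum>j\<in>G \<inter> {-L..L}. h j)"
    using assms(1) by (intro sum.mono_neutral_right) (auto intro!: assms(3))
  also have "\<dots> \<le> (\<Sum>j\<in>{-L..L}. h j)"
    using assms by (intro sum_mono2) auto
  finally show ?thesis .
qed

text \<open>Odd absolute moments are interpolated between the even ones, with the weight s = sqrt m
  that balances the two terms.\<close>

lemma lazy_walk_abs_moments:
  assumes "finite G" "0 < m"
  shows "(\<Sum>j\<in>G. \<bar>real_of_int j\<bar> * lazy_walk m j) \<le> sqrt m"
    and "(\<Sum>j\<in>G. \<bar>real_of_int j\<bar> ^ 3 * lazy_walk m j) \<le> m * sqrt m"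
proof -
  define L where "L = int m + 1"
  define s where "s = sqrt m"
  have s: "0 < s" "s * s = m" using assms by (auto simp: s_def)
  have mL: "int m < L" by (simp add: L_def)
  note mom = lazy_walk_moments[OF mL]
  have "(\<Sum>j\<in>G. \<bar>real_of_int j\<bar> * lazy_walk m j) \<le> (\<Sum>j\<in>{-L..L}. \<bar>real_of_int j\<bar> * lazy_walk m j)"
    by (rule sum_le_interval) (use assms in \<open>auto simp: lazy_walk_nonneg lazy_walk_outside L_def\<close>)
  also have "\<dots> \<le> (\<Sum>j\<in>{-L..L}. (s / 2 * lazy_walk m j + (lazy_walk m j * real_of_int j ^ 2) / (2 * s)))"
  proof (rule sum_mono)
    fix j
    have "0 \<le> (s - \<bar>real_of_int j\<bar>)\<^sup>2" by simp
    then have "\<bar>real_of_int j\<bar> \<le> s / 2 + real_of_int j ^ 2 / (2 * s)"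
      using s by (simp add: power2_eq_square field_simps)
    from mult_right_mono[OF this lazy_walk_nonneg[of m j]]
    show "\<bar>real_of_int j\<bar> * lazy_walk m j \<le> s / 2 * lazy_walk m j + lazy_walk m j * real_of_int j ^ 2 / (2 * s)"
      by (simp add: algebra_simps)
  qed
  also have "\<dots> = s / 2 + m / 2 / (2 * s)"
    by (simp only: sum.distrib flip: sum_distrib_left sum_divide_distrib) (simp add: mom)
  also have "\<dots> \<le> s" using s by (simp add: field_simps)
  finally show "(\<Sum>j\<in>G. \<bar>real_of_int j\<bar> * lazy_walk m j) \<le> sqrt m" by (simp add: s_def)
  have "(\<Sum>j\<in>G. \<bar>real_of_int j\<bar> ^ 3 * lazy_walk m j) \<le> (\<Sum>j\<in>{-L..L}. \<bar>real_of_int j\<bar> ^ 3 * lazy_walk m j)"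
    by (rule sum_le_interval) (use assms in \<open>auto simp: lazy_walk_nonneg lazy_walk_outside L_def\<close>)
  also have "\<dots> \<le> (\<Sum>j\<in>{-L..L}. (s / 2 * (lazy_walk m j * real_of_int j ^ 2) + (lazy_walk m j * real_of_int j ^ 4) / (2 * s)))"
  proof (rule sum_mono)
    fix j
    have "0 \<le> (\<bar>real_of_int j\<bar> * (s - \<bar>real_of_int j\<bar>))\<^sup>2" by simp
    then have "2 * s * \<bar>real_of_int j\<bar> ^ 3 \<le> s * s * real_of_int j ^ 2 + real_of_int j ^ 4"
      by (simp add: power2_eq_square power3_eq_cube power4_eq_xxxx algebra_simps abs_mult_self_eq)
    then have "\<bar>real_of_int j\<bar> ^ 3 \<le> s / 2 * real_of_int j ^ 2 + real_of_int j ^ 4 / (2 * s)"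
      using s(1) by (simp add: field_simps)
    from mult_right_mono[OF this lazy_walk_nonneg[of m j]]
    show "\<bar>real_of_int j\<bar> ^ 3 * lazy_walk m j \<le> s / 2 * (lazy_walk m j * real_of_int j ^ 2) + lazy_walk m j * real_of_int j ^ 4 / (2 * s)"
      by (simp add: algebra_simps)
  qed
  also have "\<dots> = s / 2 * (m / 2) + (\<Sum>j\<in>{-L..L}. lazy_walk m j * real_of_int j ^ 4) / (2 * s)"
    by (simp only: sum.distrib flip: sum_distrib_left sum_divide_distrib) (simp add: mom)
  also have "\<dots> \<le> s / 2 * (m / 2) + m ^ 2 / (2 * s)"
    using mom(3) s by (intro add_left_mono divide_right_mono) auto
  also have "\<dots> \<le> m * s" using s by (simp add: field_simps power2_eq_square flip: s(2))
  finally show "(\<Sum>j\<in>G. \<bar>real_of_int j\<bar> ^ 3 * lazy_walk m j) \<le> m * sqrt m" by (simp add: s_def)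
qed

text \<open>Bounds over all finite sets of positions are l^1 bounds on the integers. Time enters as
  m + 1 so that m = 0, which is checked by hand, is covered by the same formula.\<close>

lemma fdiff_lazy_walk_l1:
  assumes "finite G"
  shows "(\<Sum>j\<in>G. \<bar>fdiff (lazy_walk m) j\<bar>) \<le> 3 / sqrt (real m + 1)"
    and "(\<Sum>j\<in>G. real_of_int j ^ 2 * \<bar>fdiff (lazy_walk m) j\<bar>) \<le> 6 * sqrt (real m + 1)"
proof -
  have "(\<Sum>j\<in>G. \<bar>fdiff (lazy_walk m) j\<bar>) \<le> 3 / sqrt (real m + 1) \<and>
     (\<Sum>j\<in>G. real_of_int j ^ 2 * \<bar>fdiff (lazy_walk m) j\<bar>) \<le> 6 * sqrt (real m + 1)"
  proof (cases "m = 0")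
    case True
    have "(\<Sum>j\<in>G. \<bar>fdiff (lazy_walk 0) j\<bar>) \<le> (\<Sum>j\<in>{-1..1}. \<bar>fdiff (lazy_walk 0) j\<bar>)"
      by (rule sum_le_interval) (use assms in \<open>auto simp: fdiff_def\<close>)
    moreover have "(\<Sum>j\<in>G. real_of_int j ^ 2 * \<bar>fdiff (lazy_walk 0) j\<bar>) \<le> (\<Sum>j\<in>{-1..1}. real_of_int j ^ 2 * \<bar>fdiff (lazy_walk 0) j\<bar>)"
      by (rule sum_le_interval) (use assms in \<open>auto simp: fdiff_def\<close>)
    moreover have "{-1..1::int} = {-1, 0, 1}" by auto
    ultimately show ?thesis using True by (simp add: fdiff_def)
  next
    case False
    then have m: "0 < m" by simp
    define s where "s = sqrt m"
    have s: "1 \<le> s" "s * s = m" "s \<le> sqrt (real m + 1)" using m by (auto simp: s_def)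
    \<comment> \<open>Passing from sqrt m to sqrt (m + 1) costs at most 3/2 for m at least 1, which
      turns the constant 2 into 3.\<close>
    have s': "sqrt (real m + 1) \<le> 3 / 2 * s"
      using m s by (intro real_le_lsqrt) (auto simp: power2_eq_square)
    have pos: "0 < sqrt (real m + 1)" by simp
    have "m * (\<Sum>j\<in>G. \<bar>fdiff (lazy_walk m) j\<bar>) \<le>
      (\<Sum>j\<in>G. \<bar>real_of_int (j + 1)\<bar> * lazy_walk m (j + 1)) + (\<Sum>j\<in>G. \<bar>real_of_int j\<bar> * lazy_walk m j)"
      unfolding sum_distrib_left sum.distrib[symmetric] by (intro sum_mono fdiff_lazy_walk_abs_le)
    also have "\<dots> \<le> s + s"
      unfolding s_def
      by (intro add_mono lazy_walk_abs_moments m assms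
            sum_translate_le[of "\<lambda>j. \<bar>real_of_int j\<bar> * lazy_walk m j"])
    finally have "s * (s * (\<Sum>j\<in>G. \<bar>fdiff (lazy_walk m) j\<bar>)) \<le> s * 2"
      by (simp only: mult.assoc[symmetric] s(2) mult_2_right)
    then have "s * (\<Sum>j\<in>G. \<bar>fdiff (lazy_walk m) j\<bar>) \<le> 2"
      using s(1) by simp
    then have "(\<Sum>j\<in>G. \<bar>fdiff (lazy_walk m) j\<bar>) \<le> 2 / s" using s by (simp add: field_simps)
    also have "\<dots> \<le> 3 / sqrt (real m + 1)" using s s' pos by (simp add: field_simps)
    finally have 1: "(\<Sum>j\<in>G. \<bar>fdiff (lazy_walk m) j\<bar>) \<le> 3 / sqrt (real m + 1)" .
    have "m * (\<Sum>j\<in>G. real_of_int j ^ 2 * \<bar>fdiff (lazy_walk m) j\<bar>) \<le>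
      (\<Sum>j\<in>G. 2 * (\<bar>real_of_int (j + 1)\<bar> ^ 3 * lazy_walk m (j + 1))
         + 2 * (\<bar>real_of_int (j + 1)\<bar> * lazy_walk m (j + 1)) + \<bar>real_of_int j\<bar> ^ 3 * lazy_walk m j)"
      unfolding sum_distrib_left
    proof (rule sum_mono)
      fix j
      have "m * (real_of_int j ^ 2 * \<bar>fdiff (lazy_walk m) j\<bar>)
        \<le> real_of_int j ^ 2 * (\<bar>real_of_int (j + 1)\<bar> * lazy_walk m (j + 1) + \<bar>real_of_int j\<bar> * lazy_walk m j)"
        using mult_left_mono[OF fdiff_lazy_walk_abs_le[of m j], of "real_of_int j ^ 2"]
        by (simp add: algebra_simps)
      \<comment> \<open>The weight j^2 is re-centred at j + 1, where this copy of the walk is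
        evaluated.\<close>
      moreover have "real_of_int j ^ 2 * (\<bar>real_of_int (j + 1)\<bar> * lazy_walk m (j + 1))
        \<le> (2 * \<bar>real_of_int (j + 1)\<bar> ^ 2 + 2) * (\<bar>real_of_int (j + 1)\<bar> * lazy_walk m (j + 1))"
      proof (rule mult_right_mono)
        have "0 \<le> (real_of_int j + 2)\<^sup>2" by simp
        then show "real_of_int j ^ 2 \<le> 2 * \<bar>real_of_int (j + 1)\<bar> ^ 2 + 2"
          by (simp add: power2_eq_square algebra_simps)
      qed (simp add: lazy_walk_nonneg)
      moreover have "real_of_int j ^ 2 * (\<bar>real_of_int j\<bar> * lazy_walk m j) = \<bar>real_of_int j\<bar> ^ 3 * lazy_walk m j"
        by (simp add: power2_eq_square power3_eq_cube)
      ultimately show "m * (real_of_int j ^ 2 * \<bar>fdiff (lazy_walk m) j\<bar>)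
        \<le> 2 * (\<bar>real_of_int (j + 1)\<bar> ^ 3 * lazy_walk m (j + 1))
         + 2 * (\<bar>real_of_int (j + 1)\<bar> * lazy_walk m (j + 1)) + \<bar>real_of_int j\<bar> ^ 3 * lazy_walk m j"
        by (simp add: algebra_simps power2_eq_square power3_eq_cube)
    qed
    also have "\<dots> = 2 * (\<Sum>j\<in>G. \<bar>real_of_int (j + 1)\<bar> ^ 3 * lazy_walk m (j + 1))
        + 2 * (\<Sum>j\<in>G. \<bar>real_of_int (j + 1)\<bar> * lazy_walk m (j + 1)) + (\<Sum>j\<in>G. \<bar>real_of_int j\<bar> ^ 3 * lazy_walk m j)"
      by (simp add: sum.distrib sum_distrib_left)
    also have "\<dots> \<le> 2 * (m * s) + 2 * s + m * s"
      unfolding s_def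
      by (intro add_mono mult_left_mono lazy_walk_abs_moments m assms
            sum_translate_le[of "\<lambda>j. \<bar>real_of_int j\<bar> * lazy_walk m j"]
            sum_translate_le[of "\<lambda>j. \<bar>real_of_int j\<bar> ^ 3 * lazy_walk m j"]) auto
    also have "\<dots> \<le> m * (6 * s)" using mult_right_mono[of 1 "real m" s] s(1) m by simp
    finally have "(\<Sum>j\<in>G. real_of_int j ^ 2 * \<bar>fdiff (lazy_walk m) j\<bar>) \<le> 6 * s"
      using m by simp
    with 1 s show ?thesis by linarith
  qed
  then show "(\<Sum>j\<in>G. \<bar>fdiff (lazy_walk m) j\<bar>) \<le> 3 / sqrt (real m + 1)"
    "(\<Sum>j\<in>G. real_of_int j ^ 2 * \<bar>fdiff (lazy_walk m) j\<bar>) \<le> 6 * sqrt (real m + 1)" by auto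
qed

text \<open>Young's inequality for convolutions, once per difference: each of the a differences acts
  on its own block of q steps and costs 3 / sqrt (q + 1), while the r remaining steps only
  average.\<close>

lemma fdiff_lazy_walk_l1_power:
  assumes "finite G"
  shows "(\<Sum>j\<in>G. \<bar>(fdiff ^^ a) (lazy_walk (a * q + r)) j\<bar>) \<le> (3 / sqrt (real q + 1)) ^ a"
  using assms
proof (induction a arbitrary: G)
  case 0
  have "(\<Sum>j\<in>G. \<bar>lazy_walk r j\<bar>) \<le> (\<Sum>j\<in>{-(int r + 1)..int r + 1}. \<bar>lazy_walk r j\<bar>)"
    by (rule sum_le_interval) (use 0 in \<open>auto simp: lazy_walk_outside\<close>)
  then show ?case
    using lazy_walk_moments(1)[of r "int r + 1"] by (simp add: lazy_walk_nonneg)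
next
  case (Suc a)
  define I where "I = {-(int q + 2)..int q + 2}"
  let ?g = "(fdiff ^^ a) (lazy_walk (a * q + r))"
  have "(\<Sum>j\<in>G. \<bar>(fdiff ^^ Suc a) (lazy_walk (Suc a * q + r)) j\<bar>)
    \<le> (\<Sum>j\<in>G. \<Sum>i\<in>I. \<bar>fdiff (lazy_walk q) i\<bar> * \<bar>?g (j - i)\<bar>)"
  proof (rule sum_mono)
    fix j
    show "\<bar>(fdiff ^^ Suc a) (lazy_walk (Suc a * q + r)) j\<bar> \<le> (\<Sum>i\<in>I. \<bar>fdiff (lazy_walk q) i\<bar> * \<bar>?g (j - i)\<bar>)"
      using fdiff_convolution[of q "int q + 2" a "a * q + r" j]
      by (simp add: I_def add.assoc del: funpow.simps)
         (rule order_trans[OF sum_abs], simp add: abs_mult)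
  qed
  also have "\<dots> = (\<Sum>i\<in>I. \<bar>fdiff (lazy_walk q) i\<bar> * (\<Sum>j\<in>G. \<bar>?g (j - i)\<bar>))"
    by (subst sum.swap) (simp add: sum_distrib_left)
  also have "\<dots> \<le> (\<Sum>i\<in>I. \<bar>fdiff (lazy_walk q) i\<bar> * (3 / sqrt (real q + 1)) ^ a)"
  proof (intro sum_mono mult_left_mono)
    fix i
    show "(\<Sum>j\<in>G. \<bar>?g (j - i)\<bar>) \<le> (3 / sqrt (real q + 1)) ^ a"
      using sum_translate_le[of "\<lambda>j. \<bar>?g j\<bar>" "(3 / sqrt (real q + 1)) ^ a" G "- i"] Suc by simp
  qed auto
  also have "\<dots> \<le> 3 / sqrt (real q + 1) * (3 / sqrt (real q + 1)) ^ a"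
    unfolding sum_distrib_right[symmetric]
    by (intro mult_right_mono fdiff_lazy_walk_l1) (auto simp: I_def)
  finally show ?case by simp
qed

text \<open>Three blocks of about m/3 steps. The constant is 27 times 6, because (m + 1)^(3/2) is at
  most 6 (q + 1)^(3/2). This rate measures how second differences change under a shift in
  space.\<close>

lemma fdiff3_lazy_walk_l1:
  assumes "finite G"
  shows "(\<Sum>j\<in>G. \<bar>(fdiff ^^ 3) (lazy_walk m) j\<bar>) \<le> 162 / ((real m + 1) * sqrt (real m + 1))"
proof -
  define q where "q = m div 3"
  have q: "m = 3 * q + m mod 3" by (simp add: q_def)
  then have "m + 1 \<le> 3 * (q + 1)" using mod_less_divisor[of 3 m] by simp
  then have le: "real m + 1 \<le> 3 * (real q + 1)"
    by (simp flip: of_nat_add of_nat_mult of_nat_Suc)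
  define s where "s = sqrt (real q + 1)"
  have s: "0 < s" "s * s = real q + 1" by (auto simp: s_def)
  have "sqrt (real m + 1) \<le> 2 * s"
    using le s by (intro real_le_lsqrt) (auto simp: power2_eq_square)
  then have *: "(real m + 1) * sqrt (real m + 1) \<le> (3 * (s * s)) * (2 * s)"
    using le s by (intro mult_mono) auto
  have "(\<Sum>j\<in>G. \<bar>(fdiff ^^ 3) (lazy_walk m) j\<bar>) \<le> (3 / s) ^ 3"
    using fdiff_lazy_walk_l1_power[OF assms, of 3 q "m mod 3"] q unfolding s_def by simp
  also have "\<dots> = 162 / ((3 * (s * s)) * (2 * s))"
    using s(1) by (simp add: power3_eq_cube field_simps)
  also have "\<dots> \<le> 162 / ((real m + 1) * sqrt (real m + 1))"
    using * s(1) by (intro divide_left_mono mult_pos_pos) auto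
  finally show ?thesis .
qed

text \<open>Four blocks of about m/4 steps, and 1296 = 81 times 16. Fourth differences govern how
  second differences change in time.\<close>

lemma fdiff4_lazy_walk_l1:
  assumes "finite G"
  shows "(\<Sum>j\<in>G. \<bar>(fdiff ^^ 4) (lazy_walk m) j\<bar>) \<le> 1296 / (real m + 1)\<^sup>2"
proof -
  define q where "q = m div 4"
  have q: "m = 4 * q + m mod 4" by (simp add: q_def)
  then have "m + 1 \<le> 4 * (q + 1)" using mod_less_divisor[of 4 m] by simp
  then have le: "real m + 1 \<le> 4 * (real q + 1)"
    by (simp flip: of_nat_add of_nat_mult of_nat_Suc)
  define s where "s = sqrt (real q + 1)"
  have s: "0 < s" "s * s = real q + 1" by (auto simp: s_def)
  have *: "(real m + 1)\<^sup>2 \<le> (4 * (s * s))\<^sup>2"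
    using le s by (intro power_mono) auto
  have "(\<Sum>j\<in>G. \<bar>(fdiff ^^ 4) (lazy_walk m) j\<bar>) \<le> (3 / s) ^ 4"
    using fdiff_lazy_walk_l1_power[OF assms, of 4 q "m mod 4"] q unfolding s_def by simp
  also have "\<dots> = 1296 / (4 * (s * s))\<^sup>2"
    using s(1) by (simp add: power2_eq_square power4_eq_xxxx field_simps)
  also have "\<dots> \<le> 1296 / (real m + 1)\<^sup>2"
    using * s(1) by (intro divide_left_mono mult_pos_pos zero_less_power) auto
  finally show ?thesis .
qed

text \<open>Two differences gain 1/m and the weight j^2 costs m, so the bound is uniform in time.
  Each half of the steps carries one difference, and j^2 \<le> 2 i^2 + 2 (j - i)^2 puts the weight
  on one factor of the convolution at a time.\<close>

lemma fdiff2_lazy_walk_second_moment: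
  assumes "finite G"
  shows "(\<Sum>j\<in>G. real_of_int j ^ 2 * \<bar>(fdiff ^^ 2) (lazy_walk m) j\<bar>) \<le> 108"
proof -
  define q where "q = m div 2"
  define n where "n = m - q"
  have m: "m = q + n" "n \<le> q + 1" "q \<le> n" by (auto simp: q_def n_def)
  define I where "I = {-(int q + 2)..int q + 2}"
  let ?f = "fdiff (lazy_walk q)" and ?g = "fdiff (lazy_walk n)"
  define s t where "s = sqrt (real q + 1)" and "t = sqrt (real n + 1)"
  have st: "0 < s" "0 < t" "s \<le> t" by (auto simp: s_def t_def m)
  have "t \<le> sqrt (4 * (real q + 1))" unfolding t_def using m by simp
  then have ts: "t \<le> 2 * s" unfolding s_def real_sqrt_mult by simp
  have "(\<Sum>j\<in>G. real_of_int j ^ 2 * \<bar>(fdiff ^^ 2) (lazy_walk m) j\<bar>)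
    \<le> (\<Sum>j\<in>G. \<Sum>i\<in>I. 2 * (real_of_int i ^ 2 * \<bar>?f i\<bar> * \<bar>?g (j - i)\<bar>)
         + 2 * (\<bar>?f i\<bar> * (real_of_int (j - i) ^ 2 * \<bar>?g (j - i)\<bar>)))"
  proof (rule sum_mono)
    fix j
    have "(fdiff ^^ 2) (lazy_walk m) j = (\<Sum>i\<in>I. ?f i * ?g (j - i))"
      using fdiff_convolution[of q "int q + 2" 1 n j] unfolding I_def m(1) by (simp add: numeral_2_eq_2)
    then have "real_of_int j ^ 2 * \<bar>(fdiff ^^ 2) (lazy_walk m) j\<bar> \<le> (\<Sum>i\<in>I. real_of_int j ^ 2 * (\<bar>?f i\<bar> * \<bar>?g (j - i)\<bar>))"
      unfolding sum_distrib_left[symmetric]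
      by (intro mult_left_mono) (auto intro: order_trans[OF sum_abs] simp: abs_mult)
    also have "\<dots> \<le> (\<Sum>i\<in>I. (2 * real_of_int i ^ 2 + 2 * real_of_int (j - i) ^ 2) * (\<bar>?f i\<bar> * \<bar>?g (j - i)\<bar>))"
    proof (intro sum_mono mult_right_mono)
      fix i
      have "0 \<le> (2 * real_of_int i - real_of_int j)\<^sup>2" by simp
      then show "real_of_int j ^ 2 \<le> 2 * real_of_int i ^ 2 + 2 * real_of_int (j - i) ^ 2"
        by (simp add: power2_eq_square algebra_simps)
    qed auto
    also have "\<dots> = (\<Sum>i\<in>I. 2 * (real_of_int i ^ 2 * \<bar>?f i\<bar> * \<bar>?g (j - i)\<bar>)
         + 2 * (\<bar>?f i\<bar> * (real_of_int (j - i) ^ 2 * \<bar>?g (j - i)\<bar>)))"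
      by (intro sum.cong refl) (simp only: algebra_simps)
    finally show "real_of_int j ^ 2 * \<bar>(fdiff ^^ 2) (lazy_walk m) j\<bar> \<le> \<dots>" .
  qed
  also have "\<dots> = 2 * (\<Sum>i\<in>I. real_of_int i ^ 2 * \<bar>?f i\<bar> * (\<Sum>j\<in>G. \<bar>?g (j - i)\<bar>))
     + 2 * (\<Sum>i\<in>I. \<bar>?f i\<bar> * (\<Sum>j\<in>G. real_of_int (j - i) ^ 2 * \<bar>?g (j - i)\<bar>))"
    by (subst sum.swap) (simp only: sum.distrib sum_distrib_left)
  also have "\<dots> \<le> 2 * (\<Sum>i\<in>I. real_of_int i ^ 2 * \<bar>?f i\<bar> * (3 / t)) + 2 * (\<Sum>i\<in>I. \<bar>?f i\<bar> * (6 * t))"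
  proof (intro add_mono sum_mono mult_left_mono)
    fix i
    show "(\<Sum>j\<in>G. \<bar>?g (j - i)\<bar>) \<le> 3 / t"
      using sum_translate_le[of "\<lambda>j. \<bar>?g j\<bar>" "3 / t" G "- i"] fdiff_lazy_walk_l1 assms by (simp add: t_def)
    show "(\<Sum>j\<in>G. real_of_int (j - i) ^ 2 * \<bar>?g (j - i)\<bar>) \<le> 6 * t"
      using sum_translate_le[of "\<lambda>j. real_of_int j ^ 2 * \<bar>?g j\<bar>" "6 * t" G "- i"] fdiff_lazy_walk_l1 assms by (simp add: t_def)
  qed auto
  also have "\<dots> \<le> 2 * ((6 * s) * (3 / t)) + 2 * ((3 / s) * (6 * t))"
    unfolding sum_distrib_right[symmetric]
    using st by (intro add_mono mult_left_mono mult_right_mono) (auto simp: s_def I_def intro!: fdiff_lazy_walk_l1)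
  also have "\<dots> = 36 * (s / t) + 36 * (t / s)" by simp
  also have "\<dots> \<le> 36 * 1 + 36 * 2"
    using st ts by (intro add_mono mult_left_mono) (auto simp: field_simps)
  finally show ?thesis by simp
qed

text \<open>Convolution with this kernel takes the source of the walk equation to the second space
  difference of its solution. The offset -1 centres the two forward differences, and the zero at
  negative times makes the kernel causal.\<close>

definition walk_kernel :: "int \<times> int \<Rightarrow> real" where
  "walk_kernel z = (if fst z < 0 then 0 else (fdiff ^^ 2) (lazy_walk (nat (fst z))) (snd z - 1))"

section \<open>Regularity of the kernel and Hormander's condition\<close>

lemma sum_translate_diff_le:
  fixes g :: "int \<Rightarrow> real"
  assumes g: "\<And>G. finite G \<Longrightarrow> (\<Sum>j\<in>G. \<bar>fdiff g j\<bar>) \<le> C" and "finite G"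
  shows "(\<Sum>j\<in>G. \<bar>g (j + l) - g j\<bar>) \<le> \<bar>real_of_int l\<bar> * C"
proof -
  have nat: "(\<Sum>j\<in>G. \<bar>g (j + int n) - g j\<bar>) \<le> n * C" if "finite G" for n G
  proof (induction n)
    case (Suc n)
    have "(\<Sum>j\<in>G. \<bar>g (j + int (Suc n)) - g j\<bar>) \<le> (\<Sum>j\<in>G. \<bar>fdiff g (j + int n)\<bar> + \<bar>g (j + int n) - g j\<bar>)"
      by (intro sum_mono) (simp add: fdiff_def add.commute add.left_commute)
    also have "\<dots> \<le> C + n * C"
      unfolding sum.distrib using Suc sum_translate_le[of "\<lambda>j. \<bar>fdiff g j\<bar>", OF g that] by (intro add_mono) auto
    finally show ?case by (simp add: algebra_simps)
  qed simp
  show ?thesis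
  proof (cases "0 \<le> l")
    case True
    then show ?thesis using nat[OF assms(2), of "nat l"] by simp
  next
    case False
    have "(\<Sum>j\<in>G. \<bar>g (j + l) - g j\<bar>) = (\<Sum>j\<in>(\<lambda>j. j + l) ` G. \<bar>g (j + int (nat (- l))) - g j\<bar>)"
      using False by (subst sum.reindex) (auto simp: inj_on_def abs_minus_commute)
    then show ?thesis using nat[of "(\<lambda>j. j + l) ` G" "nat (- l)"] assms(2) False by simp
  qed
qed

text \<open>The walk solves the discrete heat equation: one more step adds a quarter of a centred
  second difference. Hence a unit of time costs a quarter of a fourth difference, and 324 = 1296 /
  4.\<close>

lemma fdiff2_lazy_walk_time_diff:
  assumes "finite G" "N \<le> a" "N \<le> b"
  shows "(\<Sum>j\<in>G. \<bar>(fdiff ^^ 2) (lazy_walk a) j - (fdiff ^^ 2) (lazy_walk b) j\<bar>)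
     \<le> \<bar>real a - real b\<bar> * (324 / (real N + 1)\<^sup>2)"
proof -
  have step: "(fdiff ^^ 2) (lazy_walk (Suc n)) j - (fdiff ^^ 2) (lazy_walk n) j = (fdiff ^^ 4) (lazy_walk n) (j + (- 1)) / 4" for n j
    by (simp add: eval_nat_numeral fdiff_def lstep_def) (simp add: field_simps)
  have main: "(\<Sum>j\<in>G. \<bar>(fdiff ^^ 2) (lazy_walk (a + k)) j - (fdiff ^^ 2) (lazy_walk a) j\<bar>) \<le> k * (324 / (real N + 1)\<^sup>2)"
    if "N \<le> a" for a k
  proof (induction k)
    case (Suc k)
    have "(\<Sum>j\<in>G. \<bar>(fdiff ^^ 2) (lazy_walk (a + Suc k)) j - (fdiff ^^ 2) (lazy_walk a) j\<bar>)
      \<le> (\<Sum>j\<in>G. \<bar>(fdiff ^^ 4) (lazy_walk (a + k)) (j + (- 1))\<bar> / 4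
        + \<bar>(fdiff ^^ 2) (lazy_walk (a + k)) j - (fdiff ^^ 2) (lazy_walk a) j\<bar>)"
    proof (intro sum_mono)
      fix j
      show "\<bar>(fdiff ^^ 2) (lazy_walk (a + Suc k)) j - (fdiff ^^ 2) (lazy_walk a) j\<bar>
         \<le> \<bar>(fdiff ^^ 4) (lazy_walk (a + k)) (j + (- 1))\<bar> / 4
        + \<bar>(fdiff ^^ 2) (lazy_walk (a + k)) j - (fdiff ^^ 2) (lazy_walk a) j\<bar>"
        using step[of "a + k" j] unfolding add_Suc_right by linarith
    qed
    also have "\<dots> \<le> (1296 / (real (a + k) + 1)\<^sup>2) / 4 + k * (324 / (real N + 1)\<^sup>2)"
      unfolding sum.distrib sum_divide_distrib[symmetric]
      by (intro add_mono divide_right_mono Suc.IH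
          sum_translate_le[of "\<lambda>j. \<bar>(fdiff ^^ 4) (lazy_walk (a + k)) j\<bar>"] fdiff4_lazy_walk_l1 assms) auto
    also have "(1296 / (real (a + k) + 1)\<^sup>2) / 4 \<le> 324 / (real N + 1)\<^sup>2"
      using that by (simp add: divide_left_mono power_mono)
    finally show ?case by (simp only: of_nat_Suc distrib_right mult_1_left add.commute)
  qed simp
  show ?thesis
  proof (cases "a \<le> b")
    case True
    then show ?thesis using main[OF assms(2), of "b - a"] by (simp add: of_nat_diff abs_minus_commute)
  next
    case False
    then show ?thesis using main[OF assms(3), of "a - b"] by (simp add: of_nat_diff)
  qed
qed

text \<open>Discrete integral test: t plays the part of the tail integral, and its decrements
  dominate g.\<close>

lemma sum_telescope_le:
  fixes t g :: "int \<Rightarrow> real"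
  assumes "finite M" "\<And>m. m \<in> M \<Longrightarrow> N < m" "\<And>m. N < m \<Longrightarrow> g m \<le> t (m - 1) - t m"
    "\<And>m. N < m \<Longrightarrow> 0 \<le> g m" "\<And>m. N \<le> m \<Longrightarrow> 0 \<le> t m"
  shows "sum g M \<le> t N"
proof -
  have k: "sum g {N<..N + int k} \<le> t N - t (N + int k)" for k
  proof (induction k)
    case (Suc k)
    have "{N<..N + int (Suc k)} = insert (N + int (Suc k)) {N<..N + int k}" by auto
    then show ?case using Suc assms(3)[of "N + int (Suc k)"] by simp
  qed simp
  obtain k where k': "M \<subseteq> {N<..N + int k}"
  proof (cases "M = {}")
    case False
    have "M \<subseteq> {N<..N + int (nat (Max M - N))}"
    proof
      fix x assume "x \<in> M"
      then have "N < x" "x \<le> Max M" using assms(1,2) by auto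
      then show "x \<in> {N<..N + int (nat (Max M - N))}" by simp
    qed
    then show ?thesis by (rule that)
  qed (use that in auto)
  have "sum g M \<le> sum g {N<..N + int k}"
    using k' assms(4) by (intro sum_mono2) auto
  also have "\<dots> \<le> t N" using k[of k] assms(5)[of "N + int k"] by simp
  finally show ?thesis .
qed

text \<open>Parabolic form at dyadic scales: a box of generation i has time length 4^i and space
  length 2^i, the displacement (s, l) is at most one such box, and z stays outside the doubled box
  about the origin. A uniform bound over finite G expresses the sum over the whole
  complement.\<close>

definition hormander :: "(int \<times> int \<Rightarrow> real) \<Rightarrow> real \<Rightarrow> bool" where
  "hormander K C \<longleftrightarrow> (\<forall>i::nat. \<forall>s l G. finite G \<longrightarrow> \<bar>s\<bar> \<le> 4 ^ i \<longrightarrow> \<bar>l\<bar> \<le> 2 ^ i \<longrightarrow>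
     (\<forall>z\<in>G. 2 * 4 ^ i < \<bar>fst z\<bar> \<or> 2 * 2 ^ i < \<bar>snd z\<bar>) \<longrightarrow>
     (\<Sum>z\<in>G. \<bar>K (z - (s, l)) - K z\<bar>) \<le> C)"

text \<open>Chebyshev's inequality with the weighted bound for second differences, uniform in the
  time m.\<close>

lemma walk_kernel_tail:
  assumes "finite J" "0 < R" "\<And>j. j \<in> J \<Longrightarrow> R < \<bar>j\<bar>"
  shows "(\<Sum>j\<in>J. \<bar>walk_kernel (m, j)\<bar>) \<le> 108 / real_of_int (R ^ 2)"
proof (cases "m < 0")
  case True
  then show ?thesis by (simp add: walk_kernel_def)
next
  case False
  let ?g = "(fdiff ^^ 2) (lazy_walk (nat m))"
  have "real_of_int (R ^ 2) * (\<Sum>j\<in>J. \<bar>walk_kernel (m, j)\<bar>) \<le> (\<Sum>j\<in>J. real_of_int (j + (- 1)) ^ 2 * \<bar>?g (j + (- 1))\<bar>)"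
    unfolding sum_distrib_left
  proof (rule sum_mono)
    fix j assume "j \<in> J"
    then have "R < \<bar>j\<bar>" by (rule assms)
    \<comment> \<open>For integers the strict inequality R < |j| leaves one unit, which pays for the
      offset -1 in the kernel.\<close>
    then have "\<bar>R\<bar> \<le> \<bar>j - 1\<bar>" using assms(2) by linarith
    then have "R ^ 2 \<le> (j - 1) ^ 2" by (simp add: abs_le_square_iff)
    then have "real_of_int (R ^ 2) \<le> real_of_int (j + (- 1)) ^ 2"
      by (metis of_int_le_iff of_int_power uminus_add_conv_diff add.commute)
    then show "real_of_int (R ^ 2) * \<bar>walk_kernel (m, j)\<bar> \<le> real_of_int (j + (- 1)) ^ 2 * \<bar>?g (j + (- 1))\<bar>"
      using False by (auto simp: walk_kernel_def intro!: mult_right_mono)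
  qed
  also have "\<dots> \<le> 108"
    by (rule sum_translate_le[of "\<lambda>j. real_of_int j ^ 2 * \<bar>?g j\<bar>"]) (use assms fdiff2_lazy_walk_second_moment in auto)
  finally show ?thesis using assms(2) by (simp add: field_simps)
qed

text \<open>The displacement is split into a move in space, paid for by third differences, and a
  move in time, paid for by fourth differences. As m > 2 R^2, both times m - s and m exceed m / 2;
  this explains the factors 4 in 648 = 4 times 162 and 1296 = 4 times 324.\<close>

lemma walk_kernel_row:
  assumes "finite J" "\<bar>s\<bar> \<le> R ^ 2" "\<bar>l\<bar> \<le> R" "2 * R ^ 2 < m" "0 < R"
  shows "(\<Sum>j\<in>J. \<bar>walk_kernel (m - s, j - l) - walk_kernel (m, j)\<bar>)
    \<le> 648 * (real_of_int R / (m * sqrt m)) + 1296 * (real_of_int (R ^ 2) / (real_of_int m)\<^sup>2)"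
proof -
  define a where "a = nat (m - s)"
  define N where "N = nat (m - R ^ 2)"
  have m: "0 < m" using assms(4) by (smt (verit) zero_le_power2)
  have ms: "R ^ 2 \<le> m - s" "m \<le> 2 * (m - s)" "m \<le> 2 * (m - R ^ 2)" "0 \<le> R ^ 2" "m - R ^ 2 \<le> m - s" using assms by auto
  have ms0: "\<not> m - s < 0" using ms(1,4) by linarith
  have a: "walk_kernel (m - s, j) = (fdiff ^^ 2) (lazy_walk a) (j - 1)" for j
    unfolding walk_kernel_def a_def fst_conv snd_conv using ms0 by simp
  have b: "walk_kernel (m, j) = (fdiff ^^ 2) (lazy_walk (nat m)) (j - 1)" for j
    using m by (auto simp: walk_kernel_def)
  have ra: "real_of_int m / 2 \<le> real a" "real_of_int m / 2 \<le> real N"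
    using ms by (auto simp: a_def N_def)
  let ?A = "(fdiff ^^ 2) (lazy_walk a)" and ?B = "(fdiff ^^ 2) (lazy_walk (nat m))"
  have d3: "fdiff ?A = (fdiff ^^ 3) (lazy_walk a)" by (simp add: eval_nat_numeral)
  have "(\<Sum>j\<in>J. \<bar>walk_kernel (m - s, j - l) - walk_kernel (m, j)\<bar>)
     \<le> (\<Sum>j\<in>J. \<bar>?A ((j + - 1) + (- l)) - ?A (j + - 1)\<bar> + \<bar>?A (j + - 1) - ?B (j + - 1)\<bar>)"
    unfolding a b by (intro sum_mono) (simp add: algebra_simps)
  also have "\<dots> \<le> \<bar>real_of_int (- l)\<bar> * (162 / ((real a + 1) * sqrt (real a + 1)))
      + \<bar>real a - real (nat m)\<bar> * (324 / (real N + 1)\<^sup>2)"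
    unfolding sum.distrib
  proof (rule add_mono)
    show "(\<Sum>j\<in>J. \<bar>?A ((j + - 1) + (- l)) - ?A (j + - 1)\<bar>) \<le> \<bar>real_of_int (- l)\<bar> * (162 / ((real a + 1) * sqrt (real a + 1)))"
      by (rule sum_translate_le[of "\<lambda>j. \<bar>?A (j + (- l)) - ?A j\<bar>", OF sum_translate_diff_le])
         (use fdiff3_lazy_walk_l1[of _ a] assms in \<open>auto simp: d3\<close>)
    have "N \<le> a" "N \<le> nat m" unfolding N_def a_def using ms(4,5) by linarith+
    then show "(\<Sum>j\<in>J. \<bar>?A (j + - 1) - ?B (j + - 1)\<bar>) \<le> \<bar>real a - real (nat m)\<bar> * (324 / (real N + 1)\<^sup>2)"
      by (intro sum_translate_le[of "\<lambda>j. \<bar>?A j - ?B j\<bar>", OF fdiff2_lazy_walk_time_diff]) (use assms in auto)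
  qed
  also have "\<dots> \<le> real_of_int R * (162 / ((m / 2) * (sqrt m / 2))) + real_of_int (R ^ 2) * (324 / (real_of_int m / 2)\<^sup>2)"
  proof (intro add_mono mult_mono divide_left_mono)
    show "\<bar>real_of_int (- l)\<bar> \<le> real_of_int R" using assms by simp
    have "sqrt m / 2 = sqrt (m / 4)" by (simp add: real_sqrt_divide)
    also have "\<dots> \<le> sqrt (real a + 1)" using ra m by simp
    finally show "sqrt m / 2 \<le> sqrt (real a + 1)" .
    have "\<bar>real a - real (nat m)\<bar> = real_of_int \<bar>s\<bar>" using ms m by (auto simp: a_def)
    then show "\<bar>real a - real (nat m)\<bar> \<le> real_of_int (R ^ 2)" using assms(2) by linarith
    show "(real_of_int m / 2)\<^sup>2 \<le> (real N + 1)\<^sup>2" using ra m by (intro power_mono) auto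
  qed (use ra m assms in \<open>auto intro!: mult_pos_pos\<close>)
  also have "\<dots> = 648 * (real_of_int R / (m * sqrt m)) + 1296 * (real_of_int (R ^ 2) / (real_of_int m)\<^sup>2)"
    by (simp add: field_simps power2_eq_square)
  finally show ?thesis .
qed

text \<open>Summability of the two decay rates of the rows, by telescoping 1 / m and 2 / sqrt
  m.\<close>

lemma sum_inverse_powers_le:
  assumes "finite M" "\<And>m. m \<in> M \<Longrightarrow> N < m" "0 < N"
  shows "(\<Sum>m\<in>M. 1 / (real_of_int m)\<^sup>2) \<le> 1 / real_of_int N"
    and "(\<Sum>m\<in>M. 1 / (real_of_int m * sqrt m)) \<le> 2 / sqrt (real_of_int N)"
proof -
  show "(\<Sum>m\<in>M. 1 / (real_of_int m)\<^sup>2) \<le> 1 / real_of_int N"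
  proof (rule sum_telescope_le[where t = "\<lambda>m. 1 / real_of_int m"])
    fix m assume "N < m"
    then have "1 < real_of_int m" using assms(3) by linarith
    then show "1 / (real_of_int m)\<^sup>2 \<le> 1 / real_of_int (m - 1) - 1 / real_of_int m"
      by (simp add: field_simps power2_eq_square)
  qed (use assms in auto)
  show "(\<Sum>m\<in>M. 1 / (real_of_int m * sqrt m)) \<le> 2 / sqrt (real_of_int N)"
  proof (rule sum_telescope_le[where t = "\<lambda>m. 2 / sqrt (real_of_int m)"])
    fix m assume "N < m"
    then have m: "1 < real_of_int m" using assms(3) by linarith
    define x y where "x = sqrt (m - 1)" and "y = sqrt m"
    have xy: "0 < x" "x < y" "y * y = m" "x * x = m - 1" using m by (auto simp: x_def y_def)
    have "x * (x + y) \<le> 2 * (y * y)"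
      using xy mult_strict_mono[of x y x y] mult_strict_left_mono[of x y x] mult_right_mono[of x y y] by (simp add: algebra_simps)
    have e: "(y - x) * (x + y) = 1" using xy by (simp add: algebra_simps)
    have "y - x = 1 / (x + y)" using e xy by (simp add: field_simps)
    moreover have "2 / x - 2 / y = 2 * (y - x) / (x * y)" using xy(1,2) by (simp add: field_simps)
    ultimately have "2 / x - 2 / y = 2 / (x * y * (x + y))" by simp
    moreover have "2 / (x * y * (x + y)) \<ge> 2 / (2 * (y * y) * y)"
    proof (intro divide_left_mono)
      show "x * y * (x + y) \<le> 2 * (y * y) * y"
        using mult_right_mono[OF \<open>x * (x + y) \<le> 2 * (y * y)\<close>, of y] xy(1,2) by (simp add: mult.commute mult.left_commute)
    qed (use xy(1,2) in \<open>auto intro!: mult_pos_pos\<close>)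
    ultimately have "1 / (y * y * y) \<le> 2 / x - 2 / y" using xy by simp
    then show "1 / (real_of_int m * sqrt m) \<le> 2 / sqrt (real_of_int (m - 1)) - 2 / sqrt m"
      using xy by (simp add: x_def y_def)
  qed (use assms in auto)
qed

text \<open>Near and far times need different arguments. For |m| \<le> 2 R^2 the points lie far out
  in space and no cancellation is used: two Chebyshev tails give 216 / R^2 per row, and there are at
  most 5 R^2 rows. For m > 2 R^2 regularity makes the rows decay like R m^(-3/2) and R^2 m^(-2),
  with total 1296 + 648. For m < -2 R^2 both kernel values vanish by causality.\<close>

lemma walk_kernel_hormander: "hormander walk_kernel 4000"
  unfolding hormander_def
proof (intro allI impI)
  fix i :: nat and s l :: int and G :: "(int \<times> int) set"
  assume G: "finite G" and sl: "\<bar>s\<bar> \<le> 4 ^ i" "\<bar>l\<bar> \<le> 2 ^ i"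
    and out: "\<forall>z\<in>G. 2 * 4 ^ i < \<bar>fst z\<bar> \<or> 2 * 2 ^ i < \<bar>snd z\<bar>"
  define R :: int where "R = 2 ^ i"
  have "(4::int) ^ i = (2 ^ 2) ^ i" by simp
  then have R: "0 < R" "4 ^ i = R ^ 2" by (simp_all only: R_def power_mult[symmetric] mult.commute) simp
  have R1: "1 \<le> R ^ 2" using R by (simp add: one_le_power)
  note sl = sl[unfolded R(2), folded R_def] and out = out[unfolded R(2), folded R_def]
  define J where "J m = {j. (m, j) \<in> G}" for m
  have fJ: "finite (J m)" for m
    unfolding J_def by (rule finite_subset[of _ "snd ` G"]) (use G in \<open>force+\<close>)
  define row where "row m = (\<Sum>j\<in>J m. \<bar>walk_kernel (m - s, j - l) - walk_kernel (m, j)\<bar>)" for m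
  define M where "M = fst ` G"
  have fM: "finite M" using G by (simp add: M_def)
  have "G = Sigma M J" by (force simp: M_def J_def image_iff)
  then have "(\<Sum>z\<in>G. \<bar>walk_kernel (z - (s, l)) - walk_kernel z\<bar>) = (\<Sum>m\<in>M. row m)"
    unfolding row_def by (simp add: sum.Sigma[OF fM] fJ split_beta minus_prod_def)
  also have "\<dots> = (\<Sum>m\<in>M \<inter> {m. \<bar>m\<bar> \<le> 2 * R ^ 2}. row m) + (\<Sum>m\<in>M \<inter> {m. \<not> \<bar>m\<bar> \<le> 2 * R ^ 2}. row m)"
    using sum.Int_Diff[OF fM, of row "{m. \<bar>m\<bar> \<le> 2 * R ^ 2}"] by (simp add: Diff_eq Collect_neg_eq)
  also have "(\<Sum>m\<in>M \<inter> {m. \<not> \<bar>m\<bar> \<le> 2 * R ^ 2}. row m) = (\<Sum>m\<in>M \<inter> {m. 2 * R ^ 2 < m}. row m)"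
  proof (rule sum.mono_neutral_right)
    show "\<forall>m\<in>M \<inter> {m. \<not> \<bar>m\<bar> \<le> 2 * R ^ 2} - M \<inter> {m. 2 * R ^ 2 < m}. row m = 0"
    proof
      fix m assume "m \<in> M \<inter> {m. \<not> \<bar>m\<bar> \<le> 2 * R ^ 2} - M \<inter> {m. 2 * R ^ 2 < m}"
      then have "m < 0" "m - s < 0" using sl(1) R1 by auto
      then show "row m = 0" by (simp add: row_def walk_kernel_def)
    qed
  qed (use fM R1 in auto)
  also have "(\<Sum>m\<in>M \<inter> {m. \<bar>m\<bar> \<le> 2 * R ^ 2}. row m) \<le> 1080"
  proof -
    have "row m \<le> 216 / real_of_int (R ^ 2)" if "\<bar>m\<bar> \<le> 2 * R ^ 2" for m
    proof -
      have J: "2 * R < \<bar>j\<bar>" if "j \<in> J m" for j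
        using out \<open>\<bar>m\<bar> \<le> 2 * R ^ 2\<close> that by (auto simp: J_def)
      have "row m \<le> (\<Sum>j\<in>J m. \<bar>walk_kernel (m - s, j - l)\<bar>) + (\<Sum>j\<in>J m. \<bar>walk_kernel (m, j)\<bar>)"
        unfolding row_def sum.distrib[symmetric] by (intro sum_mono) auto
      also have "(\<Sum>j\<in>J m. \<bar>walk_kernel (m - s, j - l)\<bar>) = (\<Sum>j\<in>(\<lambda>j. j - l) ` J m. \<bar>walk_kernel (m - s, j)\<bar>)"
        by (subst sum.reindex) (auto simp: inj_on_def)
      also have "\<dots> \<le> 108 / real_of_int (R ^ 2)"
      proof (rule walk_kernel_tail)
        fix j assume "j \<in> (\<lambda>j. j - l) ` J m"
        then obtain j' where "j' \<in> J m" "j = j' - l" by auto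
        then show "R < \<bar>j\<bar>" using J[of j'] sl(2) by linarith
      qed (use fJ R in auto)
      also have "(\<Sum>j\<in>J m. \<bar>walk_kernel (m, j)\<bar>) \<le> 108 / real_of_int (R ^ 2)"
      proof (rule walk_kernel_tail)
        fix j assume "j \<in> J m"
        then show "R < \<bar>j\<bar>" using J[of j] R(1) by linarith
      qed (use fJ R in auto)
      finally show ?thesis by simp
    qed
    then have "(\<Sum>m\<in>M \<inter> {m. \<bar>m\<bar> \<le> 2 * R ^ 2}. row m) \<le> card (M \<inter> {m. \<bar>m\<bar> \<le> 2 * R ^ 2}) * (216 / real_of_int (R ^ 2))"
      by (intro sum_bounded_above) auto
    also have "\<dots> \<le> real_of_int (5 * R ^ 2) * (216 / real_of_int (R ^ 2))"
    proof (intro mult_right_mono)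
      have "card (M \<inter> {m. \<bar>m\<bar> \<le> 2 * R ^ 2}) \<le> card {- (2 * R ^ 2)..2 * R ^ 2}"
        by (intro card_mono) auto
      also have "int \<dots> \<le> 5 * R ^ 2" using R1 by simp
      finally show "real (card (M \<inter> {m. \<bar>m\<bar> \<le> 2 * R ^ 2})) \<le> real_of_int (5 * R ^ 2)" by linarith
    qed auto
    also have "\<dots> = 1080" using R by simp
    finally show ?thesis .
  qed
  also have "(\<Sum>m\<in>M \<inter> {m. 2 * R ^ 2 < m}. row m) \<le> 1944"
  proof -
    let ?M = "M \<inter> {m. 2 * R ^ 2 < m}"
    have N: "0 < 2 * R ^ 2" using R1 by linarith
    have sq: "sqrt (real_of_int (2 * R ^ 2)) \<ge> R" using R by (intro real_le_rsqrt) auto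
    have "(\<Sum>m\<in>?M. row m) \<le> (\<Sum>m\<in>?M. 648 * real_of_int R * (1 / (m * sqrt m)) + 1296 * real_of_int (R ^ 2) * (1 / (real_of_int m)\<^sup>2))"
      unfolding row_def using walk_kernel_row[OF fJ sl _ R(1)] by (intro sum_mono) auto
    also have "\<dots> \<le> 648 * real_of_int R * (2 / sqrt (real_of_int (2 * R ^ 2))) + 1296 * real_of_int (R ^ 2) * (1 / real_of_int (2 * R ^ 2))"
      unfolding sum.distrib sum_distrib_left[symmetric] using fM R N
      by (intro add_mono mult_left_mono sum_inverse_powers_le) auto
    also have "\<dots> \<le> 648 * real_of_int R * (2 / real_of_int R) + 648"
      using R sq by (intro add_mono mult_left_mono divide_left_mono) (auto intro!: mult_pos_pos)
    also have "\<dots> = 1944" using R by simp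
    finally show ?thesis .
  qed
  finally show "(\<Sum>z\<in>G. \<bar>walk_kernel (z - (s, l)) - walk_kernel z\<bar>) \<le> 4000" by simp
qed

subsection \<open>The energy estimate\<close>

text \<open>The non-negative generator, minus a quarter of the second difference; the walk equation
  reads v (n + 1) - v n + \<open>lgen\<close> (v n) = f (n + 1).\<close>

definition lgen :: "(int \<Rightarrow> real) \<Rightarrow> int \<Rightarrow> real" where
  "lgen g k = g k - lstep g k"

definition ip :: "int \<Rightarrow> (int \<Rightarrow> real) \<Rightarrow> (int \<Rightarrow> real) \<Rightarrow> real" where
  "ip L g h = (\<Sum>k\<in>{-L..L}. g k * h k)"

lemma ip_commute: "ip L g h = ip L h g"
  by (simp add: ip_def mult.commute)

lemma ip_add_left: "ip L (\<lambda>k. g k + g' k) h = ip L g h + ip L g' h"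
  by (simp add: ip_def algebra_simps sum.distrib)

lemma ip_diff_left: "ip L (\<lambda>k. g k - g' k) h = ip L g h - ip L g' h"
  by (simp add: ip_def algebra_simps sum_subtractf)

lemma ip_self_nonneg: "0 \<le> ip L g g"
  by (auto simp: ip_def intro!: sum_nonneg)

lemma ip_young:
  assumes "0 < e"
  shows "\<bar>ip L g h\<bar> \<le> e * ip L g g + ip L h h / (4 * e)"
proof -
  have "\<bar>ip L g h\<bar> \<le> (\<Sum>k\<in>{-L..L}. e * (g k * g k) + h k * h k / (4 * e))"
    unfolding ip_def
  proof (rule order_trans[OF sum_abs sum_mono])
    fix k
    have "0 \<le> (2 * e * \<bar>g k\<bar> - \<bar>h k\<bar>)\<^sup>2" by simp
    then have "4 * e * (\<bar>g k\<bar> * \<bar>h k\<bar>) \<le> 4 * e * (e * (\<bar>g k\<bar> * \<bar>g k\<bar>)) + \<bar>h k\<bar> * \<bar>h k\<bar>"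
      by (simp only: power2_eq_square algebra_simps)
    then show "\<bar>g k * h k\<bar> \<le> e * (g k * g k) + h k * h k / (4 * e)"
      using assms by (simp add: abs_mult field_simps)
  qed
  then show ?thesis
    by (simp add: ip_def sum.distrib sum_distrib_left sum_divide_distrib)
qed

lemma ip_lgen_self_adjoint:
  assumes "\<And>j. L \<le> \<bar>j\<bar> \<Longrightarrow> g j = 0"
  shows "ip L (lgen g) h = ip L g (lgen h)"
  using lstep_self_adjoint[of L g h] assms
  by (simp add: ip_def lgen_def left_diff_distrib right_diff_distrib sum_subtractf)

lemma ip_shift_products:
  fixes g :: "int \<Rightarrow> real"
  assumes "\<And>j. L \<le> \<bar>j\<bar> \<Longrightarrow> g j = 0"
  shows "(\<Sum>k\<in>{-L..L}. g k * g (k - 1)) = (\<Sum>k\<in>{-L..L}. g k * g (k + 1))"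
    and "(\<Sum>k\<in>{-L..L}. g (k + 1) * g (k + 1)) = (\<Sum>k\<in>{-L..L}. g k * g k)"
  using sum_shift_int(1)[of L "\<lambda>k. g k * g (k + 1)"] sum_shift_int(2)[of L "\<lambda>k. g k * g k"] assms
  by (auto simp: mult.commute)

text \<open>Both summands of the identity \<open>lgen\<close> + \<open>lstep\<close> are
  non-negative forms, written as sums of squares. For \<open>lstep\<close> this is due to laziness:
  the mean of the two neighbours alone would give an indefinite form.\<close>

lemma ip_lstep_eq:
  assumes "\<And>j. L \<le> \<bar>j\<bar> \<Longrightarrow> g j = 0"
  shows "ip L g (lstep g) = (\<Sum>k\<in>{-L..L}. (g k + g (k + 1))\<^sup>2) / 4"
    and "ip L g (lgen g) = (\<Sum>k\<in>{-L..L}. (g k - g (k + 1))\<^sup>2) / 4"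
proof -
  have 1: "ip L g (lstep g) = ((\<Sum>k\<in>{-L..L}. g k * g (k - 1)) + 2 * (\<Sum>k\<in>{-L..L}. g k * g k) + (\<Sum>k\<in>{-L..L}. g k * g (k + 1))) / 4"
    by (simp add: ip_def lstep_def sum_distrib_left sum_divide_distrib flip: sum.distrib) (simp add: algebra_simps)
  have 2: "(\<Sum>k\<in>{-L..L}. (g k + g (k + 1))\<^sup>2) = (\<Sum>k\<in>{-L..L}. g k * g k) + 2 * (\<Sum>k\<in>{-L..L}. g k * g (k + 1)) + (\<Sum>k\<in>{-L..L}. g (k + 1) * g (k + 1))"
    by (simp add: sum_distrib_left power2_eq_square flip: sum.distrib) (simp add: algebra_simps)
  have 3: "(\<Sum>k\<in>{-L..L}. (g k - g (k + 1))\<^sup>2) = (\<Sum>k\<in>{-L..L}. g k * g k) - 2 * (\<Sum>k\<in>{-L..L}. g k * g (k + 1)) + (\<Sum>k\<in>{-L..L}. g (k + 1) * g (k + 1))"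
    by (simp add: sum_distrib_left power2_eq_square flip: sum.distrib sum_subtractf) (simp add: algebra_simps)
  have 4: "ip L g (lgen g) = (\<Sum>k\<in>{-L..L}. g k * g k) - ip L g (lstep g)"
    by (simp add: ip_def lgen_def right_diff_distrib sum_subtractf)
  show "ip L g (lstep g) = (\<Sum>k\<in>{-L..L}. (g k + g (k + 1))\<^sup>2) / 4"
    using 1 2 ip_shift_products[of L g] assms by simp
  then show "ip L g (lgen g) = (\<Sum>k\<in>{-L..L}. (g k - g (k + 1))\<^sup>2) / 4"
    using 2 3 4 ip_shift_products[of L g] assms by simp
qed

lemma ip_lgen_nonneg:
  assumes "\<And>j. L \<le> \<bar>j\<bar> \<Longrightarrow> g j = 0"
  shows "0 \<le> ip L g (lgen g)" "0 \<le> ip L g (lstep g)"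
  using ip_lstep_eq[of L g] assms sum_nonneg[of "{-L..L}" "\<lambda>k. (g k - g (k + 1))\<^sup>2"]
    sum_nonneg[of "{-L..L}" "\<lambda>k. (g k + g (k + 1))\<^sup>2"] by simp_all

text \<open>\<open>lstep\<close> is the two-point mean r followed by its adjoint, and the mean
  commutes with \<open>lgen\<close>. The pairing is therefore the energy of r.\<close>

lemma ip_lgen_lstep_nonneg:
  assumes "\<And>j. L - 1 \<le> \<bar>j\<bar> \<Longrightarrow> g j = 0"
  shows "0 \<le> ip L (lgen g) (lstep g)"
proof -
  define r where "r k = (g k + g (k + 1)) / 2" for k
  have r0: "L \<le> \<bar>j\<bar> \<Longrightarrow> r j = 0" for j using assms[of j] assms[of "j + 1"] by (auto simp: r_def)
  have a0: "L \<le> \<bar>j\<bar> \<Longrightarrow> lgen g j = 0" for j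
    using assms[of j] assms[of "j + 1"] assms[of "j - 1"] by (auto simp: lgen_def lstep_def)
  have "ip L (lgen g) (lstep g) = ((\<Sum>k\<in>{-L..L}. lgen g k * r k) + (\<Sum>k\<in>{-L..L}. lgen g k * r (k - 1))) / 2"
    by (simp add: ip_def lstep_def r_def sum_divide_distrib flip: sum.distrib)
       (rule sum.cong, auto simp: field_simps)
  also have "(\<Sum>k\<in>{-L..L}. lgen g k * r (k - 1)) = (\<Sum>k\<in>{-L..L}. lgen g (k + 1) * r k)"
    using sum_shift_int(2)[of L "\<lambda>k. lgen g k * r (k - 1)"] a0 by simp
  also have "((\<Sum>k\<in>{-L..L}. lgen g k * r k) + (\<Sum>k\<in>{-L..L}. lgen g (k + 1) * r k)) / 2 = ip L r (lgen r)"
    by (simp add: ip_def lgen_def lstep_def r_def sum_divide_distrib flip: sum.distrib) (simp add: field_simps)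
  also have "\<dots> \<ge> 0" by (rule ip_lgen_nonneg) (rule r0)
  finally show ?thesis .
qed

text \<open>These are A^2 \<le> A \<le> 1 and (1 - A)^2 \<le> 1 for the operator A =
  \<open>lgen\<close>, read off from g = A g + (1 - A) g and the non-negative cross term.\<close>

lemma ip_lgen_bounds:
  assumes "\<And>j. L - 1 \<le> \<bar>j\<bar> \<Longrightarrow> g j = 0"
  shows "ip L (lgen g) (lgen g) \<le> ip L g (lgen g)"
    and "ip L g (lgen g) \<le> ip L g g"
    and "ip L (lstep g) (lstep g) \<le> ip L g g"
proof -
  have g: "g = (\<lambda>k. lgen g k + lstep g k)" by (simp add: lgen_def)
  have z: "\<And>j. L \<le> \<bar>j\<bar> \<Longrightarrow> g j = 0" using assms by auto
  note n = ip_lgen_lstep_nonneg[of L g, OF assms] ip_lgen_nonneg[of L g, OF z]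
  have 1: "ip L g h = ip L (lgen g) h + ip L (lstep g) h" for h
    using ip_add_left[of L "lgen g" "lstep g" h] by (simp flip: g)
  show "ip L (lgen g) (lgen g) \<le> ip L g (lgen g)"
    using 1[of "lgen g"] n ip_commute[of L "lstep g" "lgen g"] by simp
  have "ip L g g = ip L g (lgen g) + ip L g (lstep g)"
    using 1[of g] by (simp add: ip_commute)
  then show "ip L g (lgen g) \<le> ip L g g" "ip L (lstep g) (lstep g) \<le> ip L g g"
    using n 1[of "lstep g"] by auto
qed

text \<open>The equation is tested with the sum of \<open>lgen\<close> of the old and of the new
  value. By self-adjointness the time difference then telescopes exactly to the increment of the
  energy of v, and no discretization error in time has to be absorbed. The window leaves room for
  the support, which grows by one per step, and for the operators applied on top.\<close>

lemma discrete_heat_energy: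
  assumes v0: "v 0 = f 0" and vS: "\<And>n. v (Suc n) = (\<lambda>k. lstep (v n) k + f (Suc n) k)"
    and f0: "\<And>n k. B < \<bar>k\<bar> \<Longrightarrow> f n k = 0" and L: "B + int N + 3 \<le> L"
  shows "(\<Sum>n\<le>N. ip L (lgen (v n)) (lgen (v n))) \<le> 13 * (\<Sum>n\<le>N. ip L (f n) (f n))"
proof -
  have sv: "B + int n < \<bar>k\<bar> \<Longrightarrow> v n k = 0" for n k
  proof (induction n arbitrary: k)
    case (Suc n)
    then show ?case using f0[of k "Suc n"] by (auto simp: vS lstep_def)
  qed (use v0 f0 in auto)
  \<comment> \<open>The energy is carried with the factor 2 because half of the dissipation is spent
    on absorbing error terms. The sum stops before n; the last term is recovered from the energy at
    the end.\<close>
  have ind: "(\<Sum>n<n. ip L (lgen (v n)) (lgen (v n))) + 2 * ip L (v n) (lgen (v n)) \<le> 13 * (\<Sum>n\<le>n. ip L (f n) (f n))"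
    if "n \<le> N" for n
    using that
  proof (induction n)
    case 0
    have "ip L (f 0) (lgen (f 0)) \<le> ip L (f 0) (f 0)"
      by (rule ip_lgen_bounds) (use f0 L in auto)
    then show ?case using ip_self_nonneg[of L "f 0"] by (simp add: v0)
  next
    case (Suc n)
    let ?x = "v n" and ?y = "v (Suc n)" and ?F = "f (Suc n)"
    let ?a = "lgen ?x" and ?b = "lgen ?y"
    have x0: "L - 1 \<le> \<bar>j\<bar> \<Longrightarrow> ?x j = 0" and x1: "L \<le> \<bar>j\<bar> \<Longrightarrow> ?x j = 0"
      and a0: "L - 1 \<le> \<bar>j\<bar> \<Longrightarrow> ?a j = 0" and a1: "L \<le> \<bar>j\<bar> \<Longrightarrow> ?a j = 0"
      and y1: "L \<le> \<bar>j\<bar> \<Longrightarrow> ?y j = 0" and F0: "L - 1 \<le> \<bar>j\<bar> \<Longrightarrow> ?F j = 0" for j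
      using sv[of n j] sv[of n "j + 1"] sv[of n "j - 1"] sv[of "Suc n" j] f0[of j "Suc n"] L Suc.prems
      by (auto simp: lgen_def lstep_def)
    have y: "?y k = ?x k - ?a k + ?F k" for k by (simp add: vS lgen_def)
    have b: "?b = (\<lambda>k. lstep ?a k + lgen ?F k)"
      by (rule ext) (simp add: lgen_def lstep_def y, simp add: field_simps)
    have sym: "ip L ?a ?y = ip L ?x ?b" by (rule ip_lgen_self_adjoint) (rule x1)
    have e1: "ip L ?y h = ip L ?x h - ip L ?a h + ip L ?F h" for h
      using ip_add_left[of L "\<lambda>k. ?x k - ?a k" ?F h] ip_diff_left[of L ?x ?a h] y by (simp add: ip_def)
    have e2: "ip L ?a ?a + ip L ?a ?b = ip L ?F ?a + ip L ?F ?b + ip L ?x ?a - ip L ?y ?b"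
      using e1[of ?a] e1[of ?b] sym ip_commute[of L ?a ?y] by simp
    have e3: "ip L ?a ?b = ip L ?a (lstep ?a) + ip L ?a (lgen ?F)"
      unfolding b using ip_add_left[of L "lstep ?a" "lgen ?F" ?a] by (simp add: ip_commute)
    have p: "0 \<le> ip L ?a (lstep ?a)" by (rule ip_lgen_nonneg) (rule a1)
    have lF: "ip L (lgen ?F) (lgen ?F) \<le> ip L ?F ?F"
      using ip_lgen_bounds(1,2)[of L ?F, OF F0] by linarith
    have bb: "ip L ?b ?b \<le> 2 * ip L ?a ?a + 2 * ip L ?F ?F"
    proof -
      have "ip L ?b ?b \<le> 2 * ip L (lstep ?a) (lstep ?a) + 2 * ip L (lgen ?F) (lgen ?F)"
        unfolding b ip_def sum_distrib_left sum.distrib[symmetric]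
      proof (rule sum_mono)
        fix k
        have "0 \<le> (lstep ?a k - lgen ?F k)\<^sup>2" by simp
        then show "(lstep ?a k + lgen ?F k) * (lstep ?a k + lgen ?F k) \<le> 2 * (lstep ?a k * lstep ?a k) + 2 * (lgen ?F k * lgen ?F k)"
          by (simp add: power2_eq_square algebra_simps)
      qed
      then show ?thesis using lF ip_lgen_bounds(3)[of L ?a, OF a0] by linarith
    qed
    have y1: "\<bar>ip L ?F ?a\<bar> \<le> 2 * ip L ?F ?F + ip L ?a ?a / 8"
      using ip_young[of 2 L ?F ?a] by simp
    have y2: "\<bar>ip L ?F ?b\<bar> \<le> 2 * ip L ?F ?F + ip L ?b ?b / 8"
      using ip_young[of 2 L ?F ?b] by simp
    have y3: "\<bar>ip L ?a (lgen ?F)\<bar> \<le> 2 * ip L (lgen ?F) (lgen ?F) + ip L ?a ?a / 8"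
      using ip_young[of 2 L "lgen ?F" ?a] by (simp add: ip_commute)
    \<comment> \<open>The Young terms use up 1/8 + 1/4 + 1/8 of the square norm of
      \<open>?a\<close>. Doubling what is left gives the constant 12.5, rounded up to 13.\<close>
    have step: "ip L ?a ?a \<le> 13 * ip L ?F ?F + 2 * ip L ?x ?a - 2 * ip L ?y ?b"
      using e2 e3 p lF bb y1 y2 y3 ip_self_nonneg[of L ?F] by (simp add: abs_le_iff)
    show ?case using Suc.IH Suc.prems step by (simp add: distrib_left)
  qed
  have "ip L (lgen (v N)) (lgen (v N)) \<le> ip L (v N) (lgen (v N))"
    by (rule ip_lgen_bounds) (use sv L in auto)
  moreover have "0 \<le> ip L (lgen (v N)) (lgen (v N))" by (rule ip_self_nonneg)
  ultimately show ?thesis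
    using ind[of N] by (simp add: lessThan_Suc_atMost[symmetric])
qed

text \<open>All data are placed in one time window starting at n0 and in one space window, and v is
  their Duhamel sum. The image under the kernel is -4 \<open>lgen\<close> v, so 208 = 16 times
  13.\<close>

lemma walk_kernel_l2:
  assumes F: "finite F" and G: "finite G"
  shows "(\<Sum>z\<in>G. (\<Sum>w\<in>F. walk_kernel (z - w) * f w)\<^sup>2) \<le> 208 * (\<Sum>w\<in>F. (f w)\<^sup>2)"
proof -
  define X where "X = insert 0 (fst ` F \<union> fst ` G)"
  define n0 where "n0 = Min X"
  define N where "N = nat (Max X - n0)"
  define Y where "Y = insert 0 (snd ` F \<union> snd ` G)"
  define B where "B = Max (abs ` Y)"
  define L where "L = B + int N + 3"
  have fX: "finite X" "X \<noteq> {}" and fY: "finite Y" using F G by (auto simp: X_def Y_def)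
  have X: "n0 \<le> x \<and> x \<le> n0 + int N" if "x \<in> X" for x
    using that fX Min_le[of X x] Max_ge[of X x] by (auto simp: n0_def N_def)
  have Y: "\<bar>y\<bar> \<le> B" if "y \<in> Y" for y
    using that fY by (auto simp: B_def)
  define fn where "fn n k = (if (n0 + int n, k) \<in> F then f (n0 + int n, k) else 0)" for n k
  define v where "v n k = (\<Sum>w\<in>F \<inter> {w. fst w \<le> n0 + int n}. lazy_walk (nat (n0 + int n - fst w)) (k - snd w) * f w)" for n k
  have delta: "(\<Sum>w\<in>F \<inter> {w. fst w = n0 + int n}. lazy_walk 0 (k - snd w) * f w) = fn n k" for n k
  proof -
    have "(\<Sum>w\<in>F \<inter> {w. fst w = n0 + int n}. lazy_walk 0 (k - snd w) * f w)
       = (\<Sum>w\<in>F. if w = (n0 + int n, k) then f w else 0)"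
      using F by (intro sum.mono_neutral_cong_left) (auto simp: prod_eq_iff split: if_splits)
    then show ?thesis using F by (simp add: fn_def)
  qed
  have v0: "v 0 = fn 0"
  proof
    fix k
    have "F \<inter> {w. fst w \<le> n0 + int 0} = F \<inter> {w. fst w = n0 + int 0}"
    proof -
      have "n0 \<le> fst w" if "w \<in> F" for w using X[of "fst w"] that by (auto simp: X_def)
      then show ?thesis by (auto intro: antisym)
    qed
    then have "v 0 k = (\<Sum>w\<in>F \<inter> {w. fst w = n0 + int 0}. lazy_walk 0 (k - snd w) * f w)"
      unfolding v_def by (intro sum.cong) auto
    then show "v 0 k = fn 0 k" using delta[of k 0] by simp
  qed
  have vS: "v (Suc n) = (\<lambda>k. lstep (v n) k + fn (Suc n) k)" for n
  proof
    fix k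
    have split: "F \<inter> {w. fst w \<le> n0 + int (Suc n)} = (F \<inter> {w. fst w \<le> n0 + int n}) \<union> (F \<inter> {w. fst w = n0 + int (Suc n)})"
      by auto
    have "v (Suc n) k = (\<Sum>w\<in>F \<inter> {w. fst w \<le> n0 + int n}. lazy_walk (nat (n0 + int (Suc n) - fst w)) (k - snd w) * f w)
       + (\<Sum>w\<in>F \<inter> {w. fst w = n0 + int (Suc n)}. lazy_walk (nat (n0 + int (Suc n) - fst w)) (k - snd w) * f w)"
      unfolding v_def split using F by (intro sum.union_disjoint) auto
    also have "(\<Sum>w\<in>F \<inter> {w. fst w = n0 + int (Suc n)}. lazy_walk (nat (n0 + int (Suc n) - fst w)) (k - snd w) * f w) = fn (Suc n) k"
      unfolding delta[symmetric] by (intro sum.cong) auto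
    also have "(\<Sum>w\<in>F \<inter> {w. fst w \<le> n0 + int n}. lazy_walk (nat (n0 + int (Suc n) - fst w)) (k - snd w) * f w)
       = (\<Sum>w\<in>F \<inter> {w. fst w \<le> n0 + int n}. lstep (lazy_walk (nat (n0 + int n - fst w))) (k - snd w) * f w)"
    proof (intro sum.cong refl)
      fix w assume "w \<in> F \<inter> {w. fst w \<le> n0 + int n}"
      then have "nat (n0 + int (Suc n) - fst w) = Suc (nat (n0 + int n - fst w))" by auto
      then show "lazy_walk (nat (n0 + int (Suc n) - fst w)) (k - snd w) * f w = lstep (lazy_walk (nat (n0 + int n - fst w))) (k - snd w) * f w"
        by simp
    qed
    also have "\<dots> = lstep (v n) k"
      by (simp add: lstep_def v_def sum_distrib_left sum_divide_distrib flip: sum.distrib) (simp add: algebra_simps)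
    finally show "v (Suc n) k = lstep (v n) k + fn (Suc n) k" .
  qed
  have f0: "B < \<bar>k\<bar> \<Longrightarrow> fn n k = 0" for n k
  proof (rule ccontr)
    assume "B < \<bar>k\<bar>" "fn n k \<noteq> 0"
    then have "(n0 + int n, k) \<in> F" by (auto simp: fn_def split: if_splits)
    then have "k \<in> Y" by (force simp: Y_def)
    then show False using Y[of k] \<open>B < \<bar>k\<bar>\<close> by simp
  qed
  have T: "(\<Sum>w\<in>F. walk_kernel ((n0 + int n, k) - w) * f w) = - 4 * lgen (v n) k" for n k
  proof -
    have "(\<Sum>w\<in>F. walk_kernel ((n0 + int n, k) - w) * f w)
      = (\<Sum>w\<in>F \<inter> {w. fst w \<le> n0 + int n}. (fdiff ^^ 2) (lazy_walk (nat (n0 + int n - fst w))) (k - snd w - 1) * f w)"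
      using F by (intro sum.mono_neutral_cong_right) (auto simp: walk_kernel_def)
    also have "\<dots> = - 4 * lgen (v n) k"
      by (simp add: lgen_def lstep_def v_def sum_distrib_left sum_divide_distrib sum_negf[symmetric] numeral_2_eq_2 fdiff_def
          flip: sum.distrib sum_subtractf) (intro sum.cong refl, simp add: field_simps)
    finally show ?thesis .
  qed
  let ?box = "{..N} \<times> {-L..L}"
  have inbox: "\<exists>x\<in>?box. z = (n0 + int (fst x), snd x)" if "z \<in> F \<union> G" for z
  proof -
    have "fst z \<in> X" "snd z \<in> Y" using that by (auto simp: X_def Y_def)
    then show ?thesis using X[of "fst z"] Y[of "snd z"]
      by (intro bexI[of _ "(nat (fst z - n0), snd z)"]) (auto simp: L_def)
  qed
  have inj: "inj_on (\<lambda>x. (n0 + int (fst x), snd x)) A" for A by (auto simp: inj_on_def)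
  have "(\<Sum>z\<in>G. (\<Sum>w\<in>F. walk_kernel (z - w) * f w)\<^sup>2)
     \<le> (\<Sum>z\<in>(\<lambda>x. (n0 + int (fst x), snd x)) ` ?box. (\<Sum>w\<in>F. walk_kernel (z - w) * f w)\<^sup>2)"
  proof (rule sum_mono2)
    show "G \<subseteq> (\<lambda>x. (n0 + int (fst x), snd x)) ` ?box" using inbox by blast
  qed auto
  also have "\<dots> = (\<Sum>x\<in>?box. 16 * (lgen (v (fst x)) (snd x) * lgen (v (fst x)) (snd x)))"
    by (subst sum.reindex[OF inj]) (simp add: T power2_eq_square)
  also have "\<dots> = 16 * (\<Sum>n\<le>N. ip L (lgen (v n)) (lgen (v n)))"
    unfolding ip_def sum_distrib_left by (subst sum.cartesian_product) (simp add: split_beta)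
  also have "\<dots> \<le> 16 * (13 * (\<Sum>n\<le>N. ip L (fn n) (fn n)))"
    by (intro mult_left_mono discrete_heat_energy[OF v0 vS f0]) (auto simp: L_def)
  also have "(\<Sum>n\<le>N. ip L (fn n) (fn n)) = (\<Sum>x\<in>?box. (fn (fst x) (snd x))\<^sup>2)"
    unfolding ip_def by (subst sum.cartesian_product) (simp add: split_beta power2_eq_square)
  also have "\<dots> = (\<Sum>z\<in>(\<lambda>x. (n0 + int (fst x), snd x)) ` ?box. if z \<in> F then (f z)\<^sup>2 else 0)"
    by (subst sum.reindex[OF inj]) (auto simp: fn_def intro!: sum.cong)
  also have "\<dots> = (\<Sum>w\<in>F. (f w)\<^sup>2)"
  proof (rule sum.mono_neutral_cong_right)
    show "F \<subseteq> (\<lambda>x. (n0 + int (fst x), snd x)) ` ?box" using inbox by blast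
  qed auto
  finally show ?thesis by simp
qed

subsection \<open>Calderon-Zygmund theory on the parabolic lattice\<close>

text \<open>A cell of generation i contains 4^i times and 2^i positions, hence 8^i points, in
  accordance with parabolic scaling. Floor division indexes the cells and makes the generations
  nested.\<close>

definition cell :: "nat \<Rightarrow> int \<times> int \<Rightarrow> int \<times> int" where
  "cell i z = (fst z div 4 ^ i, snd z div 2 ^ i)"

text \<open>Lower corner of the cell, the common base point from which the kernel is displaced for
  all points of the cell.\<close>

definition corner :: "nat \<Rightarrow> int \<times> int \<Rightarrow> int \<times> int" where
  "corner i z = (4 ^ i * (fst z div 4 ^ i), 2 ^ i * (snd z div 2 ^ i))"

definition dyadic_box :: "nat \<Rightarrow> int \<times> int \<Rightarrow> (int \<times> int) set" where
  "dyadic_box i z = {w. cell i w = cell i z}"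

lemma cell_0: "cell 0 z = z"
  by (simp add: cell_def)

lemma cell_mono:
  assumes "cell i w = cell i z" "i \<le> j"
  shows "cell j w = cell j z"
proof -
  obtain k where j: "j = i + k" using assms(2) le_Suc_ex by blast
  have "x div b ^ j = x div b ^ i div b ^ k" if "0 < b" for x b :: int
    using that by (simp add: j power_add zdiv_zmult2_eq)
  then show ?thesis using assms(1) by (simp add: cell_def)
qed

lemma dyadic_box_eq: "dyadic_box i z = {4 ^ i * fst (cell i z)..<4 ^ i * fst (cell i z) + 4 ^ i} \<times> {2 ^ i * snd (cell i z)..<2 ^ i * snd (cell i z) + 2 ^ i}"
proof -
  have "x div b = q \<longleftrightarrow> b * q \<le> x \<and> x < b * q + b" if "0 < b" for x b q :: int
  proof
    assume "x div b = q"
    then have "x = b * q + x mod b" by (metis mult_div_mod_eq)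
    then show "b * q \<le> x \<and> x < b * q + b" using pos_mod_sign[OF that, of x] pos_mod_bound[OF that, of x] by linarith
  next
    assume "b * q \<le> x \<and> x < b * q + b"
    then show "x div b = q" by (intro int_div_pos_eq[where r = "x - b * q"]) auto
  qed
  then show ?thesis by (auto simp: dyadic_box_def cell_def prod_eq_iff)
qed

lemma finite_dyadic_box: "finite (dyadic_box i z)" and card_dyadic_box: "card (dyadic_box i z) = 8 ^ i"
proof -
  show "finite (dyadic_box i z)" by (simp add: dyadic_box_eq)
  have "(4::nat) ^ i * 2 ^ i = 8 ^ i" by (simp flip: power_mult_distrib)
  then show "card (dyadic_box i z) = 8 ^ i" by (simp add: dyadic_box_eq card_cartesian_product nat_power_eq)
qed

lemma corner_in_dyadic_box: "w \<in> dyadic_box i z \<Longrightarrow> corner i w = corner i z"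
  by (simp add: dyadic_box_def cell_def corner_def)

lemma corner_bounds: "\<bar>fst (z - corner i z)\<bar> \<le> 4 ^ i" "\<bar>snd (z - corner i z)\<bar> \<le> 2 ^ i"
  by (auto simp: corner_def minus_mult_div_eq_mod abs_le_iff less_imp_le)

text \<open>Calderon-Zygmund decomposition: single points are the cells of generation 0, hence no
  differentiation theorem is needed off the bad set.\<close>

lemma weak_type:
  fixes K :: "int \<times> int \<Rightarrow> real"
  assumes L2: "\<And>F G f. finite F \<Longrightarrow> finite G \<Longrightarrow> (\<Sum>z\<in>G. (\<Sum>w\<in>F. K (z - w) * f w)\<^sup>2) \<le> C2 * (\<Sum>w\<in>F. (f w)\<^sup>2)"
    and H: "hormander K C1" and F: "finite F" and G: "finite G" and a: "0 < a"
    and nonneg: "0 \<le> C1" "0 \<le> C2"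
  shows "a * card {z\<in>G. a < \<bar>\<Sum>w\<in>F. K (z - w) * f w\<bar>} \<le> (32 * C2 + 4 * C1 + 25) * (\<Sum>w\<in>F. \<bar>f w\<bar>)"
proof -
  define g0 where "g0 w = (if w \<in> F then f w else 0)" for w
  define I where "I i z = (\<Sum>w\<in>F \<inter> dyadic_box i z. \<bar>f w\<bar>)" for i z
  define T where "T = (\<Sum>w\<in>F. \<bar>f w\<bar>)"
  have I_box: "I i w = I i z" if "w \<in> dyadic_box i z" for i w z
    using that by (simp add: I_def dyadic_box_def)
  have I_le: "I i z \<le> T" for i z unfolding I_def T_def using F by (intro sum_mono2) auto
  have T0: "0 \<le> T" by (simp add: T_def sum_nonneg)
  \<comment> \<open>The total mass limits the generation of a bad cell: from i0 on no average
    exceeds a, so maximal bad cells exist.\<close>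
  obtain i0 :: nat where i0: "T / a < 8 ^ i0" using real_arch_pow[of 8 "T / a"] by auto
  have big: "I i z \<le> a * 8 ^ i" if "i0 \<le> i" for i z
  proof -
    have "(8::real) ^ i0 \<le> 8 ^ i" using that by (simp add: power_increasing)
    then have "a * 8 ^ i0 \<le> a * 8 ^ i" using a by simp
    moreover have "T < a * 8 ^ i0" using i0 a by (simp add: divide_less_eq mult.commute)
    ultimately have "T < a * 8 ^ i" by linarith
    then show ?thesis using I_le[of i z] by simp
  qed
  define S where "S z = {i. a * 8 ^ i < I i z}" for z
  have S_sub: "S z \<subseteq> {..i0}" for z
  proof
    fix i assume "i \<in> S z"
    then show "i \<in> {..i0}" using big[of i z] by (cases "i \<le> i0") (auto simp: S_def)
  qed
  then have fS: "finite (S z)" for z by (rule finite_subset) auto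
  define \<Omega> where "\<Omega> = {z. S z \<noteq> {}}"
  \<comment> \<open>Generation of the largest bad cell containing z, meaningful for z in
    \<Omega>.\<close>
  define n where "n z = Max (S z)" for z
  have n_in: "a * 8 ^ n z < I (n z) z" if "z \<in> \<Omega>" for z
    using that Max_in[OF fS[of z]] by (auto simp: \<Omega>_def n_def S_def)
  have n_max: "I i z \<le> a * 8 ^ i" if "n z < i" for i z
    using that Max_ge[OF fS[of z], of i] by (cases "i \<in> S z") (auto simp: n_def S_def)
  define Q where "Q z = dyadic_box (n z) z" for z
  have self: "z \<in> Q z" for z by (simp add: Q_def dyadic_box_def)
  \<comment> \<open>Points of one maximal bad cell see the same averages from that generation on and
    therefore select the same cell. So these cells partition \<Omega>, and averages over them are
    constant on each.\<close>
  have same: "w \<in> \<Omega>" "n w = n z" "Q w = Q z" if "z \<in> \<Omega>" "w \<in> Q z" for z w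
  proof -
    have e: "I i w = I i z" if "n z \<le> i" for i
    proof (rule I_box)
      show "w \<in> dyadic_box i z" using \<open>w \<in> Q z\<close> cell_mono[of "n z" w z i] that by (auto simp: Q_def dyadic_box_def)
    qed
    have nS: "n z \<in> S w" using n_in[OF that(1)] e[of "n z"] by (simp add: S_def)
    then show "w \<in> \<Omega>" by (auto simp: \<Omega>_def)
    have "i \<le> n z" if "i \<in> S w" for i
    proof (rule ccontr)
      assume "\<not> i \<le> n z"
      then have "I i w \<le> a * 8 ^ i" using e[of i] n_max[of z i] by simp
      then show False using that by (simp add: S_def)
    qed
    then show nn: "n w = n z" using nS fS[of w] by (auto simp: n_def[of w] intro!: Max_eqI)
    show "Q w = Q z" using that(2) by (auto simp: Q_def nn dyadic_box_def)
  qed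
  have Q_sub: "Q z \<subseteq> \<Omega>" if "z \<in> \<Omega>" for z using same(1)[OF that] by auto
  have f\<Omega>: "finite \<Omega>"
  proof (rule finite_subset)
    show "\<Omega> \<subseteq> (\<Union>w\<in>F. \<Union>i\<le>i0. dyadic_box i w)"
    proof
      fix z assume z: "z \<in> \<Omega>"
      have "0 < a * 8 ^ n z" using a by simp
      then have "I (n z) z \<noteq> 0" using n_in[OF z] by linarith
      then obtain w where "w \<in> F" "w \<in> dyadic_box (n z) z"
        unfolding I_def by (elim sum.not_neutral_contains_not_neutral) auto
      moreover have "n z \<le> i0" using S_sub[of z] Max_in[OF fS[of z]] z by (auto simp: n_def \<Omega>_def)
      ultimately show "z \<in> (\<Union>w\<in>F. \<Union>i\<le>i0. dyadic_box i w)" by (auto simp: dyadic_box_def intro!: bexI[of _ w] bexI[of _ "n z"])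
    qed
  qed (use F finite_dyadic_box in auto)
  define \<Q> where "\<Q> = Q ` \<Omega>"
  have f\<Q>: "finite \<Q>" using f\<Omega> by (simp add: \<Q>_def)
  have fib: "{w \<in> \<Omega>. Q w = c} = c" if c: "c \<in> \<Q>" for c
  proof -
    obtain z where z: "z \<in> \<Omega>" "c = Q z" using c by (auto simp: \<Q>_def)
    show ?thesis using same(1,3)[OF z(1)] self z by blast
  qed
  have sum\<Omega>: "(\<Sum>w\<in>\<Omega>. h w) = (\<Sum>c\<in>\<Q>. \<Sum>w\<in>c. h w)" for h :: "int \<times> int \<Rightarrow> real"
  proof -
    have "(\<Sum>w\<in>\<Omega>. h w) = (\<Sum>c\<in>\<Q>. \<Sum>w\<in>{w \<in> \<Omega>. Q w = c}. h w)"
      using f\<Omega> f\<Q> by (intro sum.group[symmetric]) (auto simp: \<Q>_def)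
    then show ?thesis using fib by simp
  qed
  define m where "m z = (\<Sum>w\<in>Q z. g0 w) / 8 ^ n z" for z
  define g where "g z = (if z \<in> \<Omega> then m z else g0 z)" for z
  define b where "b z = g0 z - g z" for z
  have b_off: "b z = 0" if "z \<notin> \<Omega>" for z using that by (simp add: b_def g_def)
  have sum_m: "(\<Sum>w\<in>Q z. m w) = (\<Sum>w\<in>Q z. g0 w)" if z: "z \<in> \<Omega>" for z
  proof -
    have "(\<Sum>w\<in>Q z. m w) = (\<Sum>w\<in>Q z. m z)"
      using same(2,3)[OF z] by (intro sum.cong) (auto simp: m_def)
    then show ?thesis by (simp add: m_def Q_def card_dyadic_box)
  qed
  have sum_b: "(\<Sum>w\<in>c. b w) = 0" if c: "c \<in> \<Q>" for c
  proof -
    obtain z where z: "z \<in> \<Omega>" "c = Q z" using c by (auto simp: \<Q>_def)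
    have "(\<Sum>w\<in>Q z. b w) = (\<Sum>w\<in>Q z. g0 w - m w)"
      using Q_sub[OF z(1)] by (intro sum.cong) (auto simp: b_def g_def)
    then show ?thesis using sum_m[OF z(1)] z by (simp add: sum_subtractf)
  qed
  have Ig0: "(\<Sum>w\<in>Q z. \<bar>g0 w\<bar>) = I (n z) z" for z
    unfolding I_def Q_def g0_def using finite_dyadic_box[of "n z" z]
    by (intro sum.mono_neutral_cong_right) auto
  have m_le: "\<bar>m z\<bar> \<le> I (n z) z / 8 ^ n z" for z
    unfolding m_def Ig0[symmetric] by (simp add: divide_right_mono sum_abs)
  \<comment> \<open>The parent cell is not bad and has eight times as many points, which bounds the
    averages over bad cells by 8 a.\<close>
  have I_8: "I (n z) z \<le> 8 * a * 8 ^ n z" for z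
  proof -
    have "F \<inter> dyadic_box (n z) z \<subseteq> F \<inter> dyadic_box (Suc (n z)) z"
      unfolding dyadic_box_def by (auto intro: cell_mono)
    then have "I (n z) z \<le> I (Suc (n z)) z" unfolding I_def using F by (intro sum_mono2) auto
    also have "\<dots> \<le> a * 8 ^ Suc (n z)" by (rule n_max) simp
    finally show ?thesis by simp
  qed
  have g_le: "\<bar>g z\<bar> \<le> 8 * a" for z
  proof (cases "z \<in> \<Omega>")
    case True
    have "I (n z) z / 8 ^ n z \<le> 8 * a" using I_8[of z] by (simp add: divide_le_eq)
    then show ?thesis using m_le[of z] True by (simp add: g_def)
  next
    case False
    then have "0 \<notin> S z" by (auto simp: \<Omega>_def)
    then have "I 0 z \<le> a" by (simp add: S_def not_less)
    moreover have "\<bar>g0 z\<bar> \<le> I 0 z" by (auto simp: g0_def I_def dyadic_box_def cell_0)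
    ultimately show ?thesis using False a by (simp add: g_def)
  qed
  define F' where "F' = F \<union> \<Omega>"
  have fF': "finite F'" using F f\<Omega> by (simp add: F'_def)
  have T_eq: "(\<Sum>w\<in>F'. \<bar>g0 w\<bar>) = T"
    unfolding T_def F'_def g0_def using F f\<Omega> by (intro sum.mono_neutral_cong_right) auto
  have split': "(\<Sum>w\<in>F'. h w) = (\<Sum>w\<in>\<Omega>. h w) + (\<Sum>w\<in>F' - \<Omega>. h w)" for h :: "int \<times> int \<Rightarrow> real"
    using sum.subset_diff[of \<Omega> F' h] fF' by (simp add: F'_def)
  have m_sum: "(\<Sum>w\<in>\<Omega>. \<bar>m w\<bar>) \<le> (\<Sum>w\<in>\<Omega>. \<bar>g0 w\<bar>)"
    unfolding sum\<Omega>
  proof (rule sum_mono)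
    fix c assume "c \<in> \<Q>"
    then obtain z where z: "z \<in> \<Omega>" "c = Q z" by (auto simp: \<Q>_def)
    have "(\<Sum>w\<in>Q z. \<bar>m w\<bar>) = (\<Sum>w\<in>Q z. \<bar>m z\<bar>)"
      using same(2,3)[OF z(1)] by (intro sum.cong) (auto simp: m_def)
    also have "\<dots> = 8 ^ n z * \<bar>m z\<bar>" by (simp add: Q_def card_dyadic_box)
    also have "\<dots> \<le> I (n z) z" using m_le[of z] by (simp add: field_simps)
    finally show "(\<Sum>w\<in>c. \<bar>m w\<bar>) \<le> (\<Sum>w\<in>c. \<bar>g0 w\<bar>)" by (simp add: z Ig0)
  qed
  have g_sum: "(\<Sum>w\<in>F'. \<bar>g w\<bar>) \<le> T"
    using m_sum unfolding T_eq[symmetric] split' by (simp add: g_def)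
  have b_sum: "(\<Sum>w\<in>\<Omega>. \<bar>b w\<bar>) \<le> 2 * T"
  proof -
    have "(\<Sum>w\<in>\<Omega>. \<bar>b w\<bar>) \<le> (\<Sum>w\<in>\<Omega>. \<bar>g0 w\<bar> + \<bar>m w\<bar>)" by (intro sum_mono) (auto simp: b_def g_def)
    also have "\<dots> \<le> 2 * (\<Sum>w\<in>\<Omega>. \<bar>g0 w\<bar>)" using m_sum by (simp add: sum.distrib)
    also have "(\<Sum>w\<in>\<Omega>. \<bar>g0 w\<bar>) \<le> T" unfolding T_eq[symmetric] F'_def using F f\<Omega> by (intro sum_mono2) auto
    finally show ?thesis by simp
  qed
  define U where "U z = (\<Sum>w\<in>F'. K (z - w) * g w)" for z
  define V where "V z = (\<Sum>w\<in>\<Omega>. K (z - w) * b w)" for z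
  have decomp: "(\<Sum>w\<in>F. K (z - w) * f w) = U z + V z" for z
  proof -
    have "(\<Sum>w\<in>F. K (z - w) * f w) = (\<Sum>w\<in>F'. K (z - w) * g0 w)"
      unfolding F'_def g0_def using F f\<Omega> by (intro sum.mono_neutral_cong_left) auto
    also have "\<dots> = U z + (\<Sum>w\<in>F'. K (z - w) * b w)"
      unfolding U_def sum.distrib[symmetric] by (simp add: b_def algebra_simps)
    also have "(\<Sum>w\<in>F'. K (z - w) * b w) = V z"
      unfolding V_def F'_def using F f\<Omega> b_off by (intro sum.mono_neutral_right) auto
    finally show ?thesis .
  qed
  \<comment> \<open>Doubled box about the corner. Off these boxes, positions relative to the corner
    lie in the region of Hormander's condition.\<close>
  define near where "near w = {z. \<bar>fst (z - corner (n w) w)\<bar> \<le> 2 * 4 ^ n w \<and> \<bar>snd (z - corner (n w) w)\<bar> \<le> 2 * 2 ^ n w}" for w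
  define \<Omega>' where "\<Omega>' = (\<Union>w\<in>\<Omega>. near w)"
  have V_sum: "(\<Sum>z\<in>G - \<Omega>'. \<bar>V z\<bar>) \<le> C1 * (2 * T)"
  proof -
    \<comment> \<open>b has mean zero on each cell and all points of a cell share one corner, so the
      kernel frozen at the corners contributes nothing and may be subtracted.\<close>
    have corner_sum: "(\<Sum>w\<in>\<Omega>. K (z - corner (n w) w) * b w) = 0" for z
      unfolding sum\<Omega>
    proof (rule sum.neutral, intro ballI)
      fix c assume c: "c \<in> \<Q>"
      then obtain y where y: "y \<in> \<Omega>" "c = Q y" by (auto simp: \<Q>_def)
      have "(\<Sum>w\<in>c. K (z - corner (n w) w) * b w) = (\<Sum>w\<in>c. K (z - corner (n y) y) * b w)"
      proof (intro sum.cong refl)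
        fix w assume "w \<in> c"
        then have w: "w \<in> Q y" by (simp add: y)
        show "K (z - corner (n w) w) * b w = K (z - corner (n y) y) * b w"
          using same(2)[OF y(1) w] corner_in_dyadic_box[of w "n y" y] w by (simp add: Q_def)
      qed
      then show "(\<Sum>w\<in>c. K (z - corner (n w) w) * b w) = 0"
        using sum_b[OF c] by (simp flip: sum_distrib_left)
    qed
    have "(\<Sum>z\<in>G - \<Omega>'. \<bar>V z\<bar>) \<le> (\<Sum>z\<in>G - \<Omega>'. \<Sum>w\<in>\<Omega>. \<bar>b w\<bar> * \<bar>K (z - w) - K (z - corner (n w) w)\<bar>)"
    proof (rule sum_mono)
      fix z
      have "V z = (\<Sum>w\<in>\<Omega>. K (z - w) * b w) - (\<Sum>w\<in>\<Omega>. K (z - corner (n w) w) * b w)"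
        using corner_sum[of z] by (simp add: V_def)
      also have "\<dots> = (\<Sum>w\<in>\<Omega>. b w * (K (z - w) - K (z - corner (n w) w)))"
        by (simp add: algebra_simps flip: sum_subtractf)
      finally show "\<bar>V z\<bar> \<le> (\<Sum>w\<in>\<Omega>. \<bar>b w\<bar> * \<bar>K (z - w) - K (z - corner (n w) w)\<bar>)"
        by (simp only: abs_mult[symmetric] sum_abs)
    qed
    also have "\<dots> = (\<Sum>w\<in>\<Omega>. \<bar>b w\<bar> * (\<Sum>z\<in>G - \<Omega>'. \<bar>K (z - w) - K (z - corner (n w) w)\<bar>))"
      by (subst sum.swap) (simp add: sum_distrib_left)
    also have "\<dots> \<le> (\<Sum>w\<in>\<Omega>. \<bar>b w\<bar> * C1)"
    proof (intro sum_mono mult_left_mono)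
      fix w assume w: "w \<in> \<Omega>"
      let ?c = "corner (n w) w"
      have "(\<Sum>z\<in>G - \<Omega>'. \<bar>K (z - w) - K (z - ?c)\<bar>) = (\<Sum>y\<in>(\<lambda>z. z - ?c) ` (G - \<Omega>'). \<bar>K (y - (w - ?c)) - K y\<bar>)"
        by (subst sum.reindex) (auto simp: inj_on_def algebra_simps)
      also have "\<dots> = (\<Sum>y\<in>(\<lambda>z. z - ?c) ` (G - \<Omega>'). \<bar>K (y - (fst (w - ?c), snd (w - ?c))) - K y\<bar>)"
        by (simp only: prod.collapse)
      also have "\<dots> \<le> C1"
      proof (rule H[unfolded hormander_def, rule_format, where i = "n w"])
        fix y assume "y \<in> (\<lambda>z. z - ?c) ` (G - \<Omega>')"
        then obtain z where z: "y = z - ?c" "z \<notin> \<Omega>'" by auto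
        then have "z \<notin> near w" using w by (auto simp: \<Omega>'_def)
        then show "2 * 4 ^ n w < \<bar>fst y\<bar> \<or> 2 * 2 ^ n w < \<bar>snd y\<bar>"
          by (auto simp: near_def z(1))
      qed (use G corner_bounds in auto)
      finally show "(\<Sum>z\<in>G - \<Omega>'. \<bar>K (z - w) - K (z - ?c)\<bar>) \<le> C1" .
    qed auto
    also have "\<dots> \<le> C1 * (2 * T)"
      using mult_left_mono[OF b_sum nonneg(1)] by (simp only: sum_distrib_right[symmetric] mult.commute[of C1])
    finally show ?thesis .
  qed
  have near_eq: "near w = {fst (corner (n w) w) - 2 * 4 ^ n w..fst (corner (n w) w) + 2 * 4 ^ n w} \<times> {snd (corner (n w) w) - 2 * 2 ^ n w..snd (corner (n w) w) + 2 * 2 ^ n w}" for w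
    by (auto simp: near_def abs_le_iff)
  have near_fin: "finite (near w)" for w by (simp add: near_eq)
  \<comment> \<open>The side lengths are 4 times the power of 4, respectively of 2, plus 1, and each
    is at most 5 times that power.\<close>
  have near_card: "real (card (near w)) \<le> 25 * 8 ^ n w" for w
  proof -
    have "int (card (near w)) = (4 * 4 ^ n w + 1) * (4 * 2 ^ n w + 1)"
      by (simp add: near_eq card_cartesian_product nat_mult_distrib)
    also have "\<dots> \<le> (5 * 4 ^ n w) * (5 * 2 ^ n w)"
      by (intro mult_mono) (auto simp: one_le_power)
    also have "\<dots> = 25 * (4 * 2) ^ n w" by (simp only: power_mult_distrib)
    finally have "int (card (near w)) \<le> 25 * 8 ^ n w" by simp
    then have "real_of_int (int (card (near w))) \<le> real_of_int (25 * 8 ^ n w)" by (simp only: of_int_le_iff)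
    then show ?thesis by simp
  qed
  have \<Omega>'_card: "a * card \<Omega>' \<le> 25 * T"
  proof -
    have rep: "\<exists>y. y \<in> \<Omega> \<and> Q y = c" if "c \<in> \<Q>" for c using that by (auto simp: \<Q>_def)
    \<comment> \<open>One representative per cell, so that the enlarged boxes are counted once per
      cell and not once per point.\<close>
    define y where "y c = (SOME y. y \<in> \<Omega> \<and> Q y = c)" for c
    have y: "y c \<in> \<Omega>" "Q (y c) = c" if "c \<in> \<Q>" for c
      using someI_ex[OF rep[OF that]] by (auto simp: y_def)
    have "\<Omega>' \<subseteq> (\<Union>c\<in>\<Q>. near (y c))"
    proof
      fix z assume "z \<in> \<Omega>'"
      then obtain w where w: "w \<in> \<Omega>" "z \<in> near w" by (auto simp: \<Omega>'_def)
      have c: "Q w \<in> \<Q>" using w by (auto simp: \<Q>_def)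
      have wy: "w \<in> Q (y (Q w))" using y(2)[OF c] self by auto
      have "n w = n (y (Q w))" "corner (n (y (Q w))) w = corner (n (y (Q w))) (y (Q w))"
        using same(2)[OF y(1)[OF c] wy] corner_in_dyadic_box wy by (auto simp: Q_def)
      then have "z \<in> near (y (Q w))" using w(2) by (simp add: near_def)
      then show "z \<in> (\<Union>c\<in>\<Q>. near (y c))" using c by blast
    qed
    then have "card \<Omega>' \<le> card (\<Union>c\<in>\<Q>. near (y c))" using f\<Q> near_fin by (intro card_mono) auto
    also have "\<dots> \<le> (\<Sum>c\<in>\<Q>. card (near (y c)))" by (rule card_UN_le) (rule f\<Q>)
    finally have "real (card \<Omega>') \<le> (\<Sum>c\<in>\<Q>. real (card (near (y c))))" by (simp flip: of_nat_sum)
    then have "a * card \<Omega>' \<le> a * (\<Sum>c\<in>\<Q>. real (card (near (y c))))" using a by simp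
    also have "\<dots> \<le> (\<Sum>c\<in>\<Q>. 25 * (\<Sum>w\<in>c. \<bar>g0 w\<bar>))"
      unfolding sum_distrib_left
    proof (rule sum_mono)
      fix c assume c: "c \<in> \<Q>"
      have "a * card (near (y c)) \<le> 25 * (a * 8 ^ n (y c))"
        using mult_left_mono[OF near_card[of "y c"], of a] a by simp
      also have "\<dots> \<le> 25 * I (n (y c)) (y c)" using n_in[OF y(1)[OF c]] by simp
      also have "I (n (y c)) (y c) = (\<Sum>w\<in>c. \<bar>g0 w\<bar>)" using Ig0[of "y c"] y(2)[OF c] by simp
      finally show "a * card (near (y c)) \<le> (\<Sum>w\<in>c. 25 * \<bar>g0 w\<bar>)" by (simp add: sum_distrib_left)
    qed
    also have "\<dots> = 25 * (\<Sum>w\<in>\<Omega>. \<bar>g0 w\<bar>)" by (simp add: sum\<Omega> sum_distrib_left)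
    also have "\<dots> \<le> 25 * T" unfolding T_eq[symmetric] F'_def using F f\<Omega> by (intro mult_left_mono sum_mono2) auto
    finally show ?thesis .
  qed
  \<comment> \<open>Chebyshev at level a / 2. For the good part, 4 times the bound 8 a of g yields
    32 C2; for the bad part, 2 times the mass bound 2 T yields 4 C1; the enlarged cells account for
    25.\<close>
  let ?A = "{z\<in>G. a / 2 < \<bar>U z\<bar>}" and ?B = "{z\<in>G - \<Omega>'. a / 2 < \<bar>V z\<bar>}"
  have cardA: "a * card ?A \<le> 32 * C2 * T"
  proof -
    have "(a / 2)\<^sup>2 * card ?A = (\<Sum>z\<in>?A. (a / 2)\<^sup>2)" by simp
    also have "\<dots> \<le> (\<Sum>z\<in>?A. (U z)\<^sup>2)"
    proof (rule sum_mono)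
      fix z assume "z \<in> ?A"
      then have "\<bar>a / 2\<bar> \<le> \<bar>U z\<bar>" using a by simp
      then show "(a / 2)\<^sup>2 \<le> (U z)\<^sup>2" by (simp only: abs_le_square_iff)
    qed
    also have "\<dots> \<le> (\<Sum>z\<in>G. (U z)\<^sup>2)" using G by (intro sum_mono2) auto
    also have "\<dots> \<le> C2 * (\<Sum>w\<in>F'. (g w)\<^sup>2)" unfolding U_def by (rule L2[OF fF' G])
    also have "\<dots> \<le> C2 * (8 * a * T)"
    proof (rule mult_left_mono[OF _ nonneg(2)])
      have "(\<Sum>w\<in>F'. (g w)\<^sup>2) \<le> (\<Sum>w\<in>F'. 8 * a * \<bar>g w\<bar>)"
      proof (rule sum_mono)
        fix w
        have "\<bar>g w\<bar> * \<bar>g w\<bar> \<le> 8 * a * \<bar>g w\<bar>" by (intro mult_right_mono g_le) simp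
        then show "(g w)\<^sup>2 \<le> 8 * a * \<bar>g w\<bar>" by (simp add: power2_eq_square)
      qed
      also have "\<dots> \<le> 8 * a * T" using g_sum a by (simp flip: sum_distrib_left)
      finally show "(\<Sum>w\<in>F'. (g w)\<^sup>2) \<le> 8 * a * T" .
    qed
    finally have "a * (a * card ?A) \<le> a * (32 * C2 * T)" by (simp add: power2_eq_square field_simps)
    then show ?thesis using a by simp
  qed
  have cardB: "a * card ?B \<le> 4 * C1 * T"
  proof -
    have "a / 2 * card ?B = (\<Sum>z\<in>?B. a / 2)" by simp
    also have "\<dots> \<le> (\<Sum>z\<in>?B. \<bar>V z\<bar>)" by (intro sum_mono) auto
    also have "\<dots> \<le> (\<Sum>z\<in>G - \<Omega>'. \<bar>V z\<bar>)" using G by (intro sum_mono2) auto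
    finally show ?thesis using V_sum by simp
  qed
  have f\<Omega>': "finite \<Omega>'" using f\<Omega> near_fin by (auto simp: \<Omega>'_def)
  have "{z\<in>G. a < \<bar>\<Sum>w\<in>F. K (z - w) * f w\<bar>} \<subseteq> ?A \<union> ?B \<union> \<Omega>'"
    unfolding decomp by auto
  then have "card {z\<in>G. a < \<bar>\<Sum>w\<in>F. K (z - w) * f w\<bar>} \<le> card (?A \<union> ?B \<union> \<Omega>')"
    using G f\<Omega>' by (intro card_mono) auto
  also have "\<dots> \<le> card ?A + card ?B + card \<Omega>'"
    by (meson add_le_cancel_right card_Un_le order_trans)
  finally have "real (card {z\<in>G. a < \<bar>\<Sum>w\<in>F. K (z - w) * f w\<bar>}) \<le> card ?A + card ?B + card \<Omega>'"
    by (simp flip: of_nat_add)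
  then have "a * card {z\<in>G. a < \<bar>\<Sum>w\<in>F. K (z - w) * f w\<bar>} \<le> a * card ?A + a * card ?B + a * card \<Omega>'"
    using mult_left_mono[of "real (card {z\<in>G. a < \<bar>\<Sum>w\<in>F. K (z - w) * f w\<bar>})" "card ?A + card ?B + card \<Omega>'" a] a
    by (simp add: algebra_simps)
  also have "\<dots> \<le> (32 * C2 + 4 * C1 + 25) * T"
    using cardA cardB \<Omega>'_card by (simp add: algebra_simps)
  finally show ?thesis by (simp add: T_def)
qed

section \<open>Interpolation between weak l^1 and l^2\<close>

lemma has_integral_powr_below:
  fixes c e :: real
  assumes "-1 < e" "0 \<le> c"
  shows "((\<lambda>x. if x < c then x powr e else 0) has_integral c powr (e + 1) / (e + 1)) {0..}"
proof (rule has_integral_spike[where S = "{c}"])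
  show "((\<lambda>x. if x \<in> {0..c} then x powr e else 0) has_integral c powr (e + 1) / (e + 1)) {0..}"
    using has_integral_powr_from_0[OF assms] by (subst has_integral_restrict) auto
qed auto

lemma has_integral_powr_above:
  fixes c e :: real
  assumes "e < -1" "0 < c"
  shows "((\<lambda>x. if c \<le> x then x powr e else 0) has_integral - (c powr (e + 1)) / (e + 1)) {0..}"
proof -
  have "((\<lambda>x. if x \<in> {c..} then x powr e else 0) has_integral - (c powr (e + 1)) / (e + 1)) {0..}"
    using has_integral_powr_to_inf[OF assms] assms by (subst has_integral_restrict) auto
  then show ?thesis by simp
qed

text \<open>Layer-cake formula with f cut at the running height a: the weak-type bound is applied to
  the part above a, the l^2 bound to the part below. The inequality holds between the integrands for
  each a, and only explicit integrals of powers remain; a^(p-2) near 0 and a^(p-3) at infinity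
  converge for 1 < p < 2.\<close>

lemma marcinkiewicz:
  fixes K :: "int \<times> int \<Rightarrow> real"
  assumes L2: "\<And>F G f. finite F \<Longrightarrow> finite G \<Longrightarrow> (\<Sum>z\<in>G. (\<Sum>w\<in>F. K (z - w) * f w)\<^sup>2) \<le> C2 * (\<Sum>w\<in>F. (f w)\<^sup>2)"
    and W: "\<And>F G f a. finite F \<Longrightarrow> finite G \<Longrightarrow> 0 < a \<Longrightarrow>
      a * card {z\<in>G. a < \<bar>\<Sum>w\<in>F. K (z - w) * f w\<bar>} \<le> W * (\<Sum>w\<in>F. \<bar>f w\<bar>)"
    and F: "finite F" and G: "finite G" and p: "1 < p" "p < 2"
  shows "(\<Sum>z\<in>G. \<bar>\<Sum>w\<in>F. K (z - w) * f w\<bar> powr p)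
    \<le> 2 powr p * p * (W / (p - 1) + C2 / (2 - p)) * (\<Sum>w\<in>F. \<bar>f w\<bar> powr p)"
proof -
  define T where "T f z = (\<Sum>w\<in>F. K (z - w) * f w)" for f z
  \<comment> \<open>The level set of T f is taken at 2 a, so that one of the two parts must exceed a
    there; this is the source of the factor 2^p.\<close>
  define lhs where "lhs a = (\<Sum>z\<in>G. p * (if a < \<bar>T f z\<bar> / 2 then a powr (p - 1) else 0))" for a
  define rhs where "rhs a = p * (\<Sum>w\<in>F. W * (\<bar>f w\<bar> * (if a < \<bar>f w\<bar> then a powr (p - 2) else 0))
      + C2 * ((f w)\<^sup>2 * (if \<bar>f w\<bar> \<le> a then a powr (p - 3) else 0)))" for a
  have le: "lhs a \<le> rhs a" if a: "a \<in> {0..}" for a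
  proof (cases "a = 0")
    \<comment> \<open>At the end point both integrands vanish, since 0 \<open>powr\<close> any
      exponent is 0.\<close>
    case True
    have "(\<Sum>w\<in>F. W * (\<bar>f w\<bar> * (if 0 < \<bar>f w\<bar> then 0 powr (p - 2) else 0))
      + C2 * ((f w)\<^sup>2 * (if \<bar>f w\<bar> \<le> 0 then 0 powr (p - 3) else 0))) = 0"
      by (intro sum.neutral) auto
    then have "rhs a = 0" using True by (simp only: rhs_def mult_zero_right)
    moreover have "lhs a = 0" unfolding lhs_def using True by (intro sum.neutral) auto
    ultimately show ?thesis by simp
  next
    case False
    then have a: "0 < a" using a by simp
    define f1 where "f1 w = (if a < \<bar>f w\<bar> then f w else 0)" for w
    define f2 where "f2 w = (if a < \<bar>f w\<bar> then 0 else f w)" for w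
    have T12: "T f z = T f1 z + T f2 z" for z
      unfolding T_def sum.distrib[symmetric] by (intro sum.cong) (auto simp: f1_def f2_def)
    let ?A = "{z\<in>G. a < \<bar>T f1 z\<bar>}" and ?B = "{z\<in>G. a < \<bar>T f2 z\<bar>}" and ?E = "{z\<in>G. a < \<bar>T f z\<bar> / 2}"
    have A: "a * card ?A \<le> W * (\<Sum>w\<in>F. \<bar>f1 w\<bar>)" unfolding T_def by (rule W[OF F G a])
    have "a\<^sup>2 * card ?B = (\<Sum>z\<in>?B. a\<^sup>2)" by simp
    also have "\<dots> \<le> (\<Sum>z\<in>?B. (T f2 z)\<^sup>2)"
    proof (rule sum_mono)
      fix z assume "z \<in> ?B"
      then have "\<bar>a\<bar> \<le> \<bar>T f2 z\<bar>" using a by simp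
      then show "a\<^sup>2 \<le> (T f2 z)\<^sup>2" by (simp only: abs_le_square_iff)
    qed
    also have "\<dots> \<le> (\<Sum>z\<in>G. (T f2 z)\<^sup>2)" using G by (intro sum_mono2) auto
    also have "\<dots> \<le> C2 * (\<Sum>w\<in>F. (f2 w)\<^sup>2)" unfolding T_def by (rule L2[OF F G])
    finally have B: "a\<^sup>2 * card ?B \<le> C2 * (\<Sum>w\<in>F. (f2 w)\<^sup>2)" .
    have "card ?E \<le> card (?A \<union> ?B)" using G by (intro card_mono) (auto simp: T12)
    also have "\<dots> \<le> card ?A + card ?B" by (rule card_Un_le)
    finally have E: "real (card ?E) \<le> card ?A + card ?B" by (simp flip: of_nat_add)
    have pw: "a powr (p - 1) = a powr (p - 2) * a" "a powr (p - 1) = a powr (p - 3) * a\<^sup>2"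
      using a powr_add[of a "p - 2" 1] powr_add[of a "p - 3" 2] by (auto simp: powr_numeral)
    have "lhs a = p * (a powr (p - 1) * card ?E)"
    proof -
      have "lhs a = (\<Sum>z\<in>?E. p * a powr (p - 1))"
        unfolding lhs_def using G by (intro sum.mono_neutral_cong_right) auto
      then show ?thesis by simp
    qed
    also have "\<dots> \<le> p * (a powr (p - 1) * (card ?A + card ?B))"
      using E p by (intro mult_left_mono) auto
    also have "\<dots> = p * (a powr (p - 2) * (a * card ?A) + a powr (p - 3) * (a\<^sup>2 * card ?B))"
      using pw by (simp add: distrib_left mult.assoc)
    also have "\<dots> \<le> p * (a powr (p - 2) * (W * (\<Sum>w\<in>F. \<bar>f1 w\<bar>)) + a powr (p - 3) * (C2 * (\<Sum>w\<in>F. (f2 w)\<^sup>2)))"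
      using A B p by (intro mult_left_mono add_mono) auto
    also have "\<dots> = rhs a"
      unfolding rhs_def sum.distrib sum_distrib_left
      by (intro arg_cong[where f = "(*) p"] arg_cong2[where f = "(+)"] sum.cong refl) (auto simp: f1_def f2_def)
    finally show ?thesis .
  qed
  have il: "(lhs has_integral (\<Sum>z\<in>G. p * ((\<bar>T f z\<bar> / 2) powr p / p))) {0..}"
    unfolding lhs_def
    using has_integral_powr_below[of "p - 1" "\<bar>T f z\<bar> / 2" for z] p
    by (intro has_integral_sum has_integral_mult_right G) auto
  have ir: "(rhs has_integral p * (\<Sum>w\<in>F. W * (\<bar>f w\<bar> powr p / (p - 1)) + C2 * (\<bar>f w\<bar> powr p / (2 - p)))) {0..}"
    unfolding rhs_def
  proof (intro has_integral_sum has_integral_mult_right has_integral_add F)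
    fix w
    have e: "\<bar>f w\<bar> powr p / (p - 1) = \<bar>f w\<bar> * (\<bar>f w\<bar> powr (p - 2 + 1) / (p - 2 + 1))"
      using powr_add[of "\<bar>f w\<bar>" "p - 1" 1] by (cases "f w = 0") (auto simp: field_simps)
    show "((\<lambda>a. \<bar>f w\<bar> * (if a < \<bar>f w\<bar> then a powr (p - 2) else 0)) has_integral \<bar>f w\<bar> powr p / (p - 1)) {0..}"
      unfolding e using p by (intro has_integral_mult_right has_integral_powr_below) auto
    show "((\<lambda>a. (f w)\<^sup>2 * (if \<bar>f w\<bar> \<le> a then a powr (p - 3) else 0)) has_integral \<bar>f w\<bar> powr p / (2 - p)) {0..}"
    proof (cases "f w = 0")
      case False
      have "(f w)\<^sup>2 * \<bar>f w\<bar> powr (p - 2) = \<bar>f w\<bar> powr p"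
        using False powr_add[of "\<bar>f w\<bar>" 2 "p - 2"] by (simp add: powr_numeral)
      then have e: "\<bar>f w\<bar> powr p / (2 - p) = (f w)\<^sup>2 * (- (\<bar>f w\<bar> powr (p - 3 + 1)) / (p - 3 + 1))"
        using p by (simp add: field_simps)
      show ?thesis
        unfolding e using p False by (intro has_integral_mult_right has_integral_powr_above) auto
    qed simp
  qed
  have "(\<Sum>z\<in>G. p * ((\<bar>T f z\<bar> / 2) powr p / p)) \<le> p * (\<Sum>w\<in>F. W * (\<bar>f w\<bar> powr p / (p - 1)) + C2 * (\<bar>f w\<bar> powr p / (2 - p)))"
    by (rule has_integral_le[OF il ir le])
  also have "(\<Sum>z\<in>G. p * ((\<bar>T f z\<bar> / 2) powr p / p)) = (\<Sum>z\<in>G. \<bar>T f z\<bar> powr p) / 2 powr p"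
    using p by (simp add: powr_divide sum_divide_distrib)
  also have "p * (\<Sum>w\<in>F. W * (\<bar>f w\<bar> powr p / (p - 1)) + C2 * (\<bar>f w\<bar> powr p / (2 - p)))
     = p * (W / (p - 1) + C2 / (2 - p)) * (\<Sum>w\<in>F. \<bar>f w\<bar> powr p)"
    unfolding sum_distrib_left by (intro sum.cong refl) (simp add: field_simps)
  finally show ?thesis by (simp add: T_def divide_le_eq mult_ac)
qed

section \<open>Duality and the full range of exponents\<close>

lemma hormander_reflect:
  assumes "hormander K C"
  shows "hormander (\<lambda>z. K (- z)) C"
  unfolding hormander_def
proof (intro allI impI)
  fix i :: nat and s l :: int and G :: "(int \<times> int) set"
  assume *: "finite G" "\<bar>s\<bar> \<le> 4 ^ i" "\<bar>l\<bar> \<le> 2 ^ i"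
    "\<forall>z\<in>G. 2 * 4 ^ i < \<bar>fst z\<bar> \<or> 2 * 2 ^ i < \<bar>snd z\<bar>"
  have "(\<Sum>z\<in>G. \<bar>K (- (z - (s, l))) - K (- z)\<bar>) = (\<Sum>z\<in>uminus ` G. \<bar>K (z - (- s, - l)) - K z\<bar>)"
    by (subst sum.reindex) (auto simp: inj_on_def uminus_prod_def minus_prod_def)
  also have "\<dots> \<le> C"
  proof (rule assms[unfolded hormander_def, rule_format, where i = i])
    fix z assume "z \<in> uminus ` G"
    then show "2 * 4 ^ i < \<bar>fst z\<bar> \<or> 2 * 2 ^ i < \<bar>snd z\<bar>" using *(4) by force
  qed (use * in auto)
  finally show "(\<Sum>z\<in>G. \<bar>K (- (z - (s, l))) - K (- z)\<bar>) \<le> C" .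
qed

lemma adjoint_sum:
  fixes K :: "int \<times> int \<Rightarrow> real"
  shows "(\<Sum>z\<in>G. (\<Sum>w\<in>F. K (z - w) * f w) * g z) = (\<Sum>w\<in>F. f w * (\<Sum>z\<in>G. K (- (w - z)) * g z))"
  by (simp add: sum_distrib_left sum_distrib_right mult_ac) (rule sum.swap)

text \<open>The reflected kernel represents the adjoint. The square norm of the adjoint image g is
  the pairing of f with the image of g, and Young's inequality with weight C2 leaves half of that
  square norm to be absorbed.\<close>

lemma l2_reflect:
  fixes K :: "int \<times> int \<Rightarrow> real"
  assumes L2: "\<And>F G f. finite F \<Longrightarrow> finite G \<Longrightarrow> (\<Sum>z\<in>G. (\<Sum>w\<in>F. K (z - w) * f w)\<^sup>2) \<le> C2 * (\<Sum>w\<in>F. (f w)\<^sup>2)"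
    and "0 < C2" "finite F" "finite G"
  shows "(\<Sum>z\<in>G. (\<Sum>w\<in>F. K (- (z - w)) * f w)\<^sup>2) \<le> C2 * (\<Sum>w\<in>F. (f w)\<^sup>2)"
proof -
  define g where "g z = (\<Sum>w\<in>F. K (- (z - w)) * f w)" for z
  define h where "h w = (\<Sum>z\<in>G. K (w - z) * g z)" for w
  have "(\<Sum>z\<in>G. (g z)\<^sup>2) = (\<Sum>w\<in>F. f w * h w)"
    using adjoint_sum[where K = "\<lambda>z. K (- z)" and F = F and f = f and g = g and G = G] by (simp add: g_def h_def power2_eq_square)
  also have "\<dots> \<le> (\<Sum>w\<in>F. C2 / 2 * (f w)\<^sup>2 + (h w)\<^sup>2 / (2 * C2))"
  proof (rule sum_mono)
    fix w
    have "0 \<le> (C2 * f w - h w)\<^sup>2" by simp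
    then show "f w * h w \<le> C2 / 2 * (f w)\<^sup>2 + (h w)\<^sup>2 / (2 * C2)"
      using assms(2) by (simp add: power2_eq_square field_simps)
  qed
  also have "\<dots> = C2 / 2 * (\<Sum>w\<in>F. (f w)\<^sup>2) + (\<Sum>w\<in>F. (h w)\<^sup>2) / (2 * C2)"
    by (simp add: sum.distrib sum_distrib_left sum_divide_distrib)
  also have "(\<Sum>w\<in>F. (h w)\<^sup>2) / (2 * C2) \<le> (C2 * (\<Sum>z\<in>G. (g z)\<^sup>2)) / (2 * C2)"
    unfolding h_def using assms by (intro divide_right_mono L2) auto
  also have "\<dots> = (\<Sum>z\<in>G. (g z)\<^sup>2) / 2" using assms by simp
  finally show ?thesis by (simp add: g_def)
qed

text \<open>Interpolation covers p < 2. For p > 2 the bound for the reflected kernel is dualized by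
  testing with one extremal function and absorbing, instead of taking a supremum over a dual ball;
  all sums are finite, so the absorption is legitimate.\<close>

theorem calderon_zygmund_lattice:
  fixes K :: "int \<times> int \<Rightarrow> real"
  assumes L2: "\<And>F G f. finite F \<Longrightarrow> finite G \<Longrightarrow> (\<Sum>z\<in>G. (\<Sum>w\<in>F. K (z - w) * f w)\<^sup>2) \<le> C2 * (\<Sum>w\<in>F. (f w)\<^sup>2)"
    and H: "hormander K C1" and C: "0 \<le> C1" "0 < C2" and p: "1 < p"
  shows "\<exists>M\<ge>0. \<forall>F G f. finite F \<longrightarrow> finite G \<longrightarrow>
    (\<Sum>z\<in>G. \<bar>\<Sum>w\<in>F. K (z - w) * f w\<bar> powr p) \<le> M * (\<Sum>w\<in>F. \<bar>f w\<bar> powr p)"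
proof -
  have low: "\<exists>M\<ge>0. \<forall>F G f. finite F \<longrightarrow> finite G \<longrightarrow>
    (\<Sum>z\<in>G. \<bar>\<Sum>w\<in>F. K (z - w) * f w\<bar> powr q) \<le> M * (\<Sum>w\<in>F. \<bar>f w\<bar> powr q)"
    if L2: "\<And>F G f. finite F \<Longrightarrow> finite G \<Longrightarrow> (\<Sum>z\<in>G. (\<Sum>w\<in>F. K (z - w) * f w)\<^sup>2) \<le> C2 * (\<Sum>w\<in>F. (f w)\<^sup>2)"
      and H: "hormander K C1" and q: "1 < q" "q < 2" for K q
  proof -
    let ?W = "32 * C2 + 4 * C1 + 25"
    have "0 \<le> 2 powr q * q * (?W / (q - 1) + C2 / (2 - q))" using C q by auto
    moreover have "a * card {z\<in>G. a < \<bar>\<Sum>w\<in>F. K (z - w) * f w\<bar>} \<le> ?W * (\<Sum>w\<in>F. \<bar>f w\<bar>)"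
      if "finite F" "finite G" "0 < a" for F G f a
      using weak_type[OF L2 H that] C by simp
    moreover note marcinkiewicz[OF L2, of ?W _ _ q]
    ultimately show ?thesis
      using q by (intro exI[of _ "2 powr q * q * (?W / (q - 1) + C2 / (2 - q))"]) auto
  qed
  consider "p < 2" | "p = 2" | "2 < p" by linarith
  then show ?thesis
  proof cases
    case 1
    then show ?thesis using low[OF L2 H p] by blast
  next
    case 2
    have "x powr 2 = x\<^sup>2" if "0 \<le> x" for x :: real using that by (cases "x = 0") (auto simp: powr_numeral)
    then show ?thesis using 2 L2 C by (intro exI[of _ C2]) auto
  next
    case 3
    define q where "q = p / (p - 1)"
    have q: "1 < q" "q < 2" "1 / p + 1 / q = 1" "(p - 1) * q = p" using 3 by (auto simp: q_def field_simps)
    obtain Mq where Mq: "0 \<le> Mq" "\<And>F G f. finite F \<Longrightarrow> finite G \<Longrightarrow>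
      (\<Sum>z\<in>G. \<bar>\<Sum>w\<in>F. K (- (z - w)) * f w\<bar> powr q) \<le> Mq * (\<Sum>w\<in>F. \<bar>f w\<bar> powr q)"
      using low[OF l2_reflect[OF L2 C(2)] hormander_reflect[OF H] q(1,2)] by blast
    \<comment> \<open>Weight for Young's inequality, chosen so that the dual term is at most half of
      the left side; the added 1 keeps it positive when Mq = 0.\<close>
    define e where "e = (2 * (Mq + 1)) powr (1 / q)"
    have e: "0 < e" "e powr q = 2 * (Mq + 1)" using Mq(1) q by (auto simp: e_def powr_powr)
    show ?thesis
    proof (intro exI[of _ "2 * e powr p"] conjI allI impI)
      fix F G :: "(int \<times> int) set" and f :: "int \<times> int \<Rightarrow> real"
      assume F: "finite F" and G: "finite G"
      define T where "T z = (\<Sum>w\<in>F. K (z - w) * f w)" for z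
      \<comment> \<open>Extremal function of Hoelder's inequality: both T g and |g|^q equal
        |T|^p.\<close>
      define g where "g z = sgn (T z) * \<bar>T z\<bar> powr (p - 1)" for z
      define h where "h w = (\<Sum>z\<in>G. K (- (w - z)) * g z)" for w
      have Tg: "T z * g z = \<bar>T z\<bar> powr p" for z
      proof (cases "T z = 0")
        case False
        have "T z * g z = \<bar>T z\<bar> powr 1 * \<bar>T z\<bar> powr (p - 1)" using False by (simp add: g_def sgn_if)
        also have "\<dots> = \<bar>T z\<bar> powr p" by (simp only: powr_add[symmetric]) simp
        finally show ?thesis .
      qed (use p in auto)
      have gq: "\<bar>g z\<bar> powr q = \<bar>T z\<bar> powr p" for z
        using p q by (cases "T z = 0") (auto simp: g_def abs_mult powr_powr abs_sgn_eq)
      let ?X = "\<Sum>z\<in>G. \<bar>T z\<bar> powr p"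
      have "?X = (\<Sum>w\<in>F. f w * h w)"
        using adjoint_sum[where K = K and F = F and f = f and g = g and G = G] by (simp add: Tg h_def flip: T_def)
      also have "\<dots> \<le> (\<Sum>w\<in>F. e powr p * \<bar>f w\<bar> powr p + \<bar>h w\<bar> powr q / e powr q)"
      proof (rule sum_mono)
        fix w
        have "f w * h w \<le> (e * \<bar>f w\<bar>) * (\<bar>h w\<bar> / e)"
          using e abs_ge_self[of "f w * h w"] by (simp add: abs_mult)
        also have "\<dots> \<le> (e * \<bar>f w\<bar>) powr p / p + (\<bar>h w\<bar> / e) powr q / q"
          using e p q by (intro Youngs_inequality) auto
        also have "\<dots> \<le> (e * \<bar>f w\<bar>) powr p + (\<bar>h w\<bar> / e) powr q"
          using p q by (intro add_mono) (auto simp: divide_le_eq mult_left_le_one_le intro: mult_left_mono[of 1 _ "_ powr _", simplified])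
        finally show "f w * h w \<le> e powr p * \<bar>f w\<bar> powr p + \<bar>h w\<bar> powr q / e powr q"
          using e by (simp add: powr_mult powr_divide)
      qed
      also have "\<dots> = e powr p * (\<Sum>w\<in>F. \<bar>f w\<bar> powr p) + (\<Sum>w\<in>F. \<bar>h w\<bar> powr q) / e powr q"
        by (simp add: sum.distrib sum_distrib_left sum_divide_distrib)
      also have "(\<Sum>w\<in>F. \<bar>h w\<bar> powr q) / e powr q \<le> (Mq * ?X) / e powr q"
        unfolding h_def using Mq(2)[OF G F, of g] by (intro divide_right_mono) (auto simp: gq)
      also have "\<dots> \<le> ?X / 2"
      proof -
        have "0 \<le> ?X" by (simp add: sum_nonneg)
        then show ?thesis using Mq(1) by (simp add: e field_simps)
      qed
      finally show "(\<Sum>z\<in>G. \<bar>\<Sum>w\<in>F. K (z - w) * f w\<bar> powr p) \<le> 2 * e powr p * (\<Sum>w\<in>F. \<bar>f w\<bar> powr p)"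
        by (simp add: T_def)
    qed simp
  qed
qed

text \<open>Duhamel's formula identifies the second difference of v with the kernel applied to f.
  The constant is chosen before N, B and J: it depends neither on the length of time nor on the size
  of the support, which vary later with the line and with h.\<close>

theorem lazy_walk_maximal_regularity:
  fixes p :: real
  assumes "1 < p"
  shows "\<exists>M\<ge>0. \<forall>f v N B J. v 0 = f 0 \<longrightarrow> (\<forall>n k. v (Suc n) k = lstep (v n) k + f (Suc n) k) \<longrightarrow>
    (\<forall>n k. B < \<bar>k\<bar> \<longrightarrow> f n k = 0) \<longrightarrow> finite J \<longrightarrow>
    (\<Sum>n\<le>N. \<Sum>k\<in>J. \<bar>v n (k + 1) - 2 * v n k + v n (k - 1)\<bar> powr p) \<le> M * (\<Sum>n\<le>N. \<Sum>k\<in>{-B..B}. \<bar>f n k\<bar> powr p)"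
proof -
  obtain M where M: "0 \<le> M" "\<And>F G f. finite F \<Longrightarrow> finite G \<Longrightarrow>
    (\<Sum>z\<in>G. \<bar>\<Sum>w\<in>F. walk_kernel (z - w) * f w\<bar> powr p) \<le> M * (\<Sum>w\<in>F. \<bar>f w\<bar> powr p)"
    using calderon_zygmund_lattice[of walk_kernel 208 4000 p] walk_kernel_l2 walk_kernel_hormander assms by auto
  show ?thesis
  proof (intro exI[of _ M] conjI allI impI M(1))
    fix f v :: "nat \<Rightarrow> int \<Rightarrow> real" and N :: nat and B :: int and J :: "int set"
    assume v0: "v 0 = f 0" and vS: "\<forall>n k. v (Suc n) k = lstep (v n) k + f (Suc n) k"
      and f0: "\<forall>n k. B < \<bar>k\<bar> \<longrightarrow> f n k = 0" and J: "finite J"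
    define I where "I = {-B..B}"
    have delta: "(\<Sum>j\<in>I. lazy_walk 0 (k - j) * f n j) = f n k" for n k
    proof -
      have "(\<Sum>j\<in>I. lazy_walk 0 (k - j) * f n j) = (\<Sum>j\<in>I. if j = k then f n j else 0)"
        by (intro sum.cong) auto
      then show ?thesis using f0[rule_format, of k n] by (cases "k \<in> I") (auto simp: I_def)
    qed
    have rep: "v n k = (\<Sum>m\<le>n. \<Sum>j\<in>I. lazy_walk (n - m) (k - j) * f m j)" for n k
    proof (induction n arbitrary: k)
      case 0
      then show ?case using delta[of k 0] by (simp add: v0 del: lazy_walk.simps)
    next
      case (Suc n)
      have "(\<Sum>m\<le>Suc n. \<Sum>j\<in>I. lazy_walk (Suc n - m) (k - j) * f m j)
        = (\<Sum>m\<le>n. \<Sum>j\<in>I. lazy_walk (Suc n - m) (k - j) * f m j) + f (Suc n) k"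
        using delta[of k "Suc n"] by (simp del: lazy_walk.simps)
      also have "(\<Sum>m\<le>n. \<Sum>j\<in>I. lazy_walk (Suc n - m) (k - j) * f m j)
        = (\<Sum>m\<le>n. \<Sum>j\<in>I. lstep (lazy_walk (n - m)) (k - j) * f m j)"
        by (intro sum.cong refl) (simp add: Suc_diff_le)
      also have "\<dots> = lstep (v n) k"
        unfolding lstep_def Suc
        by (simp add: sum_distrib_left sum_divide_distrib flip: sum.distrib) (simp add: algebra_simps)
      finally show ?case using vS by simp
    qed
    define F where "F = (\<lambda>(m, j). (int m, j)) ` ({..N} \<times> I)"
    define G where "G = (\<lambda>(m, j). (int m, j)) ` ({..N} \<times> J)"
    define g where "g w = f (nat (fst w)) (snd w)" for w
    have inj: "inj_on (\<lambda>(m, j). (int m, j)) A" for A by (auto simp: inj_on_def)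
    have T: "(\<Sum>w\<in>F. walk_kernel ((int n, k) - w) * g w) = v n (k + 1) - 2 * v n k + v n (k - 1)"
      if "n \<le> N" for n k
    proof -
      have "(\<Sum>w\<in>F. walk_kernel ((int n, k) - w) * g w) = (\<Sum>m\<le>N. \<Sum>j\<in>I. walk_kernel (int n - int m, k - j) * f m j)"
        unfolding F_def sum.cartesian_product by (subst sum.reindex[OF inj]) (simp add: split_beta g_def comp_def)
      also have "\<dots> = (\<Sum>m\<le>n. \<Sum>j\<in>I. (fdiff ^^ 2) (lazy_walk (n - m)) (k - j - 1) * f m j)"
        using that by (intro sum.mono_neutral_cong_right) (auto simp: walk_kernel_def nat_diff_distrib I_def)
      also have "\<dots> = v n (k + 1) - 2 * v n k + v n (k - 1)"
        unfolding rep by (simp add: numeral_2_eq_2 fdiff_def sum_distrib_left flip: sum.distrib sum_subtractf)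
          (intro sum.cong refl, simp add: algebra_simps)
      finally show ?thesis .
    qed
    have "(\<Sum>n\<le>N. \<Sum>k\<in>J. \<bar>v n (k + 1) - 2 * v n k + v n (k - 1)\<bar> powr p)
      = (\<Sum>n\<le>N. \<Sum>k\<in>J. \<bar>\<Sum>w\<in>F. walk_kernel ((int n, k) - w) * g w\<bar> powr p)"
      using T by (intro sum.cong refl) auto
    also have "\<dots> = (\<Sum>z\<in>G. \<bar>\<Sum>w\<in>F. walk_kernel (z - w) * g w\<bar> powr p)"
      unfolding G_def sum.cartesian_product by (subst sum.reindex[OF inj]) (simp add: split_beta comp_def)
    also have "\<dots> \<le> M * (\<Sum>w\<in>F. \<bar>g w\<bar> powr p)"
      by (rule M(2)) (auto simp: F_def G_def I_def J)
    also have "(\<Sum>w\<in>F. \<bar>g w\<bar> powr p) = (\<Sum>n\<le>N. \<Sum>k\<in>I. \<bar>f n k\<bar> powr p)"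
      unfolding F_def sum.cartesian_product by (subst sum.reindex[OF inj]) (simp add: split_beta comp_def g_def)
    finally show "(\<Sum>n\<le>N. \<Sum>k\<in>J. \<bar>v n (k + 1) - 2 * v n k + v n (k - 1)\<bar> powr p) \<le> M * (\<Sum>n\<le>N. \<Sum>k\<in>{-B..B}. \<bar>f n k\<bar> powr p)"
      by (simp add: I_def)
  qed
qed

subsection \<open>Random walks with jumps in Euclidean space\<close>

text \<open>The p-th power of the norm, valued in the extended non-negative reals, so that estimates
  and limits need no integrability until the final conversion.\<close>

definition lp_int :: "real \<Rightarrow> ('a::euclidean_space \<Rightarrow> real) \<Rightarrow> ennreal" where
  "lp_int p g = (\<integral>\<^sup>+x. ennreal (\<bar>g x\<bar> powr p) \<partial>lborel)"

definition sdiff :: "'a::real_vector \<Rightarrow> ('a \<Rightarrow> real) \<Rightarrow> 'a \<Rightarrow> real" where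
  "sdiff e g x = g (x + e) - 2 * g x + g (x - e)"

definition avg3 :: "'a::real_vector \<Rightarrow> ('a \<Rightarrow> real) \<Rightarrow> 'a \<Rightarrow> real" where
  "avg3 e g x = (g (x - e) + 2 * g x + g (x + e)) / 4"

lemma nn_integral_lborel_translate:
  fixes F :: "'a::euclidean_space \<Rightarrow> ennreal"
  assumes [measurable]: "F \<in> borel_measurable borel"
  shows "(\<integral>\<^sup>+x. F (x + c) \<partial>lborel) = (\<integral>\<^sup>+x. F x \<partial>lborel)"
proof -
  have "(\<integral>\<^sup>+x. F x \<partial>lborel) = (\<integral>\<^sup>+x. F x \<partial>distr lborel borel ((+) c))"
    by (simp add: lborel_distr_plus)
  also have "\<dots> = (\<integral>\<^sup>+x. F (c + x) \<partial>lborel)"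
    by (rule nn_integral_distr) auto
  finally show ?thesis by (simp add: add.commute)
qed

text \<open>The slab between two hyperplanes orthogonal to e is a fundamental domain for the
  translations by integer multiples of e, so each lattice x + Z e is counted once. This turns
  lattice estimates into integral estimates, in space along a direction and in time along the step
  length.\<close>

lemma nn_integral_lborel_lattice:
  fixes F :: "'a::euclidean_space \<Rightarrow> ennreal"
  assumes [measurable]: "F \<in> borel_measurable borel" and "e \<noteq> 0"
  shows "(\<integral>\<^sup>+x. F x \<partial>lborel) = (\<integral>\<^sup>+x. (\<integral>\<^sup>+k. F (x + of_int k *\<^sub>R e) \<partial>count_space UNIV)
    * indicator {x. 0 \<le> x \<bullet> e \<and> x \<bullet> e < e \<bullet> e} x \<partial>lborel)"
proof -
  define D where "D = {x. 0 \<le> x \<bullet> e \<and> x \<bullet> e < e \<bullet> e}"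
  have ee: "0 < e \<bullet> e" using assms(2) by simp
  have D[measurable]: "D \<in> sets borel"
    unfolding D_def by measurable
  have one: "(\<integral>\<^sup>+k. indicator D (x - of_int k *\<^sub>R e) \<partial>count_space UNIV) = (1::ennreal)" for x :: 'a
  proof -
    have "indicator D (x - of_int k *\<^sub>R e) = (indicator {\<lfloor>x \<bullet> e / (e \<bullet> e)\<rfloor>} k :: ennreal)" for k :: int
    proof -
      have "x - of_int k *\<^sub>R e \<in> D \<longleftrightarrow> of_int k \<le> x \<bullet> e / (e \<bullet> e) \<and> x \<bullet> e / (e \<bullet> e) < of_int k + 1"
        using ee by (auto simp: D_def inner_diff_left field_simps)
      also have "\<dots> \<longleftrightarrow> k = \<lfloor>x \<bullet> e / (e \<bullet> e)\<rfloor>"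
        using floor_unique[of k "x \<bullet> e / (e \<bullet> e)"] by auto
      finally show ?thesis by (auto simp: indicator_def)
    qed
    then have "(\<integral>\<^sup>+k. indicator D (x - of_int k *\<^sub>R e) \<partial>count_space UNIV)
      = (\<integral>\<^sup>+k. indicator {\<lfloor>x \<bullet> e / (e \<bullet> e)\<rfloor>} k \<partial>count_space UNIV)" by simp
    also have "\<dots> = emeasure (count_space UNIV) {\<lfloor>x \<bullet> e / (e \<bullet> e)\<rfloor>}" by (rule nn_integral_indicator) simp
    also have "\<dots> = 1" by simp
    finally show ?thesis .
  qed
  have "(\<integral>\<^sup>+x. F x \<partial>lborel) = (\<integral>\<^sup>+x. \<integral>\<^sup>+k. F x * indicator D (x - of_int k *\<^sub>R e) \<partial>count_space (UNIV :: int set) \<partial>lborel)"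
    by (simp add: nn_integral_cmult one)
  also have "\<dots> = (\<integral>\<^sup>+k. \<integral>\<^sup>+x. F x * indicator D (x - of_int k *\<^sub>R e) \<partial>lborel \<partial>count_space (UNIV :: int set))"
    by (rule nn_integral_count_space_nn_integral) auto
  also have "\<dots> = (\<integral>\<^sup>+k. \<integral>\<^sup>+x. F (x + of_int k *\<^sub>R e) * indicator D x \<partial>lborel \<partial>count_space (UNIV :: int set))"
  proof (rule nn_integral_cong)
    fix k :: int
    show "(\<integral>\<^sup>+x. F x * indicator D (x - of_int k *\<^sub>R e) \<partial>lborel) = (\<integral>\<^sup>+x. F (x + of_int k *\<^sub>R e) * indicator D x \<partial>lborel)"
      using nn_integral_lborel_translate[of "\<lambda>x. F x * indicator D (x - of_int k *\<^sub>R e)" "of_int k *\<^sub>R e"] by simp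
  qed
  also have "\<dots> = (\<integral>\<^sup>+x. \<integral>\<^sup>+k. F (x + of_int k *\<^sub>R e) * indicator D x \<partial>count_space (UNIV :: int set) \<partial>lborel)"
    by (rule nn_integral_count_space_nn_integral[symmetric]) auto
  also have "\<dots> = (\<integral>\<^sup>+x. (\<integral>\<^sup>+k. F (x + of_int k *\<^sub>R e) \<partial>count_space UNIV) * indicator D x \<partial>lborel)"
    by (intro nn_integral_cong) (simp add: nn_integral_multc)
  finally show ?thesis unfolding D_def .
qed

lemma lp_int_translate:
  fixes g :: "'a::euclidean_space \<Rightarrow> real"
  assumes [measurable]: "g \<in> borel_measurable borel"
  shows "lp_int p (\<lambda>x. g (x + c)) = lp_int p g"
  unfolding lp_int_def by (rule nn_integral_lborel_translate) measurable

lemma sdiff_measurable[measurable]: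
  fixes g :: "'a::euclidean_space \<Rightarrow> real"
  assumes [measurable]: "g \<in> borel_measurable borel"
  shows "sdiff e g \<in> borel_measurable borel"
  unfolding sdiff_def by measurable

lemma avg3_measurable[measurable]:
  fixes g :: "'a::euclidean_space \<Rightarrow> real"
  assumes [measurable]: "g \<in> borel_measurable borel"
  shows "avg3 e g \<in> borel_measurable borel"
  unfolding avg3_def by measurable

text \<open>The step operator A n may change with n, as the law of the jumps does when the
  coefficients vary in time.\<close>

primrec sol :: "(nat \<Rightarrow> ('a \<Rightarrow> real) \<Rightarrow> 'a \<Rightarrow> real) \<Rightarrow> (nat \<Rightarrow> 'a \<Rightarrow> real) \<Rightarrow> nat \<Rightarrow> 'a \<Rightarrow> real" where
  "sol A f 0 = f 0"
| "sol A f (Suc n) = (\<lambda>x. A n (sol A f n) x + f (Suc n) x)"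

text \<open>Maximal regularity in the direction e. The common radius R makes the sums on lines
  finite, and M is fixed before R and N.\<close>

definition lp_regular :: "real \<Rightarrow> real \<Rightarrow> 'a::euclidean_space \<Rightarrow> (nat \<Rightarrow> ('a \<Rightarrow> real) \<Rightarrow> 'a \<Rightarrow> real) \<Rightarrow> bool" where
  "lp_regular p M e A \<longleftrightarrow> (\<forall>f R N. (\<forall>n. f n \<in> borel_measurable borel) \<longrightarrow> (\<forall>n x. R < norm x \<longrightarrow> f n x = 0) \<longrightarrow>
     (\<Sum>n\<le>N. lp_int p (sdiff e (sol A f n))) \<le> ennreal M * (\<Sum>n\<le>N. lp_int p (f n)))"

lemma nn_integral_sum_indicator:
  fixes g :: "'i \<Rightarrow> 'a::euclidean_space \<Rightarrow> ennreal"
  assumes "\<And>i. i \<in> S \<Longrightarrow> g i \<in> borel_measurable borel"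
  shows "(\<Sum>i\<in>S. \<integral>\<^sup>+x. g i x \<partial>lborel) = (\<integral>\<^sup>+x. (\<Sum>i\<in>S. g i x) \<partial>lborel)"
  using assms by (intro nn_integral_sum[symmetric]) auto

text \<open>On each lattice x + Z e the operator \<open>avg3 e\<close> acts as \<open>lstep\<close>,
  so the lattice estimate holds line by line with one constant for all directions and all lengths of
  e. It is then integrated over the slab.\<close>

lemma lp_regular_avg3:
  assumes "1 < p"
  shows "\<exists>M\<ge>0. \<forall>e::'a::euclidean_space. e \<noteq> 0 \<longrightarrow> lp_regular p M e (\<lambda>n. avg3 e)"
proof -
  obtain M where M: "0 \<le> M" "\<And>f v N B J. v 0 = f 0 \<Longrightarrow> (\<And>n k. v (Suc n) k = lstep (v n) k + f (Suc n) k) \<Longrightarrow>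
    (\<And>n k. B < \<bar>k\<bar> \<Longrightarrow> f n k = 0) \<Longrightarrow> finite J \<Longrightarrow>
    (\<Sum>n\<le>N. \<Sum>k\<in>J. \<bar>v n (k + 1) - 2 * v n k + v n (k - 1)\<bar> powr p) \<le> M * (\<Sum>n\<le>N. \<Sum>k\<in>{-B..B}. \<bar>f n k\<bar> powr p)"
    using lazy_walk_maximal_regularity[OF assms] by blast
  have "lp_regular p M e (\<lambda>n. avg3 e)" if e: "e \<noteq> 0" for e :: 'a
    unfolding lp_regular_def
  proof (intro allI impI)
    fix f :: "nat \<Rightarrow> 'a \<Rightarrow> real" and R N
    assume f[rule_format, measurable]: "\<forall>n. f n \<in> borel_measurable borel" and supp: "\<forall>n x. R < norm x \<longrightarrow> f n x = 0"
    define v where "v = sol (\<lambda>n. avg3 e) f"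
    have v0: "v 0 = f 0" and vS: "v (Suc n) x = avg3 e (v n) x + f (Suc n) x" for n x
      by (auto simp: v_def)
    have vm[measurable]: "v n \<in> borel_measurable borel" for n
      unfolding v_def by (induction n) auto
    define D where "D = {x. 0 \<le> x \<bullet> e \<and> x \<bullet> e < e \<bullet> e}"
    have D[measurable]: "D \<in> sets borel" unfolding D_def by measurable
    let ?C = "\<lambda>g x. (\<integral>\<^sup>+k. ennreal (\<bar>g (x + of_int k *\<^sub>R e)\<bar> powr p) \<partial>count_space (UNIV :: int set))"
    have Cm: "(\<lambda>x. ?C g x * indicator D x) \<in> borel_measurable borel" if [measurable]: "g \<in> borel_measurable borel" for g
    proof -
      interpret sigma_finite_measure "count_space (UNIV :: int set)"
        by (rule sigma_finite_measure_count_space_countable) simp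
      have "(\<lambda>(x, k). ennreal (\<bar>g (x + of_int k *\<^sub>R e)\<bar> powr p)) \<in> borel_measurable (borel \<Otimes>\<^sub>M count_space (UNIV :: int set))"
        using measurable_compose_countable'[of "UNIV :: int set" "\<lambda>k z. ennreal (\<bar>g (fst z + of_int k *\<^sub>R e)\<bar> powr p)"
            "borel \<Otimes>\<^sub>M count_space (UNIV :: int set)" borel snd]
        by (simp add: split_beta)
      from borel_measurable_nn_integral[OF this] have [measurable]: "(\<lambda>x. ?C g x) \<in> borel_measurable borel" by simp
      show ?thesis by measurable
    qed
    have lat: "lp_int p g = (\<integral>\<^sup>+x. ?C g x * indicator D x \<partial>lborel)" if [measurable]: "g \<in> borel_measurable borel" for g
      unfolding lp_int_def D_def by (rule nn_integral_lborel_lattice) (use e in measurable)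
    have pt: "(\<Sum>n\<le>N. ?C (sdiff e (v n)) x) \<le> ennreal M * (\<Sum>n\<le>N. ?C (f n) x)" for x
    proof -
      \<comment> \<open>The extent of the data along the line depends on x; this is harmless because
        the lattice constant does not depend on B.\<close>
      define B where "B = \<lceil>(\<bar>R\<bar> + norm x) / norm e\<rceil>"
      have B: "R < norm (x + of_int k *\<^sub>R e)" if "B < \<bar>k\<bar>" for k
      proof -
        have "(\<bar>R\<bar> + norm x) / norm e < \<bar>of_int k\<bar>" using that unfolding B_def by linarith
        then have "\<bar>R\<bar> + norm x < norm (of_int k *\<^sub>R e)" using e by (simp add: divide_less_eq)
        then show ?thesis using norm_triangle_ineq4[of "x + of_int k *\<^sub>R e" x] by simp
      qed
      define F where "F n k = f n (x + of_int k *\<^sub>R e)" for n and k :: int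
      define V where "V n k = v n (x + of_int k *\<^sub>R e)" for n and k :: int
      have F0: "B < \<bar>k\<bar> \<Longrightarrow> F n k = 0" for n k using B[of k] supp by (simp add: F_def)
      have shift: "x + of_int (k + 1) *\<^sub>R e = x + of_int k *\<^sub>R e + e" "x + of_int (k - 1) *\<^sub>R e = x + of_int k *\<^sub>R e - e" for k :: int
        by (simp_all add: algebra_simps)
      have V0: "V 0 = F 0" by (rule ext) (simp add: V_def F_def v0)
      have VS: "V (Suc n) k = lstep (V n) k + F (Suc n) k" for n k
        by (simp only: V_def F_def vS lstep_def avg3_def shift)
      have Vsupp: "B + int n < \<bar>k\<bar> \<Longrightarrow> V n k = 0" for n k
      proof (induction n arbitrary: k)
        case (Suc n)
        then show ?case using F0[of k "Suc n"] by (auto simp: VS lstep_def)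
      qed (use V0 F0 in auto)
      \<comment> \<open>The support of V n grows by one per step, and a second difference reaches
        one further.\<close>
      define J where "J = {-(B + int N + 1)..B + int N + 1}"
      have "?C (sdiff e (v n)) x = ennreal (\<Sum>k\<in>J. \<bar>V n (k + 1) - 2 * V n k + V n (k - 1)\<bar> powr p)" if "n \<le> N" for n
      proof -
        have "sdiff e (v n) (x + of_int k *\<^sub>R e) = V n (k + 1) - 2 * V n k + V n (k - 1)" for k
          by (simp only: sdiff_def V_def shift)
        then have "?C (sdiff e (v n)) x = (\<integral>\<^sup>+k. ennreal (\<bar>V n (k + 1) - 2 * V n k + V n (k - 1)\<bar> powr p) \<partial>count_space UNIV)"
          by simp
        also have "\<dots> = (\<Sum>k\<in>J. ennreal (\<bar>V n (k + 1) - 2 * V n k + V n (k - 1)\<bar> powr p))"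
        proof (rule nn_integral_count_space')
          fix k assume "k \<notin> J"
          then have "B + int N + 1 < \<bar>k\<bar>" by (auto simp: J_def)
          then have "V n (k + 1) = 0" "V n k = 0" "V n (k - 1) = 0" using that by (auto intro!: Vsupp)
          then show "ennreal (\<bar>V n (k + 1) - 2 * V n k + V n (k - 1)\<bar> powr p) = 0" using assms by simp
        qed (auto simp: J_def)
        finally show ?thesis by (simp add: sum_ennreal)
      qed
      then have "(\<Sum>n\<le>N. ?C (sdiff e (v n)) x) = ennreal (\<Sum>n\<le>N. \<Sum>k\<in>J. \<bar>V n (k + 1) - 2 * V n k + V n (k - 1)\<bar> powr p)"
        by (simp add: sum_nonneg flip: sum_ennreal)
      also have "\<dots> \<le> ennreal (M * (\<Sum>n\<le>N. \<Sum>k\<in>{-B..B}. \<bar>F n k\<bar> powr p))"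
        by (intro ennreal_leI M(2) V0 VS F0) (auto simp: J_def)
      also have "\<dots> = ennreal M * (\<Sum>n\<le>N. ennreal (\<Sum>k\<in>{-B..B}. \<bar>F n k\<bar> powr p))"
        using M(1) by (simp add: ennreal_mult sum_nonneg sum_ennreal)
      also have "(\<Sum>n\<le>N. ennreal (\<Sum>k\<in>{-B..B}. \<bar>F n k\<bar> powr p)) = (\<Sum>n\<le>N. ?C (f n) x)"
      proof (intro sum.cong refl)
        fix n
        have "?C (f n) x = (\<Sum>k\<in>{-B..B}. ennreal (\<bar>F n k\<bar> powr p))"
          unfolding F_def[symmetric]
          by (rule nn_integral_count_space') (use F0 assms in \<open>auto simp: abs_le_iff not_le intro!: F0\<close>)
        then show "ennreal (\<Sum>k\<in>{-B..B}. \<bar>F n k\<bar> powr p) = ?C (f n) x" by (simp add: sum_ennreal)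
      qed
      finally show ?thesis .
    qed
    have "(\<Sum>n\<le>N. lp_int p (sdiff e (v n))) = (\<integral>\<^sup>+x. (\<Sum>n\<le>N. ?C (sdiff e (v n)) x * indicator D x) \<partial>lborel)"
      unfolding lat[OF sdiff_measurable[OF vm]] by (intro nn_integral_sum_indicator Cm sdiff_measurable vm)
    also have "\<dots> \<le> (\<integral>\<^sup>+x. ennreal M * (\<Sum>n\<le>N. ?C (f n) x * indicator D x) \<partial>lborel)"
      using mult_right_mono[OF pt, of "indicator D _"]
      by (intro nn_integral_mono) (simp add: sum_distrib_right[symmetric] mult.assoc)
    also have "\<dots> = ennreal M * (\<integral>\<^sup>+x. (\<Sum>n\<le>N. ?C (f n) x * indicator D x) \<partial>lborel)"
    proof (rule nn_integral_cmult)
      show "(\<lambda>x. \<Sum>n\<le>N. ?C (f n) x * indicator D x) \<in> borel_measurable lborel"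
        unfolding measurable_lborel2 by (intro borel_measurable_sum Cm f)
    qed
    also have "(\<integral>\<^sup>+x. (\<Sum>n\<le>N. ?C (f n) x * indicator D x) \<partial>lborel) = (\<Sum>n\<le>N. lp_int p (f n))"
      unfolding lat[OF f] by (intro nn_integral_sum_indicator[symmetric] Cm f)
    finally show "(\<Sum>n\<le>N. lp_int p (sdiff e (sol (\<lambda>n. avg3 e) f n))) \<le> ennreal M * (\<Sum>n\<le>N. lp_int p (f n))"
      by (simp add: v_def)
  qed
  with M(1) show ?thesis by blast
qed

text \<open>Jensen's inequality for the p-th power, multiplied by the number of points. It follows
  from Young's inequality against A^(p-1), where A is the mean of the absolute values.\<close>

lemma abs_mean_powr_le:
  fixes a :: "'y \<Rightarrow> real"
  assumes "1 < p" "finite Y" "Y \<noteq> {}"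
  shows "card Y * \<bar>(\<Sum>y\<in>Y. a y) / card Y\<bar> powr p \<le> (\<Sum>y\<in>Y. \<bar>a y\<bar> powr p)"
proof -
  define m where "m = card Y"
  have m: "0 < m" using assms by (simp add: m_def card_gt_0_iff)
  define A where "A = (\<Sum>y\<in>Y. \<bar>a y\<bar>) / m"
  have A0: "0 \<le> A" by (simp add: A_def sum_nonneg)
  define q where "q = p / (p - 1)"
  have q: "1 < q" "1 / p + 1 / q = 1" "(p - 1) * q = p" using assms by (auto simp: q_def field_simps)
  have "m * A powr p = (\<Sum>y\<in>Y. \<bar>a y\<bar> * A powr (p - 1))"
  proof (cases "A = 0")
    case False
    have "A powr p = A powr 1 * A powr (p - 1)" by (simp only: powr_add[symmetric]) simp
    then show ?thesis using A0 m by (simp add: A_def sum_distrib_right)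
  qed (use assms in auto)
  also have "\<dots> \<le> (\<Sum>y\<in>Y. \<bar>a y\<bar> powr p / p + (A powr (p - 1)) powr q / q)"
    using assms q by (intro sum_mono Youngs_inequality) auto
  also have "\<dots> = (\<Sum>y\<in>Y. \<bar>a y\<bar> powr p) / p + m * A powr p * (1 / q)"
    using q by (simp add: sum.distrib sum_divide_distrib powr_powr m_def)
  also have "1 / q = 1 - 1 / p" using q by simp
  finally have "m * A powr p * (1 / p) \<le> (\<Sum>y\<in>Y. \<bar>a y\<bar> powr p) * (1 / p)" by (simp add: algebra_simps)
  then have "m * A powr p \<le> (\<Sum>y\<in>Y. \<bar>a y\<bar> powr p)" using assms by (simp add: divide_le_cancel)
  moreover have "\<bar>(\<Sum>y\<in>Y. a y) / card Y\<bar> \<le> A"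
    unfolding A_def m_def by (simp add: abs_divide divide_right_mono)
  then have "m * \<bar>(\<Sum>y\<in>Y. a y) / card Y\<bar> powr p \<le> m * A powr p"
    using assms by (intro mult_left_mono powr_mono2) auto
  ultimately show ?thesis by (simp add: m_def)
qed

section \<open>Removing the random jumps\<close>

definition jump_avg :: "'y set \<Rightarrow> ('y \<Rightarrow> 'a::real_vector) \<Rightarrow> ('a \<Rightarrow> real) \<Rightarrow> 'a \<Rightarrow> real" where
  "jump_avg Y s g x = (\<Sum>y\<in>Y. g (x + s y)) / card Y"

text \<open>A random jump between steps m and m + 1 is undone by translating the data of the
  steps up to m; averaging the resulting jump-free solutions costs nothing in L^p.\<close>

lemma lp_regular_jumps:
  fixes e :: "'a::euclidean_space" and s :: "nat \<Rightarrow> 'y \<Rightarrow> 'a"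
  assumes reg: "lp_regular p M e (\<lambda>n. avg3 e)" and p: "1 < p" and Y: "finite Y" "Y \<noteq> {}"
  shows "lp_regular p M e (\<lambda>n. if n < m then jump_avg Y (s n) \<circ> avg3 e else avg3 e)"
\<comment> \<open>Induction on the number of steps that carry a jump. The last jump is the one
  removed, so that all later steps are already free of jumps.\<close>
proof (induction m)
  case 0
  then show ?case using reg by simp
next
  case (Suc m)
  define A where "A m = (\<lambda>n. if n < m then jump_avg Y (s n) \<circ> avg3 e else avg3 e)" for m :: nat
  \<comment> \<open>Each step commutes with translations: the jumps depend on the step and not on
    x.\<close>
  have tr: "A m n (\<lambda>x. g (x + c)) x = A m n g (x + c)" for m n g c x
    by (simp add: A_def jump_avg_def avg3_def algebra_simps)
  have cY: "0 < card Y" using Y by (simp add: card_gt_0_iff)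
  have lin: "avg3 e (\<lambda>x. (\<Sum>y\<in>Y. g y x) / card Y) x = (\<Sum>y\<in>Y. avg3 e (g y) x) / card Y" for g x
    by (simp add: avg3_def sum_distrib_left sum_divide_distrib flip: sum.distrib)
       (intro sum.cong refl, use cY in \<open>simp add: field_simps\<close>)
  show ?case
    unfolding A_def[symmetric] lp_regular_def
  proof (intro allI impI)
    fix f :: "nat \<Rightarrow> 'a \<Rightarrow> real" and R N
    assume f[rule_format, measurable]: "\<forall>n. f n \<in> borel_measurable borel" and supp: "\<forall>n x. R < norm x \<longrightarrow> f n x = 0"
    define v where "v = sol (A (Suc m)) f"
    \<comment> \<open>Data up to the jump are translated by its value at y, later data are kept; the
      solution w y then runs without a jump at step m.\<close>
    define F where "F y n x = (if n \<le> m then f n (x + s m y) else f n x)" for y n x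
    define w where "w y = sol (A m) (F y)" for y
    have Fm[measurable]: "F y n \<in> borel_measurable borel" for y n
      unfolding F_def by (cases "n \<le> m") auto
    have Am: "A k n g \<in> borel_measurable borel" if [measurable]: "g \<in> borel_measurable borel" for k n g
      unfolding A_def by (auto simp: jump_avg_def[abs_def] comp_def)
    have vm[measurable]: "v n \<in> borel_measurable borel" for n
      unfolding v_def by (induction n) (auto intro!: borel_measurable_add Am)
    have wm[measurable]: "w y n \<in> borel_measurable borel" for y n
      unfolding w_def by (induction n) (auto intro!: borel_measurable_add Am)
    have low: "w y n x = v n (x + s m y)" if "n \<le> m" for y n x
      using that
    proof (induction n arbitrary: x)
      case (Suc n)
      then have "w y n = (\<lambda>x. v n (x + s m y))" by auto
      then have "w y (Suc n) x = A m n (\<lambda>x. v n (x + s m y)) x + f (Suc n) (x + s m y)"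
        using Suc.prems by (simp add: w_def F_def)
      also have "\<dots> = A (Suc m) n (v n) (x + s m y) + f (Suc n) (x + s m y)"
        using Suc.prems unfolding tr by (simp add: A_def)
      finally show ?case by (simp add: v_def)
    qed (simp add: w_def v_def F_def)
    have high: "v n x = (\<Sum>y\<in>Y. w y n x) / card Y" if "m < n" for n x
      using that
    proof (induction n arbitrary: x)
      case (Suc n)
      have wS: "w y (Suc n) x = avg3 e (w y n) x + f (Suc n) x" for y
        using Suc.prems by (simp add: w_def F_def A_def)
      show ?case
      proof (cases "n = m")
        case True
        have "w y m = (\<lambda>x. v m (x + s m y))" for y using low by auto
        then have "avg3 e (w y n) x = avg3 e (v m) (x + s m y)" for y
          using True by (simp add: avg3_def algebra_simps)
        then have "(\<Sum>y\<in>Y. w y (Suc n) x) / card Y = jump_avg Y (s m) (avg3 e (v m)) x + f (Suc n) x"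
          using cY by (simp add: wS sum.distrib add_divide_distrib jump_avg_def)
        then show ?thesis using True by (simp add: v_def A_def)
      next
        case False
        then have "v n = (\<lambda>x. (\<Sum>y\<in>Y. w y n x) / card Y)" using Suc by auto
        then have "v (Suc n) x = (\<Sum>y\<in>Y. avg3 e (w y n) x) / card Y + f (Suc n) x"
          using False Suc.prems lin[of "\<lambda>y. w y n" x] by (simp add: v_def A_def)
        then show ?thesis using cY by (simp add: wS sum.distrib add_divide_distrib)
      qed
    qed simp
    \<comment> \<open>Multiplied by the number of jumps to avoid division of extended reals. Up to
      step m each w y is a translate of v; afterwards v is the mean of the w y and Jensen
      applies.\<close>
    have le: "of_nat (card Y) * lp_int p (sdiff e (v n)) \<le> (\<Sum>y\<in>Y. lp_int p (sdiff e (w y n)))" for n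
    proof (cases "n \<le> m")
      case True
      have "lp_int p (sdiff e (w y n)) = lp_int p (sdiff e (v n))" for y
      proof -
        have "sdiff e (w y n) = (\<lambda>x. sdiff e (v n) (x + s m y))"
          using low[OF True] by (auto simp: sdiff_def fun_eq_iff algebra_simps)
        then show ?thesis by (simp add: lp_int_translate)
      qed
      then show ?thesis by simp
    next
      case False
      have eq: "sdiff e (v n) x = (\<Sum>y\<in>Y. sdiff e (w y n) x) / card Y" for x
        using high[of n] False
        by (simp add: sdiff_def sum.distrib sum_subtractf add_divide_distrib diff_divide_distrib sum_distrib_left sum_divide_distrib)
      have "of_nat (card Y) * lp_int p (sdiff e (v n)) = (\<integral>\<^sup>+x. ennreal (card Y * \<bar>sdiff e (v n) x\<bar> powr p) \<partial>lborel)"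
        unfolding lp_int_def by (simp add: ennreal_mult ennreal_of_nat_eq_real_of_nat nn_integral_cmult)
      also have "\<dots> \<le> (\<integral>\<^sup>+x. ennreal (\<Sum>y\<in>Y. \<bar>sdiff e (w y n) x\<bar> powr p) \<partial>lborel)"
        unfolding eq by (intro nn_integral_mono ennreal_leI abs_mean_powr_le p Y)
      also have "\<dots> = (\<integral>\<^sup>+x. (\<Sum>y\<in>Y. ennreal (\<bar>sdiff e (w y n) x\<bar> powr p)) \<partial>lborel)"
        by (simp add: sum_ennreal)
      also have "\<dots> = (\<Sum>y\<in>Y. lp_int p (sdiff e (w y n)))"
        unfolding lp_int_def by (rule nn_integral_sum) measurable
      finally show ?thesis .
    qed
    have IH: "(\<Sum>n\<le>N. lp_int p (sdiff e (w y n))) \<le> ennreal M * (\<Sum>n\<le>N. lp_int p (f n))" for y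
    proof -
      \<comment> \<open>The translation enlarges the support, which the induction hypothesis permits
        since it allows any radius.\<close>
      have "R + norm (s m y) < norm x \<Longrightarrow> F y n x = 0" for n x
        using supp[rule_format, of x n] supp[rule_format, of "x + s m y" n] norm_triangle_ineq4[of "x + s m y" "s m y"]
        by (auto simp: F_def) (smt (verit) norm_ge_zero)+
      then have "(\<Sum>n\<le>N. lp_int p (sdiff e (w y n))) \<le> ennreal M * (\<Sum>n\<le>N. lp_int p (F y n))"
        using Suc.IH[folded A_def, unfolded lp_regular_def, rule_format, of "F y"] Fm unfolding w_def by blast
      also have "(\<Sum>n\<le>N. lp_int p (F y n)) = (\<Sum>n\<le>N. lp_int p (f n))"
      proof (intro sum.cong refl)
        fix n
        have "F y n = (\<lambda>x. f n (x + s m y)) \<or> F y n = f n" by (auto simp: F_def fun_eq_iff)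
        then show "lp_int p (F y n) = lp_int p (f n)" using lp_int_translate[OF f, of p n "s m y"] by auto
      qed
      finally show ?thesis .
    qed
    have "of_nat (card Y) * (\<Sum>n\<le>N. lp_int p (sdiff e (v n))) \<le> (\<Sum>n\<le>N. \<Sum>y\<in>Y. lp_int p (sdiff e (w y n)))"
      unfolding sum_distrib_left by (intro sum_mono le)
    also have "\<dots> = (\<Sum>y\<in>Y. \<Sum>n\<le>N. lp_int p (sdiff e (w y n)))" by (rule sum.swap)
    also have "\<dots> \<le> (\<Sum>y\<in>Y. ennreal M * (\<Sum>n\<le>N. lp_int p (f n)))" by (intro sum_mono IH)
    also have "\<dots> = of_nat (card Y) * (ennreal M * (\<Sum>n\<le>N. lp_int p (f n)))" by simp
    finally show "(\<Sum>n\<le>N. lp_int p (sdiff e (sol (A (Suc m)) f n))) \<le> ennreal M * (\<Sum>n\<le>N. lp_int p (f n))"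
      using cY by (simp add: v_def ennreal_mult_le_mult_iff)
  qed
qed

subsection \<open>Directional derivatives of smooth functions\<close>

text \<open>\<open>pderiv\<close> is defined along a line; identifying it with the total derivative
  makes it linear in the direction, which the expansions in coordinates rely on.\<close>

lemma pderiv_eq_frechet:
  assumes "(f has_derivative f') (at z)"
  shows "pderiv v f z = f' v"
proof -
  have "((\<lambda>s. z + s *\<^sub>R v) has_derivative (\<lambda>s. s *\<^sub>R v)) (at 0)"
    by (auto intro!: derivative_eq_intros)
  from has_derivative_compose[OF this, of f f'] assms
  have "((\<lambda>s. f (z + s *\<^sub>R v)) has_derivative (\<lambda>s. f' (s *\<^sub>R v))) (at 0)" by simp
  moreover have "f' (s *\<^sub>R v) = f' v * s" for s
    using linear_scale[OF has_derivative_linear[OF assms]] by simp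
  ultimately have "((\<lambda>s. f (z + s *\<^sub>R v)) has_field_derivative f' v) (at 0)"
    by (simp add: has_field_derivative_def)
  then show ?thesis unfolding pderiv_def by (rule DERIV_imp_deriv)
qed

lemma smooth_differentiable: "smooth f \<Longrightarrow> f differentiable (at z)"
  unfolding smooth_def using iter_pderiv.simps(1) by metis

lemma iter_pderiv_append: "iter_pderiv (vs @ ws) f = iter_pderiv vs (iter_pderiv ws f)"
  by (induction vs) auto

lemma smooth_pderiv:
  assumes "smooth f"
  shows "smooth (pderiv v f)"
proof -
  have "iter_pderiv vs (pderiv v f) = iter_pderiv (vs @ [v]) f" for vs
    by (simp add: iter_pderiv_append)
  then show ?thesis using assms by (simp add: smooth_def)
qed

lemma smooth_continuous: "smooth f \<Longrightarrow> isCont f z"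
  by (intro differentiable_imp_continuous_within smooth_differentiable)

lemma smooth_measurable:
  fixes f :: "'a::euclidean_space \<Rightarrow> real"
  assumes "smooth f" shows "f \<in> borel_measurable borel"
  by (intro borel_measurable_continuous_onI continuous_at_imp_continuous_on ballI smooth_continuous assms)

lemma smooth_line_deriv:
  assumes "smooth f"
  shows "((\<lambda>s. f (z + s *\<^sub>R v)) has_real_derivative pderiv v f (z + s *\<^sub>R v)) (at s)"
proof -
  obtain f' where f': "(f has_derivative f') (at (z + s *\<^sub>R v))"
    using smooth_differentiable[OF assms] unfolding differentiable_def by blast
  have "((\<lambda>s. z + s *\<^sub>R v) has_derivative (\<lambda>s. s *\<^sub>R v)) (at s)"
    by (auto intro!: derivative_eq_intros)
  from has_derivative_compose[OF this f']
  have "((\<lambda>s. f (z + s *\<^sub>R v)) has_derivative (\<lambda>s. f' (s *\<^sub>R v))) (at s)" by simp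
  moreover have "f' (s *\<^sub>R v) = f' v * s" for s
    using linear_scale[OF has_derivative_linear[OF f']] by simp
  ultimately show ?thesis
    by (simp add: has_field_derivative_def pderiv_eq_frechet[OF f'])
qed

lemma pderiv_sum_direction:
  assumes "smooth f" "finite S"
  shows "pderiv (\<Sum>i\<in>S. a i *\<^sub>R b i) f z = (\<Sum>i\<in>S. a i * pderiv (b i) f z)"
proof -
  obtain f' where f': "(f has_derivative f') (at z)"
    using smooth_differentiable[OF assms(1)] unfolding differentiable_def by blast
  then show ?thesis
    using linear_sum[OF has_derivative_linear[OF f'], of "\<lambda>i. a i *\<^sub>R b i" S] linear_scale[OF has_derivative_linear[OF f']]
    by (simp add: pderiv_eq_frechet[OF f'])
qed

lemma pderiv_sum_function:
  assumes "\<And>i. i \<in> S \<Longrightarrow> smooth (f i)"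
  shows "pderiv v (\<lambda>z. \<Sum>i\<in>S. a i * f i z) z = (\<Sum>i\<in>S. a i * pderiv v (f i) z)"
  unfolding pderiv_def
proof (rule DERIV_imp_deriv)
  show "((\<lambda>s. \<Sum>i\<in>S. a i * f i (z + s *\<^sub>R v)) has_real_derivative (\<Sum>i\<in>S. a i * deriv (\<lambda>s. f i (z + s *\<^sub>R v)) 0)) (at 0)"
    using smooth_line_deriv[OF assms, of _ z v 0]
    by (intro DERIV_sum DERIV_cmult) (simp add: pderiv_def)
qed

lemma pderiv2_sum_direction:
  assumes "smooth f" "finite S"
  shows "pderiv (\<Sum>i\<in>S. a i *\<^sub>R b i) (pderiv (\<Sum>i\<in>S. a i *\<^sub>R b i) f) z
    = (\<Sum>i\<in>S. \<Sum>j\<in>S. a i * a j * pderiv (b i) (pderiv (b j) f) z)"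
proof -
  have "pderiv (\<Sum>i\<in>S. a i *\<^sub>R b i) f = (\<lambda>z. \<Sum>j\<in>S. a j * pderiv (b j) f z)"
    using pderiv_sum_direction[OF assms] by auto
  then have "pderiv (\<Sum>i\<in>S. a i *\<^sub>R b i) (pderiv (\<Sum>i\<in>S. a i *\<^sub>R b i) f) z
     = (\<Sum>i\<in>S. a i * pderiv (b i) (\<lambda>z. \<Sum>j\<in>S. a j * pderiv (b j) f z) z)"
    using pderiv_sum_direction[OF smooth_pderiv[OF assms(1)] assms(2)] by metis
  also have "\<dots> = (\<Sum>i\<in>S. a i * (\<Sum>j\<in>S. a j * pderiv (b i) (pderiv (b j) f) z))"
    using smooth_pderiv[OF assms(1)] by (subst pderiv_sum_function) auto
  finally show ?thesis by (simp add: sum_distrib_left mult.assoc)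
qed

lemma pderiv_zero_outside:
  assumes "closed K" "\<And>z. z \<notin> K \<Longrightarrow> g z = 0" "z \<notin> K"
  shows "pderiv v g z = 0"
proof -
  have "(g has_derivative (\<lambda>_. 0)) (at z)"
    using assms by (intro has_derivative_transform_within_open[of "\<lambda>_. 0" "\<lambda>_. 0" z UNIV "- K" g]) auto
  then show ?thesis by (rule pderiv_eq_frechet)
qed

section \<open>Test functions and their difference quotients\<close>

lemma C0_infty_smooth: "C0_infty f \<Longrightarrow> smooth f"
  by (simp add: C0_infty_def)

lemma C0_infty_pderiv:
  assumes "C0_infty f"
  shows "C0_infty (pderiv v f)"
proof -
  obtain K where K: "compact K" "\<And>z. z \<notin> K \<Longrightarrow> f z = 0" using assms by (auto simp: C0_infty_def)
  have "pderiv v f z = 0" if "z \<notin> K" for z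
    by (rule pderiv_zero_outside[OF compact_imp_closed[OF K(1)] K(2) that])
  then show ?thesis using K(1) assms smooth_pderiv by (auto simp: C0_infty_def)
qed

lemma C0_infty_support:
  assumes "C0_infty f"
  obtains R where "0 < R" "\<And>z. R < norm z \<Longrightarrow> f z = 0"
proof -
  obtain K where K: "compact K" "\<And>z. z \<notin> K \<Longrightarrow> f z = 0" using assms by (auto simp: C0_infty_def)
  obtain R where "0 < R" "\<And>z. z \<in> K \<Longrightarrow> norm z \<le> R"
    using compact_imp_bounded[OF K(1)] bounded_pos by blast
  then show ?thesis using that[of R] K(2) by (metis not_less)
qed

lemma C0_infty_bounded:
  assumes "C0_infty f"
  obtains B where "0 < B" "\<And>z. \<bar>f z\<bar> \<le> B"
proof -
  obtain K where K: "compact K" "\<And>z. z \<notin> K \<Longrightarrow> f z = 0" using assms by (auto simp: C0_infty_def)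
  have "compact (f ` K)"
    by (intro compact_continuous_image K continuous_at_imp_continuous_on ballI smooth_continuous C0_infty_smooth assms)
  then obtain B where B: "0 < B" "\<And>z. z \<in> K \<Longrightarrow> \<bar>f z\<bar> \<le> B"
    using compact_imp_bounded[of "f ` K"] unfolding bounded_pos by auto
  have "\<bar>f z\<bar> \<le> B" for z using B K(2)[of z] by (cases "z \<in> K") auto
  then show ?thesis using that B(1) by blast
qed

text \<open>Taylor's formula with Lagrange remainder at h and at -h: the first-order terms cancel.
  The two remainders sit at different points, hence t1 and t2.\<close>

lemma second_difference_mean:
  assumes "smooth f"
  obtains t1 t2 where "\<bar>t1\<bar> \<le> \<bar>h\<bar>" "\<bar>t2\<bar> \<le> \<bar>h\<bar>"
    "f (z + h *\<^sub>R v) - 2 * f z + f (z - h *\<^sub>R v) = h\<^sup>2 / 2 * (pderiv v (pderiv v f) (z + t1 *\<^sub>R v) + pderiv v (pderiv v f) (z + t2 *\<^sub>R v))"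
proof -
  define d where "d m s = iter_pderiv (replicate m v) f (z + s *\<^sub>R v)" for m :: nat and s
  have sm: "smooth (iter_pderiv (replicate m v) f)" for m
    by (induction m) (auto simp: assms smooth_pderiv)
  have D: "\<forall>m s. DERIV (d m) s :> d (Suc m) s"
    using smooth_line_deriv[OF sm, of _ z v] by (simp add: d_def[abs_def])
  have d0: "d 0 = (\<lambda>s. f (z + s *\<^sub>R v))" by (rule ext) (simp add: d_def)
  have "\<exists>t. \<bar>t\<bar> \<le> \<bar>x\<bar> \<and> f (z + x *\<^sub>R v) = f z + pderiv v f z * x + pderiv v (pderiv v f) (z + t *\<^sub>R v) / 2 * x\<^sup>2" for x
    using Maclaurin_all_le[OF d0 D, of x 2] by (auto simp: eval_nat_numeral d_def)
  then obtain t1 t2 where "\<bar>t1\<bar> \<le> \<bar>h\<bar>" "f (z + h *\<^sub>R v) = f z + pderiv v f z * h + pderiv v (pderiv v f) (z + t1 *\<^sub>R v) / 2 * h\<^sup>2"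
    "\<bar>t2\<bar> \<le> \<bar>- h\<bar>" "f (z + (- h) *\<^sub>R v) = f z + pderiv v f z * (- h) + pderiv v (pderiv v f) (z + t2 *\<^sub>R v) / 2 * (- h)\<^sup>2"
    by metis
  then show ?thesis by (intro that[of t1 t2]) (auto simp: field_simps)
qed

lemma mean_value_line:
  assumes "smooth f"
  obtains t where "\<bar>t\<bar> \<le> \<bar>h\<bar>" "f (z + h *\<^sub>R v) = f z + h * pderiv v f (z + t *\<^sub>R v)"
proof -
  have D: "DERIV (\<lambda>s. f (z + s *\<^sub>R v)) s :> pderiv v f (z + s *\<^sub>R v)" for s
    by (rule smooth_line_deriv[OF assms])
  consider "h = 0" | "0 < h" | "h < 0" by linarith
  then show ?thesis
  proof cases
    case 1
    then show ?thesis using that[of 0] by simp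
  next
    case 2
    obtain t where "0 < t" "t < h" "f (z + h *\<^sub>R v) - f (z + 0 *\<^sub>R v) = (h - 0) * pderiv v f (z + t *\<^sub>R v)"
      using MVT2[OF 2, of "\<lambda>s. f (z + s *\<^sub>R v)" "\<lambda>s. pderiv v f (z + s *\<^sub>R v)"] D by blast
    then show ?thesis using that[of t] by simp
  next
    case 3
    obtain t where "h < t" "t < 0" "f (z + 0 *\<^sub>R v) - f (z + h *\<^sub>R v) = (0 - h) * pderiv v f (z + t *\<^sub>R v)"
      using MVT2[OF 3, of "\<lambda>s. f (z + s *\<^sub>R v)" "\<lambda>s. pderiv v f (z + s *\<^sub>R v)"] D by blast
    then show ?thesis using that[of t] by simp
  qed
qed

text \<open>One double difference, symmetric in v and w, has both mixed derivatives as limit after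
  division by h^2. The mean value theorem, applied twice in either order, yields one of them at a
  point near z, and continuity finishes.\<close>

lemma pderiv_commute:
  assumes "smooth f"
  shows "pderiv v (pderiv w f) z = pderiv w (pderiv v f) z"
proof -
  have mixed: "\<exists>s t. \<bar>s\<bar> \<le> \<bar>h\<bar> \<and> \<bar>t\<bar> \<le> \<bar>h\<bar> \<and>
     f (z + h *\<^sub>R v + h *\<^sub>R w) - f (z + h *\<^sub>R v) - f (z + h *\<^sub>R w) + f z = h * (h * pderiv w (pderiv v f) (z + s *\<^sub>R v + t *\<^sub>R w))"
    if hpos: "h > 0" for h v w
  proof -
    define g where "g s = f (z + s *\<^sub>R v + h *\<^sub>R w) - f (z + s *\<^sub>R v)" for s
    have "DERIV g s :> pderiv v f (z + s *\<^sub>R v + h *\<^sub>R w) - pderiv v f (z + s *\<^sub>R v)" for s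
      using DERIV_diff[OF smooth_line_deriv[OF assms, of "z + h *\<^sub>R w" v s] smooth_line_deriv[OF assms, of z v s]]
      by (simp add: g_def[abs_def] algebra_simps)
    then obtain s where s: "0 < s" "s < h" "g h - g 0 = (h - 0) * (pderiv v f (z + s *\<^sub>R v + h *\<^sub>R w) - pderiv v f (z + s *\<^sub>R v))"
      using MVT2[OF hpos, of g "\<lambda>s. pderiv v f (z + s *\<^sub>R v + h *\<^sub>R w) - pderiv v f (z + s *\<^sub>R v)"] by blast
    obtain t where t: "\<bar>t\<bar> \<le> \<bar>h\<bar>" "pderiv v f (z + s *\<^sub>R v + h *\<^sub>R w) = pderiv v f (z + s *\<^sub>R v) + h * pderiv w (pderiv v f) (z + s *\<^sub>R v + t *\<^sub>R w)"
      by (rule mean_value_line[OF smooth_pderiv[OF assms, of v], where h = h and z = "z + s *\<^sub>R v" and v = w])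
    show ?thesis
      using s t by (intro exI[of _ s] exI[of _ t]) (auto simp: g_def algebra_simps)
  qed
  define h where "h n = 1 / real (Suc n)" for n
  have h: "0 < h n" for n by (simp add: h_def)
  have h0: "h \<longlonglongrightarrow> 0" unfolding h_def[abs_def] using LIMSEQ_Suc[OF lim_1_over_n] by simp
  have "\<exists>s t s' t'. \<bar>s\<bar> \<le> h n \<and> \<bar>t\<bar> \<le> h n \<and> \<bar>s'\<bar> \<le> h n \<and> \<bar>t'\<bar> \<le> h n \<and>
     pderiv w (pderiv v f) (z + s *\<^sub>R v + t *\<^sub>R w) = pderiv v (pderiv w f) (z + s' *\<^sub>R w + t' *\<^sub>R v)" for n
  proof -
    obtain s t where 1: "\<bar>s\<bar> \<le> \<bar>h n\<bar>" "\<bar>t\<bar> \<le> \<bar>h n\<bar>" "f (z + h n *\<^sub>R v + h n *\<^sub>R w) - f (z + h n *\<^sub>R v) - f (z + h n *\<^sub>R w) + f z = h n * (h n * pderiv w (pderiv v f) (z + s *\<^sub>R v + t *\<^sub>R w))"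
      using mixed[OF h] by metis
    obtain s' t' where 2: "\<bar>s'\<bar> \<le> \<bar>h n\<bar>" "\<bar>t'\<bar> \<le> \<bar>h n\<bar>" "f (z + h n *\<^sub>R w + h n *\<^sub>R v) - f (z + h n *\<^sub>R w) - f (z + h n *\<^sub>R v) + f z = h n * (h n * pderiv v (pderiv w f) (z + s' *\<^sub>R w + t' *\<^sub>R v))"
      using mixed[OF h] by metis
    have sw: "z + h n *\<^sub>R w + h n *\<^sub>R v = z + h n *\<^sub>R v + h n *\<^sub>R w" by simp
    have "h n * (h n * pderiv w (pderiv v f) (z + s *\<^sub>R v + t *\<^sub>R w)) = h n * (h n * pderiv v (pderiv w f) (z + s' *\<^sub>R w + t' *\<^sub>R v))"
      using 1(3) 2(3)[unfolded sw] by linarith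
    then show ?thesis using 1 2 h[of n] by (intro exI[of _ s] exI[of _ t] exI[of _ s'] exI[of _ t']) auto
  qed
  then obtain s t s' t' where st: "\<And>n. \<bar>s n\<bar> \<le> h n" "\<And>n. \<bar>t n\<bar> \<le> h n" "\<And>n. \<bar>s' n\<bar> \<le> h n" "\<And>n. \<bar>t' n\<bar> \<le> h n"
     "\<And>n. pderiv w (pderiv v f) (z + s n *\<^sub>R v + t n *\<^sub>R w) = pderiv v (pderiv w f) (z + s' n *\<^sub>R w + t' n *\<^sub>R v)"
    by metis
  have lim: "x \<longlonglongrightarrow> 0" if "\<And>n. \<bar>x n\<bar> \<le> h n" for x :: "nat \<Rightarrow> real"
    by (rule Lim_null_comparison[OF _ h0]) (use that in auto)
  have "(\<lambda>n. z + s n *\<^sub>R v + t n *\<^sub>R w) \<longlonglongrightarrow> z + 0 *\<^sub>R v + 0 *\<^sub>R w"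
    by (intro tendsto_intros lim st)
  then have 1: "(\<lambda>n. pderiv w (pderiv v f) (z + s n *\<^sub>R v + t n *\<^sub>R w)) \<longlonglongrightarrow> pderiv w (pderiv v f) z"
    by (intro isCont_tendsto_compose[OF smooth_continuous[OF smooth_pderiv[OF smooth_pderiv[OF assms]]]]) simp
  have "(\<lambda>n. z + s' n *\<^sub>R w + t' n *\<^sub>R v) \<longlonglongrightarrow> z + 0 *\<^sub>R w + 0 *\<^sub>R v"
    by (intro tendsto_intros lim st)
  then have 2: "(\<lambda>n. pderiv v (pderiv w f) (z + s' n *\<^sub>R w + t' n *\<^sub>R v)) \<longlonglongrightarrow> pderiv v (pderiv w f) z"
    by (intro isCont_tendsto_compose[OF smooth_continuous[OF smooth_pderiv[OF smooth_pderiv[OF assms]]]]) simp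
  show ?thesis using LIMSEQ_unique[OF 2] 1 by (simp add: st(5))
qed

subsection \<open>Square decomposition of non-negative matrices\<close>

definition qform :: "('n::finite \<Rightarrow> 'n \<Rightarrow> real) \<Rightarrow> ('n \<Rightarrow> real) \<Rightarrow> real" where
  "qform C \<eta> = (\<Sum>i\<in>UNIV. \<Sum>j\<in>UNIV. C i j * \<eta> i * \<eta> j)"

lemma qform_shift:
  fixes C :: "'n::finite \<Rightarrow> 'n \<Rightarrow> real"
  assumes "\<And>i j. C i j = C j i"
  shows "qform C (\<lambda>j. \<eta> j + (if j = i then s else 0)) = qform C \<eta> + 2 * s * (\<Sum>j\<in>UNIV. C i j * \<eta> j) + s\<^sup>2 * C i i"
proof -
  let ?e = "\<lambda>j. if j = i then s else 0"
  have "qform C (\<lambda>j. \<eta> j + ?e j) = qform C \<eta> + (\<Sum>k\<in>UNIV. \<Sum>j\<in>UNIV. C k j * \<eta> k * ?e j)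
      + (\<Sum>k\<in>UNIV. \<Sum>j\<in>UNIV. C k j * ?e k * \<eta> j) + (\<Sum>k\<in>UNIV. \<Sum>j\<in>UNIV. C k j * ?e k * ?e j)"
    unfolding qform_def sum.distrib[symmetric] by (intro sum.cong refl) (simp only: algebra_simps)
  also have "(\<Sum>k\<in>UNIV. \<Sum>j\<in>UNIV. C k j * \<eta> k * ?e j) = s * (\<Sum>j\<in>UNIV. C i j * \<eta> j)"
    using assms by (simp add: if_distrib[of "\<lambda>x. _ * x"] sum_distrib_left mult_ac cong: if_cong)
  also have "(\<Sum>k\<in>UNIV. \<Sum>j\<in>UNIV. C k j * ?e k * \<eta> j) = s * (\<Sum>j\<in>UNIV. C i j * \<eta> j)"
  proof -
    have "(\<Sum>k\<in>UNIV. \<Sum>j\<in>UNIV. C k j * ?e k * \<eta> j) = (\<Sum>k\<in>UNIV. if k = i then \<Sum>j\<in>UNIV. C k j * s * \<eta> j else 0)"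
      by (intro sum.cong) auto
    then show ?thesis by (simp add: sum_distrib_left mult_ac)
  qed
  also have "(\<Sum>k\<in>UNIV. \<Sum>j\<in>UNIV. C k j * ?e k * ?e j) = s\<^sup>2 * C i i"
  proof -
    have "(\<Sum>k\<in>UNIV. \<Sum>j\<in>UNIV. C k j * ?e k * ?e j) = (\<Sum>k\<in>UNIV. C k i * s * ?e k)"
      by (intro sum.cong refl) (simp add: if_distrib[of "\<lambda>x. _ * x"] mult_ac cong: if_cong)
    also have "\<dots> = C i i * s * s" by (simp add: if_distrib[of "\<lambda>x. _ * x"] cong: if_cong)
    finally show ?thesis by (simp add: power2_eq_square mult_ac)
  qed
  finally show ?thesis by simp
qed

text \<open>Moving one coordinate by s turns the form into a polynomial in s of degree at most two
  that is never negative, and the claims are the resulting conditions on its coefficients. For a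
  zero pivot the quotient in the third claim is 0 by the convention for division.\<close>

lemma psd_pivot:
  fixes C :: "'n::finite \<Rightarrow> 'n \<Rightarrow> real"
  assumes sym: "\<And>i j. C i j = C j i" and psd: "\<And>\<eta>. 0 \<le> qform C \<eta>"
  shows "0 \<le> C i i" "C i i = 0 \<Longrightarrow> C i j = 0"
    "(\<Sum>j\<in>UNIV. C i j * \<eta> j)\<^sup>2 / C i i \<le> qform C \<eta>"
proof -
  have sh: "0 \<le> qform C \<eta> + 2 * s * (\<Sum>j\<in>UNIV. C i j * \<eta> j) + s\<^sup>2 * C i i" for s \<eta>
    using qform_shift[of C, OF sym, of \<eta> i s] psd by metis
  have "qform C (\<lambda>_. 0) = 0" by (simp add: qform_def)
  then show ii: "0 \<le> C i i" using sh[where \<eta> = "\<lambda>_. 0" and s = 1] by simp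
  have zero: "(\<Sum>j\<in>UNIV. C i j * \<eta> j) = 0" if "C i i = 0" for \<eta>
  proof (rule ccontr)
    let ?b = "\<Sum>j\<in>UNIV. C i j * \<eta> j"
    assume b: "?b \<noteq> 0"
    \<comment> \<open>Without a quadratic term this shift would give the value -q - 2 for q =
      \<open>qform C \<eta>\<close>.\<close>
    have "0 \<le> qform C \<eta> + 2 * (- (qform C \<eta> + 1) / ?b) * ?b + (- (qform C \<eta> + 1) / ?b)\<^sup>2 * C i i"
      by (rule sh)
    then show False using that b psd[of \<eta>] by simp
  qed
  show "C i j = 0" if "C i i = 0"
    using zero[OF that, of "\<lambda>k. if k = j then 1 else 0"] by (simp add: if_distrib[of "\<lambda>x. _ * x"] cong: if_cong)
  show "(\<Sum>j\<in>UNIV. C i j * \<eta> j)\<^sup>2 / C i i \<le> qform C \<eta>"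
  proof (cases "C i i = 0")
    case True
    then show ?thesis using psd by simp
  next
    case False
    let ?b = "\<Sum>j\<in>UNIV. C i j * \<eta> j"
    have "0 \<le> qform C \<eta> + 2 * (- ?b / C i i) * ?b + (- ?b / C i i)\<^sup>2 * C i i" by (rule sh)
    also have "\<dots> = qform C \<eta> - ?b\<^sup>2 / C i i" using False by (simp add: power2_eq_square field_simps)
    finally show ?thesis by simp
  qed
qed

text \<open>Symmetric Gaussian elimination, one index at a time. Every entry of \<sigma> is an
  explicit formula in the entries of C, so measurability in t is inherited, whereas eigenvectors
  would call for a measurable choice.\<close>

lemma psd_square_decomposition:
  fixes C :: "real \<Rightarrow> 'n::finite \<Rightarrow> 'n \<Rightarrow> real"
  assumes "\<And>t i j. C t i j = C t j i" "\<And>t \<eta>. 0 \<le> qform (C t) \<eta>" "\<And>i j. (\<lambda>t. C t i j) \<in> borel_measurable borel"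
  shows "\<exists>\<sigma> :: 'n \<Rightarrow> real \<Rightarrow> 'n \<Rightarrow> real. (\<forall>l i. (\<lambda>t. \<sigma> l t i) \<in> borel_measurable borel) \<and> (\<forall>t i j. C t i j = (\<Sum>l\<in>UNIV. \<sigma> l t i * \<sigma> l t j))"
proof -
  have "\<exists>\<sigma>. (\<forall>l i. (\<lambda>t. \<sigma> l t i) \<in> borel_measurable borel) \<and> (\<forall>t i j. C t i j = (\<Sum>l\<in>A. \<sigma> l t i * \<sigma> l t j))"
    if "finite A" "\<And>t i j. C t i j = C t j i" "\<And>t \<eta>. 0 \<le> qform (C t) \<eta>" "\<And>i j. (\<lambda>t. C t i j) \<in> borel_measurable borel"
      "\<And>t i j. i \<notin> A \<Longrightarrow> C t i j = 0" for A :: "'n set" and C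
    using that
  proof (induction A arbitrary: C rule: finite_induct)
    case empty
    then show ?case by (intro exI[of _ "\<lambda>l t i. 0"]) auto
  next
    case (insert i A)
    note sym = insert.prems(1) and psd = insert.prems(2) and m[measurable] = insert.prems(3) and out = insert.prems(4)
    note piv = psd_pivot[of "C t" for t, OF sym psd]
    \<comment> \<open>Schur complement of the pivot i. If the pivot vanishes, the quotient is 0 and
      the row of i is zero already.\<close>
    define C' where "C' t j k = C t j k - C t i j * C t i k / C t i i" for t j k
    have "\<exists>\<sigma>. (\<forall>l i. (\<lambda>t. \<sigma> l t i) \<in> borel_measurable borel) \<and> (\<forall>t i j. C' t i j = (\<Sum>l\<in>A. \<sigma> l t i * \<sigma> l t j))"
    proof (rule insert.IH)
      show "C' t j k = C' t k j" for t j k using sym by (simp add: C'_def mult_ac)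
      show "(\<lambda>t. C' t j k) \<in> borel_measurable borel" for j k unfolding C'_def by measurable
      show "0 \<le> qform (C' t) \<eta>" for t \<eta>
      proof -
        have "qform (C' t) \<eta> = qform (C t) \<eta> - (\<Sum>j\<in>UNIV. C t i j * \<eta> j)\<^sup>2 / C t i i"
          unfolding qform_def C'_def power2_eq_square sum_product sum_divide_distrib sum_subtractf[symmetric]
          by (intro sum.cong refl) (simp add: algebra_simps)
        then show ?thesis using piv(3)[of t i \<eta>] by simp
      qed
      show "C' t j k = 0" if "j \<notin> A" for t j k
      proof (cases "j = i")
        case True
        then show ?thesis using piv(2)[of t i k] by (cases "C t i i = 0") (auto simp: C'_def)
      next
        case False
        then show ?thesis using out[of j t k] out[of j t i] sym[of t i j] that by (simp add: C'_def)
      qed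
    qed
    then obtain \<sigma> where \<sigma>: "\<And>l i. (\<lambda>t. \<sigma> l t i) \<in> borel_measurable borel" "\<And>t i j. C' t i j = (\<Sum>l\<in>A. \<sigma> l t i * \<sigma> l t j)" by blast
    \<comment> \<open>The pivot row over the root of the pivot supplies exactly the rank-one term
      removed in \<open>C'\<close>.\<close>
    define \<sigma>' where "\<sigma>' l t j = (if l = i then C t i j / sqrt (C t i i) else \<sigma> l t j)" for l t j
    have "(\<lambda>t. \<sigma>' l t j) \<in> borel_measurable borel" for l j
      using \<sigma>(1) by (cases "l = i") (auto simp: \<sigma>'_def)
    moreover have "C t j k = (\<Sum>l\<in>insert i A. \<sigma>' l t j * \<sigma>' l t k)" for t j k
    proof -
      have "(\<Sum>l\<in>A. \<sigma>' l t j * \<sigma>' l t k) = C' t j k"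
        unfolding \<sigma>(2) using insert.hyps by (intro sum.cong) (auto simp: \<sigma>'_def)
      moreover have "\<sigma>' i t j * \<sigma>' i t k = C t i j * C t i k / C t i i"
        using piv(1)[of t i] by (simp add: \<sigma>'_def)
      ultimately show ?thesis using insert.hyps by (simp add: C'_def)
    qed
    ultimately show ?case by blast
  qed
  from this[of UNIV C] assms show ?thesis by simp
qed

subsection \<open>The time-discretized equation\<close>

lemma lp_int_Fubini:
  fixes G :: "'a::euclidean_space \<times> 'b::euclidean_space \<Rightarrow> real"
  assumes [measurable]: "G \<in> borel_measurable borel"
  shows "lp_int p G = (\<integral>\<^sup>+t. lp_int p (\<lambda>x. G (t, x)) \<partial>lborel)"
    and "(\<lambda>t. lp_int p (\<lambda>x. G (t, x))) \<in> borel_measurable borel"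
proof -
  have G: "G \<in> borel_measurable (borel \<Otimes>\<^sub>M borel)" by (simp add: borel_prod)
  have m: "(\<lambda>z. ennreal (\<bar>G z\<bar> powr p)) \<in> borel_measurable (lborel \<Otimes>\<^sub>M lborel)"
    using G by (simp add: lborel_prod)
  show "lp_int p G = (\<integral>\<^sup>+t. lp_int p (\<lambda>x. G (t, x)) \<partial>lborel)"
    unfolding lp_int_def using lborel.nn_integral_fst[OF m] by (simp add: lborel_prod)
  have "(\<lambda>(t, x). ennreal (\<bar>G (t, x)\<bar> powr p)) \<in> borel_measurable (borel \<Otimes>\<^sub>M lborel)"
    using G by (simp add: split_beta' cong: measurable_cong_sets) (measurable)
  then show "(\<lambda>t. lp_int p (\<lambda>x. G (t, x))) \<in> borel_measurable borel"
    unfolding lp_int_def by (rule lborel.borel_measurable_nn_integral)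
qed

lemma lp_int_zero: "(\<And>x. g x = 0) \<Longrightarrow> lp_int p g = 0"
  by (simp add: lp_int_def)

text \<open>For fixed t the values of u at the times t + k d solve the scheme with the residual g as
  source. The jump estimate is applied on this time lattice and then integrated over t in an
  interval of length d, which exhausts space-time.\<close>

lemma split_step_estimate:
  fixes u g :: "real \<times> 'v::euclidean_space \<Rightarrow> real" and s :: "real \<Rightarrow> 'y \<Rightarrow> 'v"
  assumes reg: "lp_regular p M e (\<lambda>n. avg3 e)" and p: "1 < p" and M: "0 \<le> M" and Y: "finite Y" "Y \<noteq> {}" and d: "0 < d"
    and um[measurable]: "u \<in> borel_measurable borel" and supp: "\<And>z. R < norm z \<Longrightarrow> u z = 0"
    and gm[measurable]: "g \<in> borel_measurable borel"
    and g: "\<And>t x. g (t, x) = u (t, x) - jump_avg Y (s t) (avg3 e (\<lambda>x. u (t + d, x))) x"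
  shows "lp_int p (sdiff (0, e) u) \<le> ennreal M * lp_int p g"
proof -
  have [measurable]: "(\<lambda>x. u (t, x)) \<in> borel_measurable borel" "(\<lambda>x. g (t, x)) \<in> borel_measurable borel" for t
    by (rule measurable_compose[OF _ um], simp add: borel_prod[symmetric])
       (rule measurable_compose[OF _ gm], simp add: borel_prod[symmetric])
  define G1 where "G1 t = lp_int p (sdiff e (\<lambda>x. u (t, x)))" for t
  define G2 where "G2 t = lp_int p (\<lambda>x. g (t, x))" for t
  have sd: "(\<lambda>x. sdiff (0, e) u (t, x)) = sdiff e (\<lambda>x. u (t, x))" for t
    by (simp add: sdiff_def fun_eq_iff)
  have G1: "lp_int p (sdiff (0, e) u) = (\<integral>\<^sup>+t. G1 t \<partial>lborel)" and [measurable]: "G1 \<in> borel_measurable borel"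
    using lp_int_Fubini[of "sdiff (0, e) u" p] unfolding sd G1_def by auto
  have G2: "lp_int p g = (\<integral>\<^sup>+t. G2 t \<partial>lborel)" and [measurable]: "G2 \<in> borel_measurable borel"
    using lp_int_Fubini[of g p] unfolding G2_def by auto
  have u0: "u (t, x) = 0" if "R < \<bar>t\<bar> \<or> R < norm x" for t x
    using supp[of "(t, x)"] norm_fst_le[of t x] norm_snd_le[of x t] that by auto
  have main: "(\<integral>\<^sup>+k. G1 (t + of_int k *\<^sub>R d) \<partial>count_space (UNIV :: int set))
     \<le> (\<integral>\<^sup>+k. ennreal M * G2 (t + of_int k *\<^sub>R d) \<partial>count_space (UNIV :: int set))" for t
  proof -
    define N where "N = nat \<lceil>(\<bar>R\<bar> + \<bar>t\<bar>) / d\<rceil> + 1"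
    have "(\<bar>R\<bar> + \<bar>t\<bar>) / d < real N" unfolding N_def by linarith
    then have N: "\<bar>R\<bar> + \<bar>t\<bar> < N * d" using d by (simp add: divide_less_eq)
    have far: "R < \<bar>t + of_int k * d\<bar>" if "int N \<le> \<bar>k\<bar>" for k
    proof -
      have "real N * d \<le> \<bar>of_int k\<bar> * d" using that d by (intro mult_right_mono) linarith+
      also have "\<dots> = \<bar>of_int k * d\<bar>" using d by (simp add: abs_mult)
      finally show ?thesis using N by linarith
    qed
    \<comment> \<open>Time is reversed: step 0 is the latest time, where u vanishes, and larger n
      means earlier.\<close>
    define \<tau> where "\<tau> n = t + (real N - real n) * d" for n
    have \<tau>S: "\<tau> (Suc n) + d = \<tau> n" for n by (simp add: \<tau>_def algebra_simps)
    define v where "v n x = u (\<tau> n, x)" for n x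
    define f where "f n = (case n of 0 \<Rightarrow> v 0 | Suc k \<Rightarrow> if k < 2 * N then (\<lambda>x. g (\<tau> n, x)) else (\<lambda>x. 0))" for n
    \<comment> \<open>Step n leads to the time \<tau> (n + 1), and the residual there uses the jumps
      of that same time; hence the shifted index.\<close>
    define A where "A = (\<lambda>n. if n < 2 * N then jump_avg Y (s (\<tau> (Suc n))) \<circ> avg3 e else avg3 e)"
    have A: "lp_regular p M e A" unfolding A_def by (rule lp_regular_jumps[OF reg p Y])
    have sol: "sol A f n = v n" if "n \<le> 2 * N" for n
      using that
    proof (induction n)
      case (Suc n)
      then have IH: "sol A f n = v n" by simp
      have "(\<lambda>x. u (\<tau> (Suc n) + d, x)) = v n" by (simp add: \<tau>S v_def[abs_def])
      moreover have "A n = jump_avg Y (s (\<tau> (Suc n))) \<circ> avg3 e" "f (Suc n) = (\<lambda>x. g (\<tau> (Suc n), x))"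
        using Suc.prems by (simp_all add: A_def f_def)
      ultimately have "sol A f (Suc n) x = v (Suc n) x" for x
        by (simp add: IH g v_def[of "Suc n"])
      then show ?case by (rule ext)
    qed (simp add: f_def)
    have fm: "f n \<in> borel_measurable borel" for n
      by (auto simp: f_def v_def[abs_def] split: nat.split)
    \<comment> \<open>Finitely many times and jumps are involved, so their reach is finite; its size
      does not affect M.\<close>
    define R' where "R' = \<bar>R\<bar> + norm e + (\<Sum>n\<le>2 * N. \<Sum>y\<in>Y. norm (s (\<tau> n) y))"
    have R'0: "R \<le> R'" unfolding R'_def by (smt (verit) norm_ge_zero sum_nonneg)
    have fsupp: "f n x = 0" if x: "R' < norm x" for n x
    proof (cases n)
      case 0
      then show ?thesis using x R'0 u0 by (simp add: f_def v_def)
    next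
      case (Suc k)
      show ?thesis
      proof (cases "k < 2 * N")
        case True
        have jump: "norm (s (\<tau> n) y) + norm e < norm x - R" if "y \<in> Y" for y
        proof -
          have "norm (s (\<tau> n) y) \<le> (\<Sum>y\<in>Y. norm (s (\<tau> n) y))"
            using that Y(1) by (intro member_le_sum) auto
          also have "\<dots> \<le> (\<Sum>n\<le>2 * N. \<Sum>y\<in>Y. norm (s (\<tau> n) y))"
            using True Suc by (intro member_le_sum[where f = "\<lambda>n. \<Sum>y\<in>Y. norm (s (\<tau> n) y)"]) (auto intro: sum_nonneg)
          finally show ?thesis using x unfolding R'_def by linarith
        qed
        have "avg3 e (\<lambda>x. u (\<tau> n + d, x)) (x + s (\<tau> n) y) = 0" if y: "y \<in> Y" for y
        proof -
          have "R < norm (x + s (\<tau> n) y)" "R < norm (x + s (\<tau> n) y + e)" "R < norm (x + s (\<tau> n) y - e)"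
            using jump[OF y] by norm+
          then show ?thesis by (simp add: avg3_def u0)
        qed
        then have "g (\<tau> n, x) = 0" using x R'0 by (simp add: g jump_avg_def u0)
        then show ?thesis using True Suc by (simp add: f_def)
      qed (simp add: f_def Suc)
    qed
    have bij: "(\<Sum>n\<le>2 * N. h (\<tau> n)) = (\<Sum>k\<in>{-int N..int N}. h (t + of_int k * d))" for h :: "real \<Rightarrow> ennreal"
      by (rule sum.reindex_bij_witness[of _ "\<lambda>k. nat (int N - k)" "\<lambda>n. int N - int n"]) (auto simp: \<tau>_def)
    have "(\<integral>\<^sup>+k. G1 (t + of_int k *\<^sub>R d) \<partial>count_space (UNIV :: int set)) = (\<Sum>k\<in>{-int N..int N}. G1 (t + of_int k *\<^sub>R d))"
    proof (rule nn_integral_count_space')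
      fix k :: int assume "k \<notin> {-int N..int N}"
      then have "R < \<bar>t + of_int k * d\<bar>" by (intro far) auto
      then show "G1 (t + of_int k *\<^sub>R d) = 0" unfolding G1_def by (intro lp_int_zero) (simp add: sdiff_def u0)
    qed auto
    also have "\<dots> = (\<Sum>n\<le>2 * N. lp_int p (sdiff e (sol A f n)))"
      using bij[of G1] by (simp add: G1_def sol v_def[abs_def])
    also have "\<dots> \<le> ennreal M * (\<Sum>n\<le>2 * N. lp_int p (f n))"
      using A[unfolded lp_regular_def] fm fsupp by blast
    also have "\<dots> \<le> ennreal M * (\<Sum>n\<le>2 * N. G2 (\<tau> n))"
    proof (intro mult_left_mono sum_mono)
      fix n assume n: "n \<in> {..2 * N}"
      show "lp_int p (f n) \<le> G2 (\<tau> n)"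
      proof (cases n)
        case 0
        have "R < \<bar>\<tau> 0\<bar>" using far[of "int N"] by (simp add: \<tau>_def)
        then have "lp_int p (f n) = 0" using 0 by (intro lp_int_zero) (simp add: f_def v_def u0)
        then show ?thesis by simp
      next
        case (Suc k)
        then show ?thesis using n by (simp add: f_def G2_def)
      qed
    qed simp
    also have "\<dots> = (\<Sum>k\<in>{-int N..int N}. ennreal M * G2 (t + of_int k * d))"
      unfolding bij by (simp add: sum_distrib_left)
    also have "\<dots> = (\<integral>\<^sup>+k. ennreal M * G2 (t + of_int k *\<^sub>R d) * indicator {-int N..int N} k \<partial>count_space (UNIV :: int set))"
      by (subst nn_integral_count_space'[of "{-int N..int N}"]) (auto simp: indicator_def)
    also have "\<dots> \<le> (\<integral>\<^sup>+k. ennreal M * G2 (t + of_int k *\<^sub>R d) \<partial>count_space (UNIV :: int set))"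
      by (intro nn_integral_mono) (auto simp: indicator_def)
    finally show ?thesis .
  qed
  have "lp_int p (sdiff (0, e) u) = (\<integral>\<^sup>+t. (\<integral>\<^sup>+k. G1 (t + of_int k *\<^sub>R d) \<partial>count_space UNIV)
    * indicator {x. 0 \<le> x \<bullet> d \<and> x \<bullet> d < d \<bullet> d} t \<partial>lborel)"
    unfolding G1 by (rule nn_integral_lborel_lattice) (use d in auto)
  also have "\<dots> \<le> (\<integral>\<^sup>+t. (\<integral>\<^sup>+k. ennreal M * G2 (t + of_int k *\<^sub>R d) \<partial>count_space UNIV)
    * indicator {x. 0 \<le> x \<bullet> d \<and> x \<bullet> d < d \<bullet> d} t \<partial>lborel)"
    by (intro nn_integral_mono mult_right_mono main) simp
  also have "\<dots> = (\<integral>\<^sup>+t. ennreal M * G2 t \<partial>lborel)"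
    by (rule nn_integral_lborel_lattice[symmetric]) (use d in auto)
  also have "\<dots> = ennreal M * lp_int p g"
    unfolding G2 by (rule nn_integral_cmult) simp
  finally show ?thesis .
qed

subsection \<open>Passage to the limit\<close>

text \<open>The base point w n is allowed to move because in the scheme the difference is taken
  after a jump. The Lagrange points also tend to z, so continuity of the second derivative
  suffices.\<close>

lemma sdiff_quotient_tendsto:
  fixes u :: "'a::euclidean_space \<Rightarrow> real"
  assumes u: "smooth u" and h: "h \<longlonglongrightarrow> 0" "\<And>n. h n \<noteq> 0" and w: "w \<longlonglongrightarrow> z"
  shows "(\<lambda>n. sdiff (h n *\<^sub>R v) u (w n) / (h n)\<^sup>2) \<longlonglongrightarrow> pderiv v (pderiv v u) z"
proof -
  let ?D = "pderiv v (pderiv v u)"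
  have "\<exists>t1 t2. \<bar>t1\<bar> \<le> \<bar>h n\<bar> \<and> \<bar>t2\<bar> \<le> \<bar>h n\<bar> \<and> sdiff (h n *\<^sub>R v) u (w n) = (h n)\<^sup>2 / 2 * (?D (w n + t1 *\<^sub>R v) + ?D (w n + t2 *\<^sub>R v))" for n
    using second_difference_mean[OF u, of "h n" "w n" v] unfolding sdiff_def by metis
  then obtain t1 t2 where t: "\<And>n. \<bar>t1 n\<bar> \<le> \<bar>h n\<bar>" "\<And>n. \<bar>t2 n\<bar> \<le> \<bar>h n\<bar>"
    "\<And>n. sdiff (h n *\<^sub>R v) u (w n) = (h n)\<^sup>2 / 2 * (?D (w n + t1 n *\<^sub>R v) + ?D (w n + t2 n *\<^sub>R v))"
    by metis
  have h': "(\<lambda>n. \<bar>h n\<bar>) \<longlonglongrightarrow> 0" using tendsto_rabs[OF h(1)] by simp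
  have lim: "x \<longlonglongrightarrow> 0" if "\<And>n. \<bar>x n\<bar> \<le> \<bar>h n\<bar>" for x :: "nat \<Rightarrow> real"
    by (rule Lim_null_comparison[OF _ h']) (use that in auto)
  have D: "(\<lambda>n. ?D (w n + x n *\<^sub>R v)) \<longlonglongrightarrow> ?D z" if "\<And>n. \<bar>x n\<bar> \<le> \<bar>h n\<bar>" for x :: "nat \<Rightarrow> real"
  proof (rule isCont_tendsto_compose[OF smooth_continuous[OF smooth_pderiv[OF smooth_pderiv[OF u]]]])
    have "(\<lambda>n. w n + x n *\<^sub>R v) \<longlonglongrightarrow> z + 0 *\<^sub>R v" by (intro tendsto_intros w lim that)
    then show "(\<lambda>n. w n + x n *\<^sub>R v) \<longlonglongrightarrow> z" by simp
  qed
  have "(\<lambda>n. (?D (w n + t1 n *\<^sub>R v) + ?D (w n + t2 n *\<^sub>R v)) / 2) \<longlonglongrightarrow> (?D z + ?D z) / 2"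
    by (intro tendsto_intros D t) simp
  moreover have "(\<lambda>n. sdiff (h n *\<^sub>R v) u (w n) / (h n)\<^sup>2) = (\<lambda>n. (?D (w n + t1 n *\<^sub>R v) + ?D (w n + t2 n *\<^sub>R v)) / 2)"
    using h(2) by (auto simp: t(3))
  ultimately show ?thesis by (simp only: field_sum_of_halves add_divide_distrib)
qed

lemma sdiff_quotient_bound:
  assumes "smooth u" "h \<noteq> 0" "\<And>z. \<bar>pderiv v (pderiv v u) z\<bar> \<le> B"
  shows "\<bar>sdiff (h *\<^sub>R v) u z / h\<^sup>2\<bar> \<le> B"
proof -
  obtain t1 t2 where "sdiff (h *\<^sub>R v) u z = h\<^sup>2 / 2 * (pderiv v (pderiv v u) (z + t1 *\<^sub>R v) + pderiv v (pderiv v u) (z + t2 *\<^sub>R v))"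
    using second_difference_mean[OF assms(1), of h z v] unfolding sdiff_def by metis
  then have eq: "sdiff (h *\<^sub>R v) u z / h\<^sup>2 = (pderiv v (pderiv v u) (z + t1 *\<^sub>R v) + pderiv v (pderiv v u) (z + t2 *\<^sub>R v)) / 2"
    using assms(2) by simp
  show ?thesis unfolding eq using assms(3)[of "z + t1 *\<^sub>R v"] assms(3)[of "z + t2 *\<^sub>R v"]
    unfolding abs_le_iff by (simp add: field_simps)
qed

lemma diff_quotient_tendsto:
  fixes u :: "'a::euclidean_space \<Rightarrow> real"
  assumes u: "smooth u" and h: "h \<longlonglongrightarrow> 0" "\<And>n. h n \<noteq> 0" and w: "w \<longlonglongrightarrow> z"
  shows "(\<lambda>n. (u (w n + h n *\<^sub>R v) - u (w n)) / h n) \<longlonglongrightarrow> pderiv v u z"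
proof -
  have "\<exists>t. \<bar>t\<bar> \<le> \<bar>h n\<bar> \<and> u (w n + h n *\<^sub>R v) = u (w n) + h n * pderiv v u (w n + t *\<^sub>R v)" for n
    using mean_value_line[OF u, of "h n" "w n" v] by metis
  then obtain t where t: "\<And>n. \<bar>t n\<bar> \<le> \<bar>h n\<bar>" "\<And>n. u (w n + h n *\<^sub>R v) = u (w n) + h n * pderiv v u (w n + t n *\<^sub>R v)"
    by metis
  have h': "(\<lambda>n. \<bar>h n\<bar>) \<longlonglongrightarrow> 0" using tendsto_rabs[OF h(1)] by simp
  have "t \<longlonglongrightarrow> 0" by (rule Lim_null_comparison[OF _ h']) (use t in auto)
  then have "(\<lambda>n. w n + t n *\<^sub>R v) \<longlonglongrightarrow> z + 0 *\<^sub>R v" by (intro tendsto_intros w)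
  then have "(\<lambda>n. pderiv v u (w n + t n *\<^sub>R v)) \<longlonglongrightarrow> pderiv v u z"
    by (intro isCont_tendsto_compose[OF smooth_continuous[OF smooth_pderiv[OF u]]]) simp
  then show ?thesis using h(2) by (simp add: t(2))
qed

lemma diff_quotient_bound:
  assumes "smooth u" "h \<noteq> 0" "\<And>z. \<bar>pderiv v u z\<bar> \<le> B"
  shows "\<bar>(u (z + h *\<^sub>R v) - u z) / h\<bar> \<le> B"
proof -
  obtain t where "u (z + h *\<^sub>R v) = u z + h * pderiv v u (z + t *\<^sub>R v)"
    using mean_value_line[OF assms(1), of h z v] by metis
  then show ?thesis using assms(2,3) by simp
qed

text \<open>Expansion in an orthonormal basis makes the bound quadratic in y and uniform in z, as
  required for directions \<sigma> l t that vary with time.\<close>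

lemma pderiv2_bound:
  fixes u :: "real \<times> 'v::euclidean_space \<Rightarrow> real"
  assumes "C0_infty u"
  obtains B where "0 \<le> B" "\<And>y z. \<bar>pderiv (0, y) (pderiv (0, y) u) z\<bar> \<le> B * (norm y)\<^sup>2"
proof -
  let ?D = "\<lambda>b b'. pderiv (0, b) (pderiv (0, b') u)"
  have "\<exists>B>0. \<forall>z. \<bar>?D b b' z\<bar> \<le> B" for b b'
    using C0_infty_bounded[OF C0_infty_pderiv[OF C0_infty_pderiv[OF assms]]] by metis
  then obtain C where C: "\<And>b b'. 0 < C b b'" "\<And>b b' z. \<bar>?D b b' z\<bar> \<le> C b b'" by metis
  define B where "B = (\<Sum>b\<in>Basis. \<Sum>b'\<in>(Basis :: 'v set). C b b')"
  have "\<bar>?D y y z\<bar> \<le> B * (norm y)\<^sup>2" for y z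
  proof -
    have y: "(0, y) = (\<Sum>b\<in>Basis. (y \<bullet> b) *\<^sub>R ((0::real), b))"
      by (simp add: prod_eq_iff fst_sum snd_sum euclidean_representation)
    have "\<bar>?D y y z\<bar> = \<bar>\<Sum>b\<in>Basis. \<Sum>b'\<in>Basis. (y \<bullet> b) * (y \<bullet> b') * ?D b b' z\<bar>"
      unfolding y by (subst pderiv2_sum_direction[OF C0_infty_smooth[OF assms]]) auto
    also have "\<dots> \<le> (\<Sum>b\<in>Basis. \<Sum>b'\<in>Basis. \<bar>(y \<bullet> b) * (y \<bullet> b') * ?D b b' z\<bar>)"
      by (intro order_trans[OF sum_abs] sum_mono order_refl)
    also have "\<dots> \<le> (\<Sum>b\<in>Basis. \<Sum>b'\<in>Basis. C b b' * (norm y)\<^sup>2)"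
    proof (intro sum_mono)
      fix b b' :: 'v assume b: "b \<in> Basis" "b' \<in> Basis"
      have "\<bar>(y \<bullet> b) * (y \<bullet> b') * ?D b b' z\<bar> = (\<bar>y \<bullet> b\<bar> * \<bar>y \<bullet> b'\<bar>) * \<bar>?D b b' z\<bar>" by (simp add: abs_mult)
      also have "\<dots> \<le> (norm y * norm y) * C b b'"
        using b C by (intro mult_mono Basis_le_norm) auto
      finally show "\<bar>(y \<bullet> b) * (y \<bullet> b') * ?D b b' z\<bar> \<le> C b b' * (norm y)\<^sup>2" by (simp add: power2_eq_square mult_ac)
    qed
    finally show ?thesis by (simp add: B_def sum_distrib_right)
  qed
  moreover have "0 \<le> B" unfolding B_def using C(1) by (intro sum_nonneg) (auto intro: less_imp_le)
  ultimately show ?thesis using that by blast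
qed

lemma lp_int_cmult:
  fixes g :: "'a::euclidean_space \<Rightarrow> real"
  assumes [measurable]: "g \<in> borel_measurable borel"
  shows "lp_int p (\<lambda>x. k * g x) = ennreal (\<bar>k\<bar> powr p) * lp_int p g"
  unfolding lp_int_def by (simp add: abs_mult powr_mult ennreal_mult nn_integral_cmult)

lemma lp_int_mono:
  assumes "\<And>x. \<bar>f x\<bar> \<le> \<bar>g x\<bar>" "0 \<le> p"
  shows "lp_int p f \<le> lp_int p g"
  unfolding lp_int_def using assms by (intro nn_integral_mono ennreal_leI powr_mono2) auto

lemma cball_majorant:
  fixes k r :: real
  defines "w \<equiv> (\<lambda>z::'a::euclidean_space. ennreal k * indicator (cball 0 r) z)"
  shows "w \<in> borel_measurable lborel" "(\<integral>\<^sup>+z. w z \<partial>lborel) < \<infinity>"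
proof -
  show "w \<in> borel_measurable lborel" unfolding w_def measurable_lborel2
    by (intro borel_measurable_times_ennreal borel_measurable_const borel_measurable_indicator borel_closed closed_cball)
  have "(\<integral>\<^sup>+z. w z \<partial>lborel) = ennreal k * emeasure lborel (cball (0 :: 'a) r)"
    unfolding w_def by (rule nn_integral_cmult_indicator) simp
  also have "\<dots> < \<infinity>"
    using emeasure_bounded_finite[OF bounded_cball[of "0 :: 'a" r]] by (simp add: ennreal_mult_less_top)
  finally show "(\<integral>\<^sup>+z. w z \<partial>lborel) < \<infinity>" .
qed

text \<open>The residual of the scheme divided by the time step is a consistent approximation of the
  operator, so the discrete estimate survives the limit. The local bound on \<sigma> provides
  domination and stays out of the constant.\<close>

lemma parabolic_direction_estimate:
  fixes u :: "real \<times> 'v::euclidean_space \<Rightarrow> real" and \<sigma> :: "'l \<Rightarrow> real \<Rightarrow> 'v"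
  assumes reg: "\<And>e::'v. e \<noteq> 0 \<Longrightarrow> lp_regular p M e (\<lambda>n. avg3 e)" and p: "1 < p" and M: "0 \<le> M"
    and u: "C0_infty u" and \<xi>: "\<xi> \<noteq> 0" and \<Lambda>: "finite \<Lambda>" "\<Lambda> \<noteq> {}"
    and \<sigma>m[measurable]: "\<And>l. \<sigma> l \<in> borel_measurable borel"
    and \<sigma>b: "\<And>r. \<exists>S. \<forall>l\<in>\<Lambda>. \<forall>t. \<bar>t\<bar> \<le> r \<longrightarrow> norm (\<sigma> l t) \<le> S"
  shows "lp_int p (pderiv (0, \<xi>) (pderiv (0, \<xi>) u)) \<le> ennreal M * lp_int p (\<lambda>z. pderiv (1, 0) u z
    + pderiv (0, \<xi>) (pderiv (0, \<xi>) u) z + (\<Sum>l\<in>\<Lambda>. pderiv (0, \<sigma> l (fst z)) (pderiv (0, \<sigma> l (fst z)) u) z))"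
proof -
  note su = C0_infty_smooth[OF u]
  have um: "u \<in> borel_measurable borel" by (rule smooth_measurable[OF su])
  define E where "E = ((0::real), \<xi>)"
  define D where "D = pderiv E (pderiv E u)"
  define f where "f z = pderiv (1, 0) u z + D z + (\<Sum>l\<in>\<Lambda>. pderiv (0, \<sigma> l (fst z)) (pderiv (0, \<sigma> l (fst z)) u) z)" for z
  define c where "c = card \<Lambda>"
  have c: "0 < c" using \<Lambda> by (simp add: c_def card_gt_0_iff)
  \<comment> \<open>One jump for each l and each sign, all equally likely; the two signs cancel the
    first-order terms.\<close>
  define Y where "Y = \<Lambda> \<times> (UNIV :: bool set)"
  have Y: "finite Y" "Y \<noteq> {}" "card Y = 2 * c" using \<Lambda> by (auto simp: Y_def c_def card_cartesian_product)
  define h where "h n = 1 / real (Suc n)" for n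
  \<comment> \<open>\<open>avg3\<close> adds a quarter of a second difference, so with this step the
    direction \<xi> enters with coefficient 1.\<close>
  define d where "d n = (h n)\<^sup>2 / 4" for n
  \<comment> \<open>Averaging over 2 c jumps and dividing by d must reproduce the full sum over l,
    which forces the square of the jump scale to be 2 c d.\<close>
  define \<kappa> where "\<kappa> n = h n * sqrt (c / 2)" for n
  have h: "0 < h n" "h n \<le> 1" for n by (auto simp: h_def)
  have d: "0 < d n" "d n \<le> 1" for n using h[of n] power_le_one[of "h n" 2] by (auto simp: d_def)
  have \<kappa>: "0 < \<kappa> n" "(\<kappa> n)\<^sup>2 = 2 * real c * d n" "\<kappa> n \<le> c" for n
  proof -
    show "0 < \<kappa> n" using h[of n] c by (simp add: \<kappa>_def)
    show "(\<kappa> n)\<^sup>2 = 2 * real c * d n" by (simp add: \<kappa>_def d_def power_mult_distrib)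
    have "real c / 2 \<le> real c * real c" using c mult_left_mono[of 1 "real c" "real c"] by simp
    then have "sqrt (c / 2) \<le> c" by (intro real_le_lsqrt) (auto simp: power2_eq_square)
    then have "h n * sqrt (c / 2) \<le> 1 * real c" using h[of n] by (intro mult_mono) auto
    then show "\<kappa> n \<le> c" by (simp add: \<kappa>_def)
  qed
  have h0: "h \<longlonglongrightarrow> 0" unfolding h_def[abs_def] using LIMSEQ_Suc[OF lim_1_over_n] by simp
  have d0: "d \<longlonglongrightarrow> 0" unfolding d_def[abs_def] using tendsto_divide[OF tendsto_power[OF h0, of 2] tendsto_const[of 4]] by simp
  have \<kappa>0: "\<kappa> \<longlonglongrightarrow> 0" unfolding \<kappa>_def[abs_def] using tendsto_mult[OF h0 tendsto_const[of "sqrt (c / 2)"]] by simp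
  define s where "s n t y = ((if snd y then 1 else - 1) * \<kappa> n) *\<^sub>R \<sigma> (fst y) t" for n t y
  define g where "g n z = u z - jump_avg Y (s n (fst z)) (avg3 (h n *\<^sub>R \<xi>) (\<lambda>x. u (fst z + d n, x))) (snd z)" for n z
  define a where "a n z = sdiff (h n *\<^sub>R E) u z / (h n)\<^sup>2" for n z
  \<comment> \<open>The sign makes this an approximation of the operator and not of its negative,
    since g is the present value minus the average of later ones.\<close>
  define b where "b n z = - g n z / d n" for n z
  have Ev: "h n *\<^sub>R E = (0, h n *\<^sub>R \<xi>)" for n by (simp add: E_def)
  have gm[measurable]: "g n \<in> borel_measurable borel" for n
  proof -
    have [measurable]: "u \<in> borel_measurable (borel \<Otimes>\<^sub>M borel)" using um by (simp add: borel_prod)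
    have "g n \<in> borel_measurable (borel \<Otimes>\<^sub>M borel)"
      unfolding g_def jump_avg_def avg3_def s_def by measurable
    then show ?thesis by (simp add: borel_prod)
  qed
  note um[measurable]
  have am[measurable]: "a n \<in> borel_measurable borel" for n
    unfolding a_def by measurable
  have bm[measurable]: "b n \<in> borel_measurable borel" for n
    unfolding b_def by measurable
  have Dm[measurable]: "D \<in> borel_measurable borel"
    unfolding D_def by (intro smooth_measurable smooth_pderiv su)

  \<comment> \<open>Exact splitting of the residual into difference quotients: the time increment
    and the second difference along \<xi> are taken after the jump, and the jump itself is compared
    with u at z.\<close>
  have b_eq: "b n z = (\<Sum>y\<in>Y. (u (z + (0, s n (fst z) y) + d n *\<^sub>R (1, 0)) - u (z + (0, s n (fst z) y))) / d n
      + a n (z + (0, s n (fst z) y) + d n *\<^sub>R (1, 0))) / (2 * real c)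
      + (\<Sum>l\<in>\<Lambda>. sdiff (\<kappa> n *\<^sub>R (0, \<sigma> l (fst z))) u z / (\<kappa> n)\<^sup>2)" for n z
  proof -
    let ?w = "\<lambda>y. z + (0, s n (fst z) y)"
    have av: "avg3 (h n *\<^sub>R \<xi>) (\<lambda>x. u (fst z + d n, x)) (snd z + s n (fst z) y)
      = u (?w y + d n *\<^sub>R (1, 0)) + d n * a n (?w y + d n *\<^sub>R (1, 0))" for y
      using h[of n] by (cases z) (simp add: avg3_def a_def sdiff_def Ev d_def field_simps)
    have two: "(\<Sum>y\<in>Y. u (?w y) - u z) = (\<Sum>l\<in>\<Lambda>. sdiff (\<kappa> n *\<^sub>R (0, \<sigma> l (fst z))) u z)"
    proof -
      have "(\<Sum>y\<in>Y. u (?w y) - u z) = (\<Sum>l\<in>\<Lambda>. \<Sum>bb\<in>(UNIV :: bool set). u (?w (l, bb)) - u z)"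
        unfolding Y_def by (simp add: sum.cartesian_product split_beta)
      also have "\<dots> = (\<Sum>l\<in>\<Lambda>. sdiff (\<kappa> n *\<^sub>R (0, \<sigma> l (fst z))) u z)"
        by (intro sum.cong refl) (simp add: UNIV_bool s_def sdiff_def minus_prod_def, cases z, simp)
      finally show ?thesis .
    qed
    have "b n z = ((\<Sum>y\<in>Y. u (?w y + d n *\<^sub>R (1, 0)) + d n * a n (?w y + d n *\<^sub>R (1, 0))) / (2 * real c) - u z) / d n"
      by (simp add: b_def g_def jump_avg_def av Y(3))
    also have "\<dots> = (\<Sum>y\<in>Y. (u (?w y + d n *\<^sub>R (1, 0)) + d n * a n (?w y + d n *\<^sub>R (1, 0)) - u z)) / (2 * real c * d n)"
      using c d[of n] by (simp add: sum_subtractf Y(3) field_simps)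
    also have "\<dots> = (\<Sum>y\<in>Y. d n * ((u (?w y + d n *\<^sub>R (1, 0)) - u (?w y)) / d n + a n (?w y + d n *\<^sub>R (1, 0))) + (u (?w y) - u z)) / (2 * real c * d n)"
      using d[of n] by (intro arg_cong2[where f = "(/)"] sum.cong refl) (simp add: field_simps)
    also have "\<dots> = (\<Sum>y\<in>Y. (u (?w y + d n *\<^sub>R (1, 0)) - u (?w y)) / d n + a n (?w y + d n *\<^sub>R (1, 0))) / (2 * real c) + (\<Sum>y\<in>Y. u (?w y) - u z) / (2 * real c * d n)"
      unfolding sum.distrib[of _ "\<lambda>y. u (?w y) - u z"] sum_distrib_left[symmetric] add_divide_distrib using d[of n] by simp
    finally show ?thesis unfolding two \<kappa>(2) by (simp add: sum_divide_distrib)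
  qed

  have b_lim: "(\<lambda>n. b n z) \<longlonglongrightarrow> f z" for z
  proof -
    have w: "(\<lambda>n. z + (0, s n (fst z) y)) \<longlonglongrightarrow> z" for y
    proof -
      have "(\<lambda>n. z + (0, ((if snd y then 1 else - 1) * \<kappa> n) *\<^sub>R \<sigma> (fst y) (fst z))) \<longlonglongrightarrow> z + (0, ((if snd y then 1 else - 1) * 0) *\<^sub>R \<sigma> (fst y) (fst z))"
        by (intro tendsto_intros \<kappa>0)
      then show ?thesis by (simp add: s_def flip: zero_prod_def)
    qed
    have w': "(\<lambda>n. z + (0, s n (fst z) y) + d n *\<^sub>R (1, 0)) \<longlonglongrightarrow> z" for y
    proof -
      have "(\<lambda>n. z + (0, s n (fst z) y) + d n *\<^sub>R (1, 0)) \<longlonglongrightarrow> z + 0 *\<^sub>R (1, 0)"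
        by (intro tendsto_intros w d0)
      then show ?thesis by (simp flip: zero_prod_def)
    qed
    have nz: "h n \<noteq> 0" "d n \<noteq> 0" "\<kappa> n \<noteq> 0" for n using h[of n] d[of n] \<kappa>(1)[of n] by auto
    have "(\<lambda>n. b n z) \<longlonglongrightarrow> (\<Sum>y\<in>Y. pderiv (1, 0) u z + D z) / (2 * real c) + (\<Sum>l\<in>\<Lambda>. pderiv (0, \<sigma> l (fst z)) (pderiv (0, \<sigma> l (fst z)) u) z)"
      unfolding b_eq a_def D_def
      by (intro tendsto_add tendsto_divide tendsto_sum tendsto_const sdiff_quotient_tendsto diff_quotient_tendsto su h0 d0 \<kappa>0 nz w w')
         (use c in auto)
    moreover have "(\<Sum>y\<in>Y. pderiv (1, 0) u z + D z) / (2 * real c) = pderiv (1, 0) u z + D z"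
      using c by (simp add: Y(3))
    ultimately show ?thesis by (simp only: f_def)
  qed
  have fm[measurable]: "f \<in> borel_measurable borel"
    by (rule borel_measurable_LIMSEQ_real[where u = b, OF b_lim bm])

  obtain R where R: "0 < R" "\<And>z. R < norm z \<Longrightarrow> u z = 0" using C0_infty_support[OF u] by blast
  have u0: "u (t, x) = 0" if "R < \<bar>t\<bar> \<or> R < norm x" for t x
    using R(2)[of "(t, x)"] norm_fst_le[of t x] norm_snd_le[of x t] that by auto
  \<comment> \<open>As d is at most 1 and u vanishes for |t| > R, the residual vanishes for |t| > R
    + 1, and a bound on this time interval is enough.\<close>
  obtain S where S': "\<forall>l\<in>\<Lambda>. \<forall>t. \<bar>t\<bar> \<le> R + 1 \<longrightarrow> norm (\<sigma> l t) \<le> S" using \<sigma>b[of "R + 1"] by (rule exE)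
  then have S: "norm (\<sigma> l t) \<le> S" if "l \<in> \<Lambda>" "\<bar>t\<bar> \<le> R + 1" for l t using that by blast
  obtain l0 where "l0 \<in> \<Lambda>" using \<Lambda>(2) by auto
  then have "norm (\<sigma> l0 0) \<le> S" using S[of l0 0] R(1) by simp
  then have S0: "0 \<le> S" using norm_ge_zero[of "\<sigma> l0 0"] by linarith
  obtain B1 where B1: "0 < B1" "\<And>z. \<bar>D z\<bar> \<le> B1"
    using C0_infty_bounded[OF C0_infty_pderiv[OF C0_infty_pderiv[OF u, of E], of E]] unfolding D_def by blast
  obtain B2 where B2: "0 < B2" "\<And>z. \<bar>pderiv (1, 0) u z\<bar> \<le> B2"
    using C0_infty_bounded[OF C0_infty_pderiv[OF u, of "(1, 0)"]] by blast
  obtain B3 where B3: "0 \<le> B3" "\<And>y z. \<bar>pderiv (0, y) (pderiv (0, y) u) z\<bar> \<le> B3 * (norm y)\<^sup>2"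
    using pderiv2_bound[OF u] by blast
  define B where "B = B2 + B1 + real c * (B3 * S\<^sup>2)"
  have B0: "0 \<le> B" using B1 B2 B3 by (simp add: B_def)
  \<comment> \<open>Reach of the residual: R + 1 in time; in space R, plus one walk step of length
    at most |\<xi>|, plus one jump of length at most c S.\<close>
  define r where "r = (R + 1) + (R + norm \<xi> + real c * S)"
  have b_supp: "b n z = 0" if z: "r < norm z" for n z
  proof -
    obtain t x where tx: "z = (t, x)" by (cases z)
    have "g n (t, x) = 0"
    proof (cases "R + 1 < \<bar>t\<bar>")
      case True
      then have "R < \<bar>t\<bar>" "R < \<bar>t + d n\<bar>" using d[of n] by auto
      then show ?thesis by (simp add: g_def jump_avg_def avg3_def u0)
    next
      case False
      then have "norm x > R + norm \<xi> + real c * S" using z norm_Pair_le[of t x] by (simp add: tx r_def)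
      moreover have "norm (s n t y) \<le> real c * S" if "y \<in> Y" for y
      proof -
        have "norm (s n t y) = \<kappa> n * norm (\<sigma> (fst y) t)" using \<kappa>(1)[of n] by (simp add: s_def abs_mult)
        also have "\<dots> \<le> real c * S" using \<kappa>(1,3)[of n] S[of "fst y" t] that False by (intro mult_mono) (auto simp: Y_def)
        finally show ?thesis .
      qed
      moreover have "norm (h n *\<^sub>R \<xi>) \<le> norm \<xi>" using h[of n] by (simp add: mult_left_le_one_le)
      ultimately have "u (t + d n, x + s n t y + e) = 0" "u (t, x) = 0" if "y \<in> Y" "e = 0 \<or> e = h n *\<^sub>R \<xi> \<or> e = - (h n *\<^sub>R \<xi>)" for y e
      proof -
        have ne: "norm e \<le> norm \<xi>" using that(2) \<open>norm (h n *\<^sub>R \<xi>) \<le> norm \<xi>\<close> by auto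
        have "norm x \<le> norm (x + s n t y + e) + norm (s n t y) + norm e" by norm
        then have "R < norm (x + s n t y + e)"
          using ne \<open>norm x > R + norm \<xi> + real c * S\<close> \<open>\<And>y. y \<in> Y \<Longrightarrow> norm (s n t y) \<le> real c * S\<close>[OF that(1)] by linarith
        then show "u (t + d n, x + s n t y + e) = 0" by (simp add: u0)
        have "R < norm x" using \<open>norm x > R + norm \<xi> + real c * S\<close> S0 norm_ge_zero[of \<xi>] by (smt (verit) mult_nonneg_nonneg of_nat_0_le_iff)
        then show "u (t, x) = 0" by (simp add: u0)
      qed note vanish = this
      have "avg3 (h n *\<^sub>R \<xi>) (\<lambda>x. u (t + d n, x)) (x + s n t y) = 0" if "y \<in> Y" for y
        using vanish(1)[OF that, of 0] vanish(1)[OF that, of "h n *\<^sub>R \<xi>"] vanish(1)[OF that, of "- (h n *\<^sub>R \<xi>)"]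
        by (simp add: avg3_def)
      moreover have "u (t, x) = 0" using vanish(2) Y(2) by blast
      ultimately show ?thesis by (simp add: g_def jump_avg_def)
    qed
    then show ?thesis by (simp add: b_def tx)
  qed
  have b_bound: "\<bar>b n z\<bar> \<le> B" for n z
  proof (cases "R + 1 < \<bar>fst z\<bar>")
    case True
    then have "R < \<bar>fst z\<bar>" "R < \<bar>fst z + d n\<bar>" using d[of n] by auto
    then have "g n z = 0" by (cases z) (simp add: g_def jump_avg_def avg3_def u0)
    then show ?thesis using B0 by (simp add: b_def)
  next
    case False
    have nz: "h n \<noteq> 0" "d n \<noteq> 0" "\<kappa> n \<noteq> 0" using h[of n] d[of n] \<kappa>(1)[of n] by auto
    have 1: "\<bar>(u (w + d n *\<^sub>R (1, 0)) - u w) / d n + a n w'\<bar> \<le> B2 + B1" for w w'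
    proof -
      have "\<bar>a n w'\<bar> \<le> B1" unfolding a_def by (intro sdiff_quotient_bound su nz B1(2)[unfolded D_def])
      moreover have "\<bar>(u (w + d n *\<^sub>R (1, 0)) - u w) / d n\<bar> \<le> B2" by (intro diff_quotient_bound su nz B2)
      ultimately show ?thesis using abs_triangle_ineq[of "(u (w + d n *\<^sub>R (1, 0)) - u w) / d n" "a n w'"] by linarith
    qed
    have 2: "\<bar>sdiff (\<kappa> n *\<^sub>R (0, \<sigma> l (fst z))) u z / (\<kappa> n)\<^sup>2\<bar> \<le> B3 * S\<^sup>2" if "l \<in> \<Lambda>" for l
    proof (intro sdiff_quotient_bound su nz order_trans[OF B3(2)] mult_left_mono B3(1) power_mono)
      show "norm (\<sigma> l (fst z)) \<le> S" using S[of l "fst z"] that False by simp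
    qed simp
    have "\<bar>b n z\<bar> \<le> \<bar>(\<Sum>y\<in>Y. (u (z + (0, s n (fst z) y) + d n *\<^sub>R (1, 0)) - u (z + (0, s n (fst z) y))) / d n
      + a n (z + (0, s n (fst z) y) + d n *\<^sub>R (1, 0))) / (2 * real c)\<bar> + \<bar>\<Sum>l\<in>\<Lambda>. sdiff (\<kappa> n *\<^sub>R (0, \<sigma> l (fst z))) u z / (\<kappa> n)\<^sup>2\<bar>"
      unfolding b_eq by (rule abs_triangle_ineq)
    also have "\<dots> \<le> (\<Sum>y\<in>Y. B2 + B1) / (2 * real c) + (\<Sum>l\<in>\<Lambda>. B3 * S\<^sup>2)"
      unfolding abs_divide using 2
      by (intro add_mono frac_le order_trans[OF sum_abs] sum_mono 1) (use c B1(1) B2(1) Y(3) in auto)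
    also have "\<dots> = B" using c by (simp add: B_def Y(3) c_def[symmetric])
    finally show ?thesis .
  qed

  define w where "w z = ennreal (B powr p) * indicator (cball 0 r) z" for z :: "real \<times> 'v"
  have lim_b: "(\<lambda>n. lp_int p (b n)) \<longlonglongrightarrow> lp_int p f"
    unfolding lp_int_def
  proof (rule nn_integral_dominated_convergence[where w = w])
    show "w \<in> borel_measurable lborel" "(\<integral>\<^sup>+z. w z \<partial>lborel) < \<infinity>"
      unfolding w_def[abs_def] by (rule cball_majorant)+
    show "AE z in lborel. ennreal (\<bar>b n z\<bar> powr p) \<le> w z" for n
    proof (rule AE_I2)
      fix z
      show "ennreal (\<bar>b n z\<bar> powr p) \<le> w z"
      proof (cases "r < norm z")
        case True
        then show ?thesis using b_supp p by simp
      next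
        case False
        then have "w z = ennreal (B powr p)" by (simp add: w_def)
        moreover have "\<bar>b n z\<bar> powr p \<le> B powr p" using b_bound[of n z] p by (intro powr_mono2) auto
        ultimately show ?thesis by (simp add: ennreal_leI)
      qed
    qed
    show "AE z in lborel. (\<lambda>n. ennreal (\<bar>b n z\<bar> powr p)) \<longlonglongrightarrow> ennreal (\<bar>f z\<bar> powr p)"
      using p by (intro AE_I2 tendsto_ennrealI tendsto_powr' tendsto_rabs b_lim) auto
  qed auto
  have le: "lp_int p (a n) \<le> ennreal M * lp_int p (b n)" for n
  proof -
    have 1: "lp_int p (sdiff (h n *\<^sub>R E) u) \<le> ennreal M * lp_int p (g n)"
      unfolding Ev
    proof (rule split_step_estimate[OF reg p M Y(1,2) d(1)[of n] um R(2) gm])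
      show "g n (t, x) = u (t, x) - jump_avg Y (s n t) (avg3 (h n *\<^sub>R \<xi>) (\<lambda>x. u (t + d n, x))) x" for t x
        by (simp add: g_def)
    qed (use \<xi> h[of n] in auto)
    have 2: "lp_int p (a n) = ennreal (\<bar>1 / (h n)\<^sup>2\<bar> powr p) * lp_int p (sdiff (h n *\<^sub>R E) u)"
      unfolding lp_int_cmult[OF sdiff_measurable[OF um], symmetric] by (simp add: a_def[abs_def])
    \<comment> \<open>Since d = h^2 / 4, a factor 4 in the size of the residual is given away
      here.\<close>
    have 3: "ennreal (\<bar>1 / (h n)\<^sup>2\<bar> powr p) * lp_int p (g n) \<le> lp_int p (b n)"
      unfolding lp_int_cmult[OF gm, symmetric]
    proof (rule lp_int_mono)
      fix z
      have "\<bar>1 / (h n)\<^sup>2 * g n z\<bar> = \<bar>g n z\<bar> / (h n)\<^sup>2" by (simp add: abs_mult)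
      also have "\<dots> \<le> \<bar>g n z\<bar> / d n" using h[of n] d[of n] by (intro divide_left_mono) (auto simp: d_def)
      also have "\<dots> = \<bar>b n z\<bar>" using d[of n] by (simp add: b_def)
      finally show "\<bar>1 / (h n)\<^sup>2 * g n z\<bar> \<le> \<bar>b n z\<bar>" .
    qed (use p in simp)
    have "lp_int p (a n) \<le> ennreal (\<bar>1 / (h n)\<^sup>2\<bar> powr p) * (ennreal M * lp_int p (g n))"
      unfolding 2 by (intro mult_left_mono 1) simp
    also have "\<dots> = ennreal M * (ennreal (\<bar>1 / (h n)\<^sup>2\<bar> powr p) * lp_int p (g n))" by (rule mult.left_commute)
    also have "\<dots> \<le> ennreal M * lp_int p (b n)" by (intro mult_left_mono 3) simp
    finally show ?thesis .
  qed
  have "lp_int p D = (\<integral>\<^sup>+z. liminf (\<lambda>n. ennreal (\<bar>a n z\<bar> powr p)) \<partial>lborel)"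
    unfolding lp_int_def
  proof (rule nn_integral_cong)
    fix z
    have nz: "h n \<noteq> 0" for n using h[of n] by auto
    have "(\<lambda>n. a n z) \<longlonglongrightarrow> D z" unfolding a_def D_def by (intro sdiff_quotient_tendsto su h0 nz tendsto_const)
    then have "(\<lambda>n. ennreal (\<bar>a n z\<bar> powr p)) \<longlonglongrightarrow> ennreal (\<bar>D z\<bar> powr p)"
      using p by (intro tendsto_ennrealI tendsto_powr' tendsto_rabs) auto
    then show "ennreal (\<bar>D z\<bar> powr p) = liminf (\<lambda>n. ennreal (\<bar>a n z\<bar> powr p))"
      using lim_imp_Liminf[of sequentially] by fastforce
  qed
  also have "\<dots> \<le> liminf (\<lambda>n. lp_int p (a n))"
    unfolding lp_int_def by (rule nn_integral_liminf) auto
  also have "\<dots> \<le> liminf (\<lambda>n. ennreal M * lp_int p (b n))"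
    by (intro Liminf_mono always_eventually allI le)
  also have "\<dots> = ennreal M * lp_int p f"
    by (intro lim_imp_Liminf ennreal_tendsto_cmult lim_b) auto
  finally show ?thesis by (simp add: D_def f_def[abs_def] E_def)
qed

subsection \<open>Second-order operators in coordinates\<close>

lemma Pair_eq_sum_e_x: "(0, y) = (\<Sum>i\<in>UNIV. y $ i *\<^sub>R e_x i)"
proof -
  have "y = (\<Sum>i\<in>UNIV. y $ i *\<^sub>R axis i 1)"
    using basis_expansion[of y] by (simp add: scalar_mult_eq_scaleR)
  then show ?thesis by (simp add: prod_eq_iff fst_sum snd_sum e_x_def)
qed

lemma pderiv2_coordinates:
  assumes "smooth u"
  shows "pderiv (0, y) (pderiv (0, y) u) z = (\<Sum>i\<in>UNIV. \<Sum>j\<in>UNIV. y $ i * y $ j * pderiv (e_x i) (pderiv (e_x j) u) z)"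
  unfolding Pair_eq_sum_e_x[of y] by (rule pderiv2_sum_direction[OF assms]) simp

lemma bounded_image_abs_le:
  fixes g :: "real \<Rightarrow> real"
  assumes "\<And>K. compact K \<Longrightarrow> bounded (g ` K)"
  shows "\<exists>b. \<forall>t. \<bar>t\<bar> \<le> r \<longrightarrow> \<bar>g t\<bar> \<le> b"
proof -
  obtain b where b: "\<And>t. t \<in> {-r..r} \<Longrightarrow> \<bar>g t\<bar> \<le> b"
    using assms[of "{-r..r}"] unfolding bounded_iff by (metis compact_Icc imageI real_norm_def)
  have "\<bar>g t\<bar> \<le> b" if "\<bar>t\<bar> \<le> r" for t
    using that by (intro b) (simp add: abs_le_iff)
  then show ?thesis by blast
qed

text \<open>The bound \<open>ell\<close> says that c - \<xi> \<xi>^T is non-negative, so this matrix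
  is a sum of measurable squares. The vectors \<sigma> l are controlled locally by the diagonal of
  c, because the squares of their entries sum to the diagonal of the remainder.\<close>

lemma Lop_direction_estimate:
  fixes c :: "real \<Rightarrow> real^'n^'n" and \<xi> :: "real^'n"
  assumes reg: "\<And>e::real^'n. e \<noteq> 0 \<Longrightarrow> lp_regular p M e (\<lambda>n. avg3 e)" and p: "1 < p" and M: "0 \<le> M"
    and sym: "\<And>t i j. c t $ i $ j = c t $ j $ i"
    and cm[measurable]: "\<And>i j. (\<lambda>t. c t $ i $ j) \<in> borel_measurable borel"
    and cb: "\<And>i j K. compact K \<Longrightarrow> bounded ((\<lambda>t. c t $ i $ j) ` K)"
    and ell: "\<And>t \<eta>. (\<xi> \<bullet> \<eta>)\<^sup>2 \<le> (\<Sum>i\<in>UNIV. \<Sum>j\<in>UNIV. c t $ i $ j * \<eta> $ i * \<eta> $ j)"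
    and u: "C0_infty u"
  shows "lp_int p (pderiv (0, \<xi>) (pderiv (0, \<xi>) u)) \<le> ennreal M * lp_int p (\<lambda>z. pderiv e_t u z + Lop c u z)"
proof (cases "\<xi> = 0")
  \<comment> \<open>This occurs in the polarization when the two indices agree, as one of the two
    directions is then 0.\<close>
  case True
  have "pderiv (0, \<xi>) (pderiv (0, \<xi>) u) z = 0" for z
    unfolding True zero_prod_def[symmetric] by (simp add: pderiv_def)
  then have "lp_int p (pderiv (0, \<xi>) (pderiv (0, \<xi>) u)) = 0" by (rule lp_int_zero)
  then show ?thesis by simp
next
  case False
  define C where "C t i j = c t $ i $ j - \<xi> $ i * \<xi> $ j" for t i j
  have "0 \<le> qform (C t) \<eta>" for t \<eta>
  proof -
    have "(\<xi> \<bullet> (\<chi> i. \<eta> i))\<^sup>2 = (\<Sum>i\<in>UNIV. \<Sum>j\<in>UNIV. \<xi> $ i * \<xi> $ j * \<eta> i * \<eta> j)"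
      by (simp add: inner_vec_def power2_eq_square sum_product mult_ac)
    then have "qform (C t) \<eta> = (\<Sum>i\<in>UNIV. \<Sum>j\<in>UNIV. c t $ i $ j * (\<chi> i. \<eta> i) $ i * (\<chi> i. \<eta> i) $ j) - (\<xi> \<bullet> (\<chi> i. \<eta> i))\<^sup>2"
      by (simp add: qform_def C_def left_diff_distrib sum_subtractf)
    then show ?thesis using ell[where t = t and \<eta> = "\<chi> i. \<eta> i"] by simp
  qed
  moreover have "C t i j = C t j i" for t i j using sym by (simp add: C_def mult.commute)
  moreover have "(\<lambda>t. C t i j) \<in> borel_measurable borel" for i j unfolding C_def by measurable
  ultimately obtain s :: "'n \<Rightarrow> real \<Rightarrow> 'n \<Rightarrow> real" where s: "\<And>l i. (\<lambda>t. s l t i) \<in> borel_measurable borel"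
    "\<And>t i j. C t i j = (\<Sum>l\<in>UNIV. s l t i * s l t j)"
    using psd_square_decomposition[of C] by blast
  define \<sigma> :: "'n \<Rightarrow> real \<Rightarrow> real^'n" where "\<sigma> l t = (\<chi> i. s l t i)" for l t
  have \<sigma>m: "\<sigma> l \<in> borel_measurable borel" for l
    unfolding borel_measurable_euclidean_space[of "\<sigma> l"] by (auto simp: Basis_vec_def \<sigma>_def inner_axis s)
  have \<sigma>b: "\<exists>S. \<forall>l\<in>UNIV. \<forall>t. \<bar>t\<bar> \<le> r \<longrightarrow> norm (\<sigma> l t) \<le> S" for r
  proof -
    have "\<exists>B. \<forall>t. \<bar>t\<bar> \<le> r \<longrightarrow> \<bar>c t $ i $ i\<bar> \<le> B" for i
      using bounded_image_abs_le[OF cb] by blast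
    then obtain B where B: "\<And>i t. \<bar>t\<bar> \<le> r \<Longrightarrow> \<bar>c t $ i $ i\<bar> \<le> B i" by metis
    have "norm (\<sigma> l t) \<le> (\<Sum>i\<in>UNIV. B i + 1)" if t: "\<bar>t\<bar> \<le> r" for l t
    proof -
      \<comment> \<open>From s^2 \<le> B follows 2 |s| \<le> B + 1, which avoids a square
        root.\<close>
      have "\<bar>s l t i\<bar> \<le> B i + 1" for i
      proof -
        have "s l t i * s l t i \<le> (\<Sum>l\<in>UNIV. s l t i * s l t i)"
          by (intro member_le_sum) auto
        also have "\<dots> = C t i i" by (simp add: s)
        also have "\<dots> \<le> c t $ i $ i" by (simp add: C_def)
        also have "\<dots> \<le> B i" using B[OF t, of i] by simp
        finally have "\<bar>s l t i\<bar>\<^sup>2 \<le> B i" by (simp add: power2_eq_square)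
        moreover have "0 \<le> (\<bar>s l t i\<bar> - 1)\<^sup>2" by simp
        ultimately show ?thesis by (simp add: power2_diff)
      qed
      then have "(\<Sum>i\<in>UNIV. \<bar>\<sigma> l t $ i\<bar>) \<le> (\<Sum>i\<in>UNIV. B i + 1)" by (intro sum_mono) (simp add: \<sigma>_def)
      then show ?thesis using norm_le_l1_cart[of "\<sigma> l t"] by linarith
    qed
    then show ?thesis by blast
  qed
  have "pderiv e_t u z + Lop c u z = pderiv (1, 0) u z + pderiv (0, \<xi>) (pderiv (0, \<xi>) u) z
    + (\<Sum>l\<in>UNIV. pderiv (0, \<sigma> l (fst z)) (pderiv (0, \<sigma> l (fst z)) u) z)" for z
  proof -
    let ?D = "\<lambda>i j. pderiv (e_x i) (pderiv (e_x j) u) z"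
    have "(\<Sum>l\<in>UNIV. pderiv (0, \<sigma> l (fst z)) (pderiv (0, \<sigma> l (fst z)) u) z)
      = (\<Sum>l\<in>UNIV. \<Sum>i\<in>UNIV. \<Sum>j\<in>UNIV. s l (fst z) i * s l (fst z) j * ?D i j)"
      by (simp add: pderiv2_coordinates[OF C0_infty_smooth[OF u]] \<sigma>_def)
    also have "\<dots> = (\<Sum>i\<in>UNIV. \<Sum>j\<in>UNIV. C (fst z) i j * ?D i j)"
    proof -
      have "(\<Sum>l\<in>UNIV. \<Sum>i\<in>UNIV. \<Sum>j\<in>UNIV. s l (fst z) i * s l (fst z) j * ?D i j)
        = (\<Sum>i\<in>UNIV. \<Sum>l\<in>UNIV. \<Sum>j\<in>UNIV. s l (fst z) i * s l (fst z) j * ?D i j)" by (rule sum.swap)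
      also have "\<dots> = (\<Sum>i\<in>UNIV. \<Sum>j\<in>UNIV. \<Sum>l\<in>UNIV. s l (fst z) i * s l (fst z) j * ?D i j)"
        by (rule sum.cong[OF refl], rule sum.swap)
      finally show ?thesis by (simp only: s(2) sum_distrib_right)
    qed
    finally have "(\<Sum>l\<in>UNIV. pderiv (0, \<sigma> l (fst z)) (pderiv (0, \<sigma> l (fst z)) u) z) = Lop c u z - pderiv (0, \<xi>) (pderiv (0, \<xi>) u) z"
      by (simp add: pderiv2_coordinates[OF C0_infty_smooth[OF u], of \<xi>] Lop_def C_def left_diff_distrib sum_subtractf)
    then show ?thesis by (simp add: e_t_def)
  qed
  then show ?thesis
    using parabolic_direction_estimate[OF reg p M u False _ _ \<sigma>m \<sigma>b] by simp
qed

section \<open>From directional estimates to mixed derivatives and norms\<close>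

lemma lp_int_diff_le:
  fixes f g :: "'a::euclidean_space \<Rightarrow> real"
  assumes [measurable]: "f \<in> borel_measurable borel" "g \<in> borel_measurable borel" and "0 \<le> p"
  shows "lp_int p (\<lambda>x. f x - g x) \<le> ennreal (2 powr p) * (lp_int p f + lp_int p g)"
proof -
  have "\<bar>f x - g x\<bar> powr p \<le> 2 powr p * (\<bar>f x\<bar> powr p + \<bar>g x\<bar> powr p)" for x
  proof -
    have "\<bar>f x - g x\<bar> powr p \<le> (2 * max \<bar>f x\<bar> \<bar>g x\<bar>) powr p" using assms(3) by (intro powr_mono2) auto
    also have "\<dots> = 2 powr p * max \<bar>f x\<bar> \<bar>g x\<bar> powr p" by (simp add: powr_mult)
    also have "\<dots> \<le> 2 powr p * (\<bar>f x\<bar> powr p + \<bar>g x\<bar> powr p)"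
      by (intro mult_left_mono) (auto simp: max_def)
    finally show ?thesis .
  qed
  then have "lp_int p (\<lambda>x. f x - g x) \<le> (\<integral>\<^sup>+x. ennreal (2 powr p * (\<bar>f x\<bar> powr p + \<bar>g x\<bar> powr p)) \<partial>lborel)"
    unfolding lp_int_def by (intro nn_integral_mono ennreal_leI)
  also have "\<dots> = ennreal (2 powr p) * (lp_int p f + lp_int p g)"
    unfolding lp_int_def by (simp add: ennreal_mult nn_integral_cmult nn_integral_add)
  finally show ?thesis .
qed

text \<open>Completion does not change the integral of a Borel function. If the integral diverges,
  both sides are 0 by their default values.\<close>

lemma Lp_norm_eq_lp_int:
  assumes [measurable]: "g \<in> borel_measurable borel"
  shows "Lp_norm p g = enn2real (lp_int p g) powr (1 / p)"
proof -
  have "(\<integral>z. \<bar>g z\<bar> powr p \<partial>lebesgue) = (\<integral>z. \<bar>g z\<bar> powr p \<partial>lborel)"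
    by (rule integral_completion) measurable
  also have "\<dots> = enn2real (lp_int p g)"
    unfolding lp_int_def by (rule integral_eq_nn_integral) auto
  finally show ?thesis by (simp add: Lp_norm_def)
qed

text \<open>The pure second derivatives of half-sum and half-difference cancel, and commutation
  merges the two mixed terms. The factor 1/2 keeps both directions within the ellipticity
  bound.\<close>

lemma pderiv_mixed_polarization:
  fixes u :: "real \<times> (real^'n) \<Rightarrow> real"
  assumes "smooth u"
  shows "pderiv (e_x i) (pderiv (e_x j) u) z
    = pderiv (0, (1/2) *\<^sub>R (axis i 1 + axis j 1)) (pderiv (0, (1/2) *\<^sub>R (axis i 1 + axis j 1)) u) z
    - pderiv (0, (1/2) *\<^sub>R (axis i 1 - axis j 1)) (pderiv (0, (1/2) *\<^sub>R (axis i 1 - axis j 1)) u) z"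
proof -
  \<comment> \<open>Indexed by truth values and not by the set of i and j, so that i = j needs no
    separate case.\<close>
  define b :: "bool \<Rightarrow> real \<times> (real^'n)" where "b x = (if x then e_x i else e_x j)" for x
  have *: "(\<Sum>x\<in>UNIV. (if x then 1/2 else r/2) *\<^sub>R b x) = (0, (1/2) *\<^sub>R (axis i 1 + r *\<^sub>R axis j 1))" for r :: real
    by (simp add: UNIV_bool b_def e_x_def algebra_simps)
  have D: "pderiv (0, (1/2) *\<^sub>R (axis i 1 + r *\<^sub>R axis j 1)) (pderiv (0, (1/2) *\<^sub>R (axis i 1 + r *\<^sub>R axis j 1)) u) z
    = (pderiv (e_x i) (pderiv (e_x i) u) z + r * pderiv (e_x i) (pderiv (e_x j) u) z
     + r * pderiv (e_x j) (pderiv (e_x i) u) z + r\<^sup>2 * pderiv (e_x j) (pderiv (e_x j) u) z) / 4" for r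
    unfolding *[symmetric] using assms
    by (subst pderiv2_sum_direction) (auto simp: UNIV_bool b_def power2_eq_square field_simps)
  show ?thesis
    using D[of 1] D[of "-1"] pderiv_commute[OF assms, of "e_x j" "e_x i" z] by (simp add: field_simps)
qed

text \<open>Finiteness is required for the conversion to real numbers, where an infinite right side
  would become 0 and spoil the inequality. It comes from compact support and local boundedness of c,
  and the bound found here does not enter the constant.\<close>

lemma parabolic_rhs:
  fixes c :: "real \<Rightarrow> real^'n^'n"
  assumes u: "C0_infty u" and p: "0 < p"
    and cm[measurable]: "\<And>i j. (\<lambda>t. c t $ i $ j) \<in> borel_measurable borel"
    and cb: "\<And>i j K. compact K \<Longrightarrow> bounded ((\<lambda>t. c t $ i $ j) ` K)"
  shows "(\<lambda>z. pderiv e_t u z + Lop c u z) \<in> borel_measurable borel"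
    and "lp_int p (\<lambda>z. pderiv e_t u z + Lop c u z) < \<infinity>"
proof -
  let ?D = "\<lambda>i j. pderiv (e_x i) (pderiv (e_x j) u)"
  let ?f = "\<lambda>z. pderiv e_t u z + Lop c u z"
  have D0: "C0_infty (?D i j)" for i j by (intro C0_infty_pderiv u)
  have Dm: "?D i j \<in> borel_measurable borel" for i j by (intro smooth_measurable C0_infty_smooth D0)
  have cm': "(\<lambda>z. c (fst z) $ i $ j) \<in> borel_measurable borel" for i j
    by (rule measurable_compose[OF _ cm]) (intro borel_measurable_continuous_onI continuous_intros)
  show m: "?f \<in> borel_measurable borel"
    unfolding Lop_def
    by (intro borel_measurable_add borel_measurable_sum borel_measurable_times cm' Dm smooth_measurable smooth_pderiv C0_infty_smooth u)
  obtain B0 where B0: "0 < B0" "\<And>z. \<bar>pderiv e_t u z\<bar> \<le> B0" using C0_infty_bounded[OF C0_infty_pderiv[OF u, of e_t]] by blast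
  have "\<exists>B>0. \<forall>z. \<bar>?D i j z\<bar> \<le> B" for i j using C0_infty_bounded[OF D0] by metis
  then obtain B where B: "\<And>i j. 0 < B i j" "\<And>i j z. \<bar>?D i j z\<bar> \<le> B i j" by metis
  obtain K where K: "compact K" "\<And>z. z \<notin> K \<Longrightarrow> u z = 0" using u by (auto simp: C0_infty_def)
  obtain r where r: "\<And>z. z \<in> K \<Longrightarrow> norm z \<le> r" using compact_imp_bounded[OF K(1)] by (auto simp: bounded_iff)
  note der0 = pderiv_zero_outside[OF compact_imp_closed[OF K(1)]]
  have f0: "?f z = 0" if "r < norm z" for z
  proof -
    have z: "z \<notin> K" using r[of z] that by auto
    have "pderiv e_t u z = 0" "?D i j z = 0" for i j
      by (intro der0 z K(2); assumption)+
    then show ?thesis by (simp add: Lop_def)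
  qed
  have "\<exists>b. \<forall>t. \<bar>t\<bar> \<le> r \<longrightarrow> \<bar>c t $ i $ j\<bar> \<le> b" for i j
    using bounded_image_abs_le[OF cb] by blast
  then obtain b where b: "\<And>i j t. \<bar>t\<bar> \<le> r \<Longrightarrow> \<bar>c t $ i $ j\<bar> \<le> b i j" by metis
  define k where "k = B0 + (\<Sum>i\<in>UNIV. \<Sum>j\<in>UNIV. b i j * B i j)"
  have fb: "\<bar>?f z\<bar> \<le> k" if "norm z \<le> r" for z
  proof -
    have t: "\<bar>fst z\<bar> \<le> r" using that norm_fst_le[of "fst z" "snd z"] by simp
    have "\<bar>Lop c u z\<bar> \<le> (\<Sum>i\<in>UNIV. \<Sum>j\<in>UNIV. \<bar>c (fst z) $ i $ j * ?D i j z\<bar>)"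
      unfolding Lop_def by (intro order_trans[OF sum_abs] sum_mono order_refl)
    also have "\<dots> \<le> (\<Sum>i\<in>UNIV. \<Sum>j\<in>UNIV. b i j * B i j)"
      unfolding abs_mult using B b[OF t] order_trans[OF abs_ge_zero b[OF t]] by (intro sum_mono mult_mono) auto
    finally show ?thesis using B0(2)[of z] abs_triangle_ineq[of "pderiv e_t u z" "Lop c u z"] by (simp add: k_def)
  qed
  define w where "w z = ennreal (k powr p) * indicator (cball 0 r) z" for z :: "real \<times> (real^'n)"
  have "lp_int p ?f \<le> (\<integral>\<^sup>+z. w z \<partial>lborel)"
    unfolding lp_int_def
  proof (rule nn_integral_mono)
    fix z
    show "ennreal (\<bar>?f z\<bar> powr p) \<le> w z"
    proof (cases "r < norm z")
      case True
      then show ?thesis using f0[OF True] by simp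
    next
      case False
      then have "w z = ennreal (k powr p)" by (simp add: w_def)
      moreover have "\<bar>?f z\<bar> powr p \<le> k powr p" using fb[of z] False p by (intro powr_mono2) auto
      ultimately show ?thesis by (simp add: ennreal_leI)
    qed
  qed
  also have "\<dots> < \<infinity>" unfolding w_def by (rule cball_majorant)
  finally show "lp_int p ?f < \<infinity>" .
qed

theorem theorem2p4:
  fixes p0 :: nat and p :: real
  assumes "1 \<le> p0" and "p0 \<le> card (UNIV :: ('n::{finite,linorder}) set)" and "1 < p"
  shows "\<exists>M0::real. \<forall>c :: real \<Rightarrow> ((real, 'n) vec, 'n) vec.
    ((\<forall>t i j. c t $ i $ j = c t $ j $ i)
     \<and> (\<forall>i j. (\<lambda>t. c t $ i $ j) \<in> borel_measurable borel)
     \<and> (\<forall>i j K. compact K \<longrightarrow> bounded ((\<lambda>t. c t $ i $ j) ` K))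
     \<and> (\<forall>t \<xi>. (\<Sum>i\<in>UNIV. \<Sum>j\<in>UNIV. c t $ i $ j * \<xi> $ i * \<xi> $ j) \<ge> 0)
     \<and> (\<forall>t \<xi>. (\<Sum>i\<in>UNIV. \<Sum>j\<in>UNIV. c t $ i $ j * \<xi> $ i * \<xi> $ j)
                \<ge> (\<Sum>j\<in>first_coords p0. (\<xi> $ j)\<^sup>2)))
    \<longrightarrow> (\<forall>u :: real \<times> (real, 'n) vec \<Rightarrow> real. C0_infty u \<longrightarrow>
          (\<forall>i\<in>first_coords p0. \<forall>j\<in>first_coords p0.
             Lp_norm p (pderiv (e_x i) (pderiv (e_x j) u))
               \<le> M0 * Lp_norm p (\<lambda>z. pderiv e_t u z + Lop c u z)))"
proof -
  obtain M where M: "0 \<le> M" "\<And>e::(real, 'n) vec. e \<noteq> 0 \<Longrightarrow> lp_regular p M e (\<lambda>n. avg3 e)"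
    using lp_regular_avg3[OF assms(3)] by blast
  \<comment> \<open>2^p from splitting a difference, and 2 M from one directional estimate for each
    of its two terms. Nothing here depends on c.\<close>
  define k where "k = 2 powr p * (2 * M)"
  have k: "0 \<le> k" using M by (simp add: k_def)
  show ?thesis
  proof (intro exI[of _ "k powr (1 / p)"] allI impI ballI, elim conjE)
    fix c :: "real \<Rightarrow> ((real, 'n) vec, 'n) vec" and u :: "real \<times> (real, 'n) vec \<Rightarrow> real" and i j :: 'n
    assume sym: "\<forall>t i j. c t $ i $ j = c t $ j $ i"
      and cm: "\<forall>i j. (\<lambda>t. c t $ i $ j) \<in> borel_measurable borel"
      and cb: "\<forall>i j K. compact K \<longrightarrow> bounded ((\<lambda>t. c t $ i $ j) ` K)"
      and ell: "\<forall>t \<xi>. (\<Sum>i\<in>UNIV. \<Sum>j\<in>UNIV. c t $ i $ j * \<xi> $ i * \<xi> $ j) \<ge> (\<Sum>j\<in>first_coords p0. (\<xi> $ j)\<^sup>2)"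
      and u: "C0_infty u" and ij: "i \<in> first_coords p0" "j \<in> first_coords p0"
    let ?f = "\<lambda>z. pderiv e_t u z + Lop c u z"
    define \<xi> :: "real \<Rightarrow> (real, 'n) vec" where "\<xi> r = (1/2) *\<^sub>R (axis i 1 + r *\<^sub>R axis j 1)" for r
    define D where "D r = pderiv (0, \<xi> r) (pderiv (0, \<xi> r) u)" for r
    have Dm: "D r \<in> borel_measurable borel" for r
      unfolding D_def by (intro smooth_measurable smooth_pderiv C0_infty_smooth u)
    have le: "lp_int p (D r) \<le> ennreal M * lp_int p ?f" if r: "\<bar>r\<bar> = 1" for r
      unfolding D_def
    proof (rule Lop_direction_estimate[OF M(2) assms(3) M(1) _ _ _ _ u])
      fix t and \<eta> :: "(real, 'n) vec"
      have "\<xi> r \<bullet> \<eta> = (\<eta> $ i + r * \<eta> $ j) / 2"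
        by (simp add: \<xi>_def inner_add_left inner_axis')
      then have 1: "4 * (\<xi> r \<bullet> \<eta>)\<^sup>2 = (\<eta> $ i + r * \<eta> $ j)\<^sup>2"
        by (simp only:) (simp add: power_divide)
      have "r\<^sup>2 = 1" using r by (simp add: abs_square_eq_1)
      moreover have "(\<eta> $ i + r * \<eta> $ j)\<^sup>2 + (\<eta> $ i - r * \<eta> $ j)\<^sup>2 = 2 * (\<eta> $ i)\<^sup>2 + 2 * (r\<^sup>2 * (\<eta> $ j)\<^sup>2)"
        by (simp add: power2_eq_square algebra_simps)
      ultimately have 2: "(\<eta> $ i + r * \<eta> $ j)\<^sup>2 + (\<eta> $ i - r * \<eta> $ j)\<^sup>2 = 2 * (\<eta> $ i)\<^sup>2 + 2 * (\<eta> $ j)\<^sup>2"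
        by simp
      have "2 * x \<le> a + b" if "4 * x = y" "y + y' = 2 * a + 2 * b" "0 \<le> y'" for x y y' a b :: real
        using that by simp
      \<comment> \<open>Parallelogram law. For i = j both squares on the right are the same
        coordinate, so only twice the sum over the first coordinates bounds them; the 2 on the left
        matches this.\<close>
      from this[OF 1 2] have 3: "2 * (\<xi> r \<bullet> \<eta>)\<^sup>2 \<le> (\<eta> $ i)\<^sup>2 + (\<eta> $ j)\<^sup>2" by simp
      have 4: "(\<eta> $ l)\<^sup>2 \<le> (\<Sum>j\<in>first_coords p0. (\<eta> $ j)\<^sup>2)" if "l \<in> first_coords p0" for l
        using that by (intro member_le_sum[where f = "\<lambda>j. (\<eta> $ j)\<^sup>2"]) auto
      from 4[OF ij(1)] 4[OF ij(2)] 3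
      have "(\<xi> r \<bullet> \<eta>)\<^sup>2 \<le> (\<Sum>j\<in>first_coords p0. (\<eta> $ j)\<^sup>2)" by linarith
      then show "(\<xi> r \<bullet> \<eta>)\<^sup>2 \<le> (\<Sum>i\<in>UNIV. \<Sum>j\<in>UNIV. c t $ i $ j * \<eta> $ i * \<eta> $ j)"
        using ell[rule_format, of \<eta> t] by linarith
    qed (use sym cm cb in auto)
    have fm: "?f \<in> borel_measurable borel" and ffin: "lp_int p ?f < \<infinity>"
      using parabolic_rhs[OF u, of p c] cm cb assms(3) by auto
    have Dij: "pderiv (e_x i) (pderiv (e_x j) u) = (\<lambda>z. D 1 z - D (- 1) z)"
      using pderiv_mixed_polarization[OF C0_infty_smooth[OF u], of i j] by (simp add: D_def \<xi>_def fun_eq_iff)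
    have m: "(\<lambda>z. D 1 z - D (- 1) z) \<in> borel_measurable borel"
      by (intro borel_measurable_diff Dm)
    have "lp_int p (\<lambda>z. D 1 z - D (- 1) z) \<le> ennreal (2 powr p) * (lp_int p (D 1) + lp_int p (D (- 1)))"
      using assms(3) by (intro lp_int_diff_le Dm) simp
    also have "\<dots> \<le> ennreal (2 powr p) * (ennreal M * lp_int p ?f + ennreal M * lp_int p ?f)"
      by (intro mult_left_mono add_mono le) auto
    also have "\<dots> = ennreal k * lp_int p ?f"
    proof -
      have "ennreal k = ennreal (2 powr p) * ennreal (M + M)"
        unfolding k_def mult_2 by (rule ennreal_mult) (use M(1) in auto)
      moreover have "ennreal (M + M) = ennreal M + ennreal M" by (intro ennreal_plus M(1))
      ultimately show ?thesis by (simp only: distrib_right mult.assoc)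
    qed
    finally have "lp_int p (\<lambda>z. D 1 z - D (- 1) z) \<le> ennreal k * lp_int p ?f" .
    then have "enn2real (lp_int p (\<lambda>z. D 1 z - D (- 1) z)) \<le> enn2real (ennreal k * lp_int p ?f)"
      using ffin by (intro enn2real_mono) (auto simp: ennreal_mult_less_top)
    also have "\<dots> = k * enn2real (lp_int p ?f)" using k by (simp add: enn2real_mult)
    finally have "enn2real (lp_int p (\<lambda>z. D 1 z - D (- 1) z)) powr (1 / p) \<le> (k * enn2real (lp_int p ?f)) powr (1 / p)"
      using assms(3) by (intro powr_mono2) auto
    also have "\<dots> = k powr (1 / p) * enn2real (lp_int p ?f) powr (1 / p)"
      using k by (simp add: powr_mult)
    finally show "Lp_norm p (pderiv (e_x i) (pderiv (e_x j) u)) \<le> k powr (1 / p) * Lp_norm p ?f"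
      unfolding Dij Lp_norm_eq_lp_int[OF m] Lp_norm_eq_lp_int[OF fm] .
  qed
qed

end
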